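(* Assume the Hitting Set Conjecture: when $d=\Theta(\log^2 n)$, for every constant $\delta>0$, no randomized algorithm solves the Hitting Set problem on inputs $A,B\subseteq\{0,1\}^d$ with $|A|,|B|\le n$ in $O(n^{2-\delta})$ time. Let $ALG$ be an algorithm that, given sets $A'',B''\subset\{0,1\}^D$ of sizes at most $N$, with $D=\Theta(\log^2 N)$ and $\varepsilon=\Theta(1)/D$, reports a mapping $g:A''\to B''$ whose cost $\sum_{a\in A''}\|a-g(a)\|_1$ is at most $(1+\varepsilon)\,\mathrm{CH}(A'',B'')$, and let $T(N,D,\varepsilon)$ be its running time. Then $T(N,D,\varepsilon)=\Omega(N^{2-\delta})$ for every constant $\delta>0$.
   Context: The Chamfer distance (with respect to the Manhattan distance) is $\mathrm{CH}(A,B)=\sum_{a\in A}\min_{b\in B}\|a-b\|_1$. The Hitting Set problem: given $A,B\subseteq\{0,1\}^d$, determine whether there exists $a\in A$ such that $a\cdot b\ne 0$ for every $b\in B$ (such an $a$ is said to hit $B$). *)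

theory Defs
  imports "HOL-Probability.Probability" "HOL-Library.Landau_Symbols"
begin

section \<open>Hitting Set and Chamfer distance\<close>

definition cube :: "nat \<Rightarrow> nat list set" where
  "cube d = {x. length x = d \<and> set x \<subseteq> {0, 1}}"

definition dot :: "nat list \<Rightarrow> nat list \<Rightarrow> nat" where
  "dot a b = (\<Sum>i<length a. a ! i * b ! i)"

definition hits :: "nat list \<Rightarrow> nat list set \<Rightarrow> bool" where
  "hits a B \<longleftrightarrow> (\<forall>b\<in>B. dot a b \<noteq> 0)"

definition l1_dist :: "nat list \<Rightarrow> nat list \<Rightarrow> real" where
  "l1_dist a b = (\<Sum>i<length a. \<bar>real (a ! i) - real (b ! i)\<bar>)"

definition chamfer :: "nat list set \<Rightarrow> nat list set \<Rightarrow> real" where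
  "chamfer A B = (\<Sum>a\<in>A. Min (l1_dist a ` B))"


section \<open>Randomized word RAM\<close>

text \<open>
  The machine has registers and a random-access memory, both indexed by natural numbers and
  both holding words of \<open>w\<close> bits; programs are structured, and every command takes unit time.
  An expression in a program has fixed size, so evaluating it in one step only affects running
  times by a constant factor that depends on the program. All arithmetic is modulo \<open>2 ^ w\<close>,
  except that subtraction is truncated at zero. The command \<open>Flip r\<close> stores a fresh fair coin
  toss in register \<open>r\<close>.
\<close>

datatype binop = Add | Sub | Mul | Div | Mod | And | Or | Xor | Shl | Shr | Less | Equal

datatype expr = Num nat | Reg nat | Mem expr | Bin binop expr expr

datatype cmd =
    Skip
  | Assign nat expr
  | Store expr expr
  | Flip nat
  | Seq cmd cmd
  | If expr cmd cmd
  | While expr cmd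

type_synonym state = "(nat \<Rightarrow> nat) \<times> (nat \<Rightarrow> nat)"

fun apply_binop :: "binop \<Rightarrow> nat \<Rightarrow> nat \<Rightarrow> nat" where
  "apply_binop Add a b = a + b"
| "apply_binop Sub a b = a - b"
| "apply_binop Mul a b = a * b"
| "apply_binop Div a b = a div b"
| "apply_binop Mod a b = a mod b"
| "apply_binop And a b = Bit_Operations.and a b"
| "apply_binop Or a b = Bit_Operations.or a b"
| "apply_binop Xor a b = Bit_Operations.xor a b"
| "apply_binop Shl a b = push_bit b a"
| "apply_binop Shr a b = drop_bit b a"
| "apply_binop Less a b = of_bool (a < b)"
| "apply_binop Equal a b = of_bool (a = b)"

fun eval_expr :: "nat \<Rightarrow> state \<Rightarrow> expr \<Rightarrow> nat" where
  "eval_expr w s (Num k) = k mod 2 ^ w"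
| "eval_expr w s (Reg r) = fst s r mod 2 ^ w"
| "eval_expr w s (Mem e) = snd s (eval_expr w s e) mod 2 ^ w"
| "eval_expr w s (Bin f e1 e2) = apply_binop f (eval_expr w s e1) (eval_expr w s e2) mod 2 ^ w"

text \<open>
  A configuration is the list of commands that remain to be executed together with the current
  state; the machine has halted when the list is empty.
\<close>

type_synonym config = "cmd list \<times> state"

fun step :: "nat \<Rightarrow> config \<Rightarrow> config pmf" where
  "step w ([], s) = return_pmf ([], s)"
| "step w (Skip # k, s) = return_pmf (k, s)"
| "step w (Assign r e # k, s) = return_pmf (k, ((fst s)(r := eval_expr w s e), snd s))"
| "step w (Store e1 e2 # k, s) =
     return_pmf (k, (fst s, (snd s)(eval_expr w s e1 := eval_expr w s e2)))"
| "step w (Flip r # k, s) =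
     map_pmf (\<lambda>b. (k, ((fst s)(r := of_bool b mod 2 ^ w), snd s))) (bernoulli_pmf (1/2))"
| "step w (Seq p q # k, s) = return_pmf (p # q # k, s)"
| "step w (If e p q # k, s) = return_pmf ((if eval_expr w s e \<noteq> 0 then p else q) # k, s)"
| "step w (While e p # k, s) =
     return_pmf (if eval_expr w s e \<noteq> 0 then p # While e p # k else k, s)"

primrec run :: "nat \<Rightarrow> nat \<Rightarrow> config \<Rightarrow> config pmf" where
  "run w 0 c = return_pmf c"
| "run w (Suc t) c = bind_pmf (step w c) (run w t)"

definition init_config :: "cmd \<Rightarrow> nat list \<Rightarrow> config" where
  "init_config P xs = ([P], (\<lambda>_. 0), (\<lambda>i. if i < length xs then xs ! i else 0))"

text \<open>
  On input \<open>xs\<close>, the program \<open>P\<close> halts within \<open>t\<close> steps whatever the outcome of the coin tosses,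
  and with probability at least 2/3 its final memory is a correct output, i.e. satisfies \<open>ok\<close>.
\<close>

definition computes :: "nat \<Rightarrow> cmd \<Rightarrow> nat list \<Rightarrow> nat \<Rightarrow> ((nat \<Rightarrow> nat) \<Rightarrow> bool) \<Rightarrow> bool" where
  "computes w P xs t ok \<longleftrightarrow>
     (\<forall>(k, s) \<in> set_pmf (run w t (init_config P xs)). k = []) \<and>
     measure_pmf.prob (run w t (init_config P xs)) {(k, s). ok (snd s)} \<ge> 2/3"

text \<open>Words of \<open>O(log n)\<close> bits; the constant \<open>c\<close> may depend on the algorithm.\<close>

definition word_size :: "nat \<Rightarrow> nat \<Rightarrow> nat" where
  "word_size c n = c * nat \<lceil>log 2 (real n + 2)\<rceil>"


section \<open>Algorithms for the two problems\<close>

text \<open>A set of at most \<open>n\<close> vectors is presented to an algorithm by listing it in any order.\<close>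

definition lists_set :: "nat list list \<Rightarrow> nat list set \<Rightarrow> nat \<Rightarrow> nat \<Rightarrow> bool" where
  "lists_set xs A n d \<longleftrightarrow> A \<subseteq> cube d \<and> card A \<le> n \<and> distinct xs \<and> set xs = A"

definition encode :: "nat \<Rightarrow> nat \<Rightarrow> nat list list \<Rightarrow> nat list list \<Rightarrow> nat list" where
  "encode n d xs ys = [n, d, length xs, length ys] @ concat xs @ concat ys"

text \<open>The answer is read off memory cell 0, nonzero meaning that a hitting vector exists.\<close>

definition solves_hitting_set :: "nat \<Rightarrow> cmd \<Rightarrow> nat \<Rightarrow> nat \<Rightarrow> nat \<Rightarrow> bool" where
  "solves_hitting_set w P n d t \<longleftrightarrow>
     (\<forall>A B xs ys. lists_set xs A n d \<and> lists_set ys B n d \<longrightarrow>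
        computes w P (encode n d xs ys) t (\<lambda>mem. mem 0 \<noteq> 0 \<longleftrightarrow> (\<exists>a\<in>A. hits a B)))"

text \<open>
  The mapping \<open>g\<close> is reported by indices: memory cell \<open>i\<close> holds the position, in the input
  listing \<open>ys\<close> of \<open>B\<close>, of the image of the \<open>i\<close>-th vector in the listing \<open>xs\<close> of \<open>A\<close>. The set
  \<open>B\<close> must be nonempty for the minima in the Chamfer distance (and for \<open>g\<close>) to exist.
\<close>

definition approximates_chamfer :: "nat \<Rightarrow> cmd \<Rightarrow> nat \<Rightarrow> nat \<Rightarrow> real \<Rightarrow> nat \<Rightarrow> bool" where
  "approximates_chamfer w P n d \<epsilon> t \<longleftrightarrow>
     (\<forall>A B xs ys. lists_set xs A n d \<and> lists_set ys B n d \<and> B \<noteq> {} \<longrightarrow>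
        computes w P (encode n d xs ys) t
          (\<lambda>mem. \<exists>g. (\<forall>a\<in>A. g a \<in> B) \<and>
                     (\<forall>i<length xs. mem i < length ys \<and> g (xs ! i) = ys ! mem i) \<and>
                     (\<Sum>a\<in>A. l1_dist a (g a)) \<le> (1 + \<epsilon>) * chamfer A B))"


section \<open>The Hitting Set Conjecture\<close>

definition hitting_set_conjecture :: bool where
  "hitting_set_conjecture \<longleftrightarrow>
     (\<forall>d. (\<lambda>n. real (d n)) \<in> \<Theta>(\<lambda>n. ln (real n) ^ 2) \<longrightarrow>
        (\<forall>\<delta>>0. \<not> (\<exists>P c t. (\<forall>n. solves_hitting_set (word_size c n) P n (d n) (t n)) \<and>
                        (\<lambda>n. real (t n)) \<in> O(\<lambda>n. real n powr (2 - \<delta>)))))"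

text \<open>
  The conjecture above only says that an algorithm is not fast at all large sizes, so what it
  transfers to other problems is a lower bound in the sense of Hardy and Littlewood:
  \<open>f = \<Omega>(g)\<close> iff \<open>f\<close> is not \<open>o(g)\<close>. A lower bound at all large sizes, which is the meaning of
  \<open>f \<in> \<Omega>(g)\<close> in the library, corresponds to the following version, in which an algorithm
  cannot even be correct and fast at infinitely many sizes. Constant factors in the time bound
  are absorbed by the universally quantified \<open>\<delta>\<close>.
\<close>

definition hitting_set_conjecture_io :: bool where
  "hitting_set_conjecture_io \<longleftrightarrow>
     (\<forall>d. (\<lambda>n. real (d n)) \<in> \<Theta>(\<lambda>n. ln (real n) ^ 2) \<longrightarrow>
        (\<forall>\<delta>>0. \<not> (\<exists>P c t. \<exists>\<^sub>F n in sequentially.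
                        solves_hitting_set (word_size c n) P n (d n) (t n) \<and>
                        real (t n) \<le> real n powr (2 - \<delta>))))"

end

theory Submission
  imports Defs "HOL-Real_Asymp.Real_Asymp"
begin

text \<open>
  For bit vectors \<open>a\<close> and \<open>b\<close> of length \<open>d\<close>, the vectors \<open>(0, a, 0)\<close> and \<open>(b, 1 - b, 0)\<close> of
  length \<open>D\<close> have distance \<open>d - \<bar>a\<bar> + 2 (a \<cdot> b)\<close>. If no \<open>a\<close> hits \<open>B\<close>, the optimal distances are
  at most \<open>d\<close>, so when \<open>d \<le> D / K\<close> for a large constant \<open>K\<close>, a mapping of cost
  \<open>(1 + O(1/D)) CH\<close> is suboptimal for at most a quarter of the vectors; for all others it exhibits
  some \<open>b\<close> with \<open>a \<cdot> b = 0\<close>. Discarding these halves the expected number of candidates, so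
  with good probability none is left after \<open>d \<ge> log (3 n)\<close> rounds, while a hitting vector is never discarded, because
  every discard is certified.

  The function \<open>D\<close> need not be computable, so the Hitting Set program has to work with
  \<open>d = D div K\<close> and tries all residues: for a wrong guess of \<open>D\<close> the Chamfer algorithm may return
  anything or run forever, which is harmless since discards are certified and the algorithm
  is simulated with a clock of about \<open>n\<^sup>2 / n\<^bsup>1/q\<^esup>\<close> ticks.
\<close>

section \<open>Halting with bounded error and deterministic execution\<close>

text \<open>Each call of the algorithm may fail with probability 1/3, and no amplification is used:
  discards are certified, so a failed call costs progress but never correctness. A successful call
  leaves at most a quarter of the candidates, so a well-guessed call shrinks the expectation by a
  factor of at most 2/3 * 1/4 + 1/3 = 1/2, and Markov's inequality turns the expected number of
  survivors into an error probability. The machine model is the other obstacle. The algorithm is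
  only known to be correct for words of exactly \<open>word_size c n\<close> bits, while the solver
  needs longer words to address one memory region per query; hence the program is not called but
  translated, with explicit reductions to the shorter words. Both problems are compared at the same
  size \<open>n\<close>, so one argument serves both forms of the conjecture. At the finitely many
  sizes where the asymptotic estimates fail, the dimension of the Hitting Set problem is set to 0,
  which \<open>solver\<close> treats separately in constant time.\<close>

lemma run_add: "run w (t + u) c = bind_pmf (run w t c) (run w u)"
proof (induction t arbitrary: c)
  case (Suc t)
  have "run w (t + u) = (\<lambda>c. bind_pmf (run w t c) (run w u))"
    by (rule ext) (rule Suc)
  then show ?case by (simp add: bind_assoc_pmf)
qed (simp add: bind_return_pmf)

lemma run_halted [simp]: "run w t ([], s) = return_pmf ([], s)"
  by (induction t) (simp_all add: bind_return_pmf)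

text \<open>Failure is bounded instead of success, and in \<open>ennreal\<close>, so that bounds for
  different branches combine by nonnegative integrals over the coin tosses, without integrability
  conditions. Halting is demanded of every outcome, as in \<open>computes\<close>.\<close>

definition safe :: "nat \<Rightarrow> ((nat \<Rightarrow> nat) \<Rightarrow> bool) \<Rightarrow> nat \<Rightarrow> config \<Rightarrow> ennreal \<Rightarrow> bool" where
  "safe w ok t c e \<longleftrightarrow> (\<forall>(k, s) \<in> set_pmf (run w t c). k = []) \<and>
     emeasure (measure_pmf (run w t c)) {(k, s). \<not> ok (snd s)} \<le> e"

text \<open>Halted configurations are fixed by \<open>step\<close>, so running longer does not
  change the distribution.\<close>

lemma safe_mono:
  assumes "safe w ok t c e" "t \<le> t'" "e \<le> e'"
  shows "safe w ok t' c e'"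
proof -
  obtain u where u: "t' = t + u" using assms(2) le_Suc_ex by blast
  have "run w t' c = bind_pmf (run w t c) return_pmf"
    unfolding u run_add using assms(1)
    by (intro bind_pmf_cong refl) (auto simp: safe_def)
  then have run: "run w t' c = run w t c" by (simp add: bind_return_pmf')
  then show ?thesis using assms unfolding safe_def by auto
qed

lemma safe_halted: "ok (snd s) \<or> 1 \<le> e \<Longrightarrow> safe w ok t ([], s) e"
  unfolding safe_def by (auto simp: indicator_def)

text \<open>The law of total probability for one step: the error bound may depend on the successor
  configuration and is averaged.\<close>

lemma safe_bind:
  assumes "\<And>c'. c' \<in> set_pmf (step w c) \<Longrightarrow> safe w ok t c' (f c')"
  shows "safe w ok (Suc t) c (\<integral>\<^sup>+ c'. f c' \<partial>measure_pmf (step w c))"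
  using assms unfolding safe_def
  by (auto simp: emeasure_bind_pmf AE_measure_pmf_iff intro!: nn_integral_mono_AE)

lemma safe_reach:
  assumes "run w u c = return_pmf c'" "safe w ok t c' e" "u + t \<le> v"
  shows "safe w ok v c e"
proof (rule safe_mono[OF _ assms(3) order_refl])
  show "safe w ok (u + t) c e"
    using assms(1,2) by (simp add: safe_def run_add bind_return_pmf)
qed

lemma computes_if_safe:
  assumes "safe w ok t (init_config P xs) e" "e \<le> ennreal (1/3)"
  shows "computes w P xs t ok"
proof -
  let ?M = "run w t (init_config P xs)"
  have "ennreal (measure_pmf.prob ?M {(k, s). \<not> ok (snd s)}) \<le> ennreal (1/3)"
    using assms order_trans unfolding safe_def measure_pmf.emeasure_eq_measure by blast
  then have "measure_pmf.prob ?M {(k, s). \<not> ok (snd s)} \<le> 1/3"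
    by (subst (asm) ennreal_le_iff) auto
  moreover have "measure_pmf.prob ?M (UNIV - {(k, s). \<not> ok (snd s)})
      = 1 - measure_pmf.prob ?M {(k, s). \<not> ok (snd s)}"
    using measure_pmf.prob_compl[of "{(k, s). \<not> ok (snd s)}" ?M] by simp
  moreover have "UNIV - {(k, s :: state). \<not> ok (snd s)} = {(k :: cmd list, s). ok (snd s)}" by auto
  ultimately show ?thesis using assms(1) unfolding computes_def safe_def by auto
qed

text \<open>The argument \<open>t\<close> counts the steps executed before \<open>ks\<close>, so that \<open>Q\<close> can bound running times.\<close>

definition wp :: "nat \<Rightarrow> cmd list \<Rightarrow> state \<Rightarrow> nat \<Rightarrow> (state \<Rightarrow> nat \<Rightarrow> bool) \<Rightarrow> bool" where
  "wp w ks s t Q \<longleftrightarrow> (\<exists>u s'. Q s' (t + u) \<and> (\<forall>k. run w u (ks @ k, s) = return_pmf (k, s')))"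

lemma wp_Nil: "Q s t \<Longrightarrow> wp w [] s t Q"
  unfolding wp_def by (intro exI[of _ 0] exI[of _ s]) auto

lemma wp_step:
  assumes "\<And>k. step w (ks @ k, s) = return_pmf (ks' @ k, s')" "wp w ks' s' (Suc t) Q"
  shows "wp w ks s t Q"
proof -
  obtain u s2 where "Q s2 (Suc t + u)" "\<And>k. run w u (ks' @ k, s') = return_pmf (k, s2)"
    using assms(2) unfolding wp_def by auto
  then show ?thesis unfolding wp_def
    by (intro exI[of _ "Suc u"] exI[of _ s2]) (simp add: assms(1) bind_return_pmf)
qed

lemma wp_mono: "wp w ks s t Q \<Longrightarrow> (\<And>s t. Q s t \<Longrightarrow> Q' s t) \<Longrightarrow> wp w ks s t Q'"
  unfolding wp_def by blast

lemma wp_append: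
  assumes "wp w ks s t (\<lambda>s t. wp w ks' s t Q)"
  shows "wp w (ks @ ks') s t Q"
proof -
  obtain u s2 v s3 where "Q s3 (t + u + v)" "\<And>k. run w u (ks @ k, s) = return_pmf (k, s2)"
    "\<And>k. run w v (ks' @ k, s2) = return_pmf (k, s3)"
    using assms unfolding wp_def by blast
  then show ?thesis unfolding wp_def
    by (intro exI[of _ "u + v"] exI[of _ s3]) (auto simp: run_add bind_return_pmf add.assoc)
qed

text \<open>The number \<open>n\<close> of iterations is fixed beforehand, so induction on
  \<open>n - i\<close> takes the place of a termination argument. As \<open>Inv\<close> sees the
  step count, time bounds are part of the invariant.\<close>

lemma wp_While:
  assumes init: "Inv 0 s t"
    and body: "\<And>i s t. i < n \<Longrightarrow> Inv i s t \<Longrightarrow>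
      eval_expr w s e \<noteq> 0 \<and> wp w [p] s (Suc t) (Inv (Suc i))"
    and exit: "\<And>s t. Inv n s t \<Longrightarrow> eval_expr w s e = 0 \<and> wp w ks s (Suc t) Q"
  shows "wp w (While e p # ks) s t Q"
proof -
  have "wp w (While e p # ks) s t Q" if "Inv i s t" "i \<le> n" for i s t
    using that
  proof (induction "n - i" arbitrary: i s t)
    case 0
    then have "Inv n s t" by simp
    from exit[OF this] have "eval_expr w s e = 0" "wp w ks s (Suc t) Q" by blast+
    then show ?case by (intro wp_step[of w "While e p # ks" s ks s]) simp_all
  next
    case (Suc j)
    then have i: "i < n" by simp
    have "wp w ([p] @ (While e p # ks)) s (Suc t) Q"
    proof (rule wp_append, rule wp_mono)
      show "wp w [p] s (Suc t) (Inv (Suc i))" using body[OF i Suc.prems(1)] by simp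
      show "wp w (While e p # ks) s' t' Q" if "Inv (Suc i) s' t'" for s' t'
      proof (rule Suc.hyps(1)[OF _ that])
        show "j = n - Suc i" using Suc.hyps(2) by linarith
        show "Suc i \<le> n" using i by simp
      qed
    qed
    moreover have "eval_expr w s e \<noteq> 0" using body[OF i Suc.prems(1)] by blast
    ultimately show ?case
      by (intro wp_step[of w "While e p # ks" s "p # While e p # ks" s]) simp_all
  qed
  from this[of 0] init show ?thesis by simp
qed

text \<open>The link between the two calculi: a deterministic fragment only costs time and leaves
  the error bound of its randomized continuation unchanged.\<close>

lemma safe_if_wp:
  assumes "wp w ks s 0 (\<lambda>s' u. u \<le> U \<and> safe w ok T (k, s') e)" "U + T \<le> v"
  shows "safe w ok v (ks @ k, s) e"
proof -
  obtain u s' where "u \<le> U" "safe w ok T (k, s') e" "run w u (ks @ k, s) = return_pmf (k, s')"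
    using assms(1) unfolding wp_def by auto
  then show ?thesis using assms(2) by (intro safe_reach[of w u "(ks @ k, s)" "(k, s')" ok T e v]) simp_all
qed

section \<open>Clocked simulation at a smaller word size\<close>

text \<open>
  Registers below \<open>offset\<close> belong to the simulating program, the simulated registers come after
  them. The simulated words have fewer bits than the machine's, hence the reductions modulo the
  content \<open>2 ^ w\<close> of \<open>rW\<close>.
\<close>

abbreviation (input) "rW \<equiv> 0 :: nat"
abbreviation (input) "rBase \<equiv> 1 :: nat"
abbreviation (input) "rClk \<equiv> 2 :: nat"
abbreviation (input) "offset \<equiv> 30 :: nat"

text \<open>Every subexpression is reduced at once, so both machines apply an operation to the same
  numbers; the intermediate reduction modulo \<open>2 ^ v\<close> is then harmless because
  \<open>2 ^ w\<close> divides \<open>2 ^ v\<close>. Even constants must be reduced, since they may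
  exceed \<open>2 ^ w\<close>.\<close>

primrec tr_expr :: "expr \<Rightarrow> expr" where
  "tr_expr (Num k) = Bin Mod (Num k) (Reg rW)"
| "tr_expr (Reg r) = Bin Mod (Reg (r + offset)) (Reg rW)"
| "tr_expr (Mem e) = Bin Mod (Mem (Bin Add (Reg rBase) (tr_expr e))) (Reg rW)"
| "tr_expr (Bin f e1 e2) = Bin Mod (Bin f (tr_expr e1) (tr_expr e2)) (Reg rW)"

text \<open>Only loops consume clock ticks, because code between loop entries is bounded by the size
  of the program. Once the clock is zero every loop exits, so an exhausted simulation halts with an
  arbitrary result. Comparison with 0 turns both factors of the guard into bits, and their product
  is the conjunction.\<close>

primrec tr :: "cmd \<Rightarrow> cmd" where
  "tr Skip = Skip"
| "tr (Assign r e) = Assign (r + offset) (tr_expr e)"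
| "tr (Store e1 e2) = Store (Bin Add (Reg rBase) (tr_expr e1)) (tr_expr e2)"
| "tr (Flip r) = Flip (r + offset)"
| "tr (Seq p q) = Seq (tr p) (tr q)"
| "tr (If e p q) = If (tr_expr e) (tr p) (tr q)"
| "tr (While e p) =
     While (Bin Mul (Bin Less (Num 0) (Reg rClk)) (Bin Less (Num 0) (tr_expr e)))
       (Seq (Assign rClk (Bin Sub (Reg rClk) (Num 1))) (tr p))"

text \<open>A program mentions finitely many registers. A bound on their indices is a constant of
  the program, so clearing all simulated registers before a query takes constant time.\<close>

primrec regs_below_expr :: "nat \<Rightarrow> expr \<Rightarrow> bool" where
  "regs_below_expr m (Num k) = True"
| "regs_below_expr m (Reg r) = (r < m)"
| "regs_below_expr m (Mem e) = regs_below_expr m e"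
| "regs_below_expr m (Bin f e1 e2) = (regs_below_expr m e1 \<and> regs_below_expr m e2)"

primrec regs_below :: "nat \<Rightarrow> cmd \<Rightarrow> bool" where
  "regs_below m Skip = True"
| "regs_below m (Assign r e) = (r < m \<and> regs_below_expr m e)"
| "regs_below m (Store e1 e2) = (regs_below_expr m e1 \<and> regs_below_expr m e2)"
| "regs_below m (Flip r) = (r < m)"
| "regs_below m (Seq p q) = (regs_below m p \<and> regs_below m q)"
| "regs_below m (If e p q) = (regs_below_expr m e \<and> regs_below m p \<and> regs_below m q)"
| "regs_below m (While e p) = (regs_below_expr m e \<and> regs_below m p)"

lemma regs_below_expr_mono: "regs_below_expr m e \<Longrightarrow> m \<le> m' \<Longrightarrow> regs_below_expr m' e"
  by (induction e) auto

lemma regs_below_mono: "regs_below m p \<Longrightarrow> m \<le> m' \<Longrightarrow> regs_below m' p"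
  by (induction p) (auto intro: regs_below_expr_mono)

lemma ex_regs_below_expr: "\<exists>m. regs_below_expr m e"
proof (induction e)
  case (Bin f e1 e2)
  then obtain m1 m2 where "regs_below_expr m1 e1" "regs_below_expr m2 e2" by auto
  then have "regs_below_expr (max m1 m2) (Bin f e1 e2)"
    by (auto intro: regs_below_expr_mono)
  then show ?case ..
qed auto

lemma ex_regs_below: "\<exists>m. regs_below m p"
proof (induction p)
  case (Assign r e)
  obtain m where "regs_below_expr m e" using ex_regs_below_expr by blast
  then have "regs_below (max m (Suc r)) (Assign r e)" by (auto intro: regs_below_expr_mono)
  then show ?case ..
next
  case (Store e1 e2)
  obtain m1 m2 where "regs_below_expr m1 e1" "regs_below_expr m2 e2"
    using ex_regs_below_expr by blast
  then have "regs_below (max m1 m2) (Store e1 e2)" by (auto intro: regs_below_expr_mono)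
  then show ?case ..
next
  case (Seq p q)
  then obtain m1 m2 where "regs_below m1 p" "regs_below m2 q" by blast
  then have "regs_below (max m1 m2) (Seq p q)" by (auto intro: regs_below_mono)
  then show ?case ..
next
  case (If e p q)
  then obtain m1 m2 where "regs_below m1 p" "regs_below m2 q" by blast
  moreover obtain m where "regs_below_expr m e" using ex_regs_below_expr by blast
  ultimately have "regs_below (max m (max m1 m2)) (If e p q)"
    by (auto intro: regs_below_mono regs_below_expr_mono)
  then show ?case ..
next
  case (While e p)
  then obtain m1 where "regs_below m1 p" by blast
  moreover obtain m where "regs_below_expr m e" using ex_regs_below_expr by blast
  ultimately have "regs_below (max m m1) (While e p)"
    by (auto intro: regs_below_mono regs_below_expr_mono)
  then show ?case ..
qed auto

text \<open>A potential for the running time: pending commands pay for their own steps, except that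
  entering a loop pushes a copy of the body. That entry takes 3 steps and is paid by a clock tick,
  which is worth the weight of the loop or more; the summand 4 makes this exceed the weight of the
  body plus 3.\<close>

primrec msize :: "cmd \<Rightarrow> nat" where
  "msize Skip = 1"
| "msize (Assign r e) = 1"
| "msize (Store e1 e2) = 1"
| "msize (Flip r) = 1"
| "msize (Seq p q) = 1 + msize p + msize q"
| "msize (If e p q) = 1 + msize p + msize q"
| "msize (While e p) = 4 + msize p"

text \<open>Words have \<open>v\<close> bits on the executing machine and \<open>w\<close> bits on
  the simulated one. A region of length at least \<open>2 ^ w\<close> contains all simulated
  addresses, and it lies within the \<open>2 ^ v\<close> real ones, so address computations do not
  wrap around.\<close>

locale simulation =
  fixes w v base R m :: nat
  assumes w_less_v: "w < v" and pow_le_R: "2 ^ w \<le> R" and region_fits: "base + R \<le> 2 ^ v"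
begin

text \<open>Registers agree only modulo \<open>2 ^ w\<close>: for \<open>w = 0\<close> a toss stored
  by the executing machine may be 1 while the simulated one stores 0, and every read reduces anyway.
  Memory must agree exactly, because the output condition inspects unreduced cells.\<close>

definition sim :: "state \<Rightarrow> state \<Rightarrow> bool" where
  "sim s s' \<longleftrightarrow> (\<forall>r<m. fst s' (r + offset) mod 2 ^ w = fst s r mod 2 ^ w) \<and>
     (\<forall>a<R. snd s' (base + a) = snd s a)"

definition env :: "state \<Rightarrow> bool" where
  "env s' \<longleftrightarrow> fst s' rW = 2 ^ w \<and> fst s' rBase = base \<and> fst s' rClk < 2 ^ v"

definition frame :: "state \<Rightarrow> state \<Rightarrow> bool" where
  "frame s' s'' \<longleftrightarrow> (\<forall>r<offset. r \<noteq> rClk \<longrightarrow> fst s'' r = fst s' r) \<and>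
     (\<forall>a. a < base \<or> base + R \<le> a \<longrightarrow> snd s'' a = snd s' a)"

lemma frame_refl: "frame s s"
  by (simp add: frame_def)

lemma frame_trans: "frame s s' \<Longrightarrow> frame s' s'' \<Longrightarrow> frame s s''"
  by (simp add: frame_def)

lemma pow_less: "(2::nat) ^ w < 2 ^ v"
  using w_less_v by simp

lemma one_less: "Suc 0 < 2 ^ v"
  using w_less_v by (metis One_nat_def gr_implies_not0 lessI numeral_2_eq_2 one_less_power not_gr_zero)

lemma mod_mod_pow: "a mod 2 ^ v mod 2 ^ w = a mod (2::nat) ^ w"
  by (intro mod_mod_cancel le_imp_power_dvd less_imp_le w_less_v)

lemma eval_mod_W:
  assumes "env s'"
  shows "eval_expr v s' (Bin Mod e (Reg rW)) = eval_expr v s' e mod 2 ^ w"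
proof -
  have "eval_expr v s' e mod 2 ^ w < 2 ^ v"
    using pow_less by (meson mod_less_divisor order_less_trans zero_less_numeral zero_less_power)
  then show ?thesis using assms pow_less by (simp add: env_def)
qed

lemma eval_tr_less:
  assumes "env s'" shows "eval_expr v s' (tr_expr e) < 2 ^ w"
proof -
  have "\<exists>e'. tr_expr e = Bin Mod e' (Reg rW)" by (cases e) auto
  then obtain e' where "tr_expr e = Bin Mod e' (Reg rW)" by blast
  then show ?thesis by (simp only: eval_mod_W[OF assms]) simp
qed

lemma eval_address:
  assumes "env s'"
  shows "eval_expr v s' (Bin Add (Reg rBase) (tr_expr e)) = base + eval_expr v s' (tr_expr e)"
proof -
  have "base + eval_expr v s' (tr_expr e) < 2 ^ v"
    using eval_tr_less[OF assms, of e] pow_le_R region_fits by linarith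
  moreover from this have "base < 2 ^ v" by linarith
  ultimately show ?thesis using assms by (simp add: env_def)
qed

lemma eval_tr:
  assumes "env s'" "sim s s'" "regs_below_expr m e"
  shows "eval_expr v s' (tr_expr e) = eval_expr w s e"
  using assms(3)
proof (induction e)
  case (Num k)
  then show ?case by (simp only: tr_expr.simps eval_mod_W[OF assms(1)]) (simp add: mod_mod_pow)
next
  case (Reg r)
  then show ?case using assms(2)
    by (simp only: tr_expr.simps eval_mod_W[OF assms(1)]) (simp add: mod_mod_pow sim_def)
next
  case (Mem e)
  have "eval_expr v s' (tr_expr e) < R"
    using eval_tr_less[OF assms(1), of e] pow_le_R by linarith
  moreover have "eval_expr v s' (Mem (Bin Add (Reg rBase) (tr_expr e)))
      = snd s' (base + eval_expr v s' (tr_expr e)) mod 2 ^ v"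
    by (simp only: eval_expr.simps(3) eval_address[OF assms(1)])
  ultimately show ?case using Mem assms(2)
    by (simp only: tr_expr.simps eval_mod_W[OF assms(1)]) (simp add: mod_mod_pow sim_def)
next
  case (Bin f e1 e2)
  then show ?case
    by (simp only: tr_expr.simps eval_mod_W[OF assms(1)]) (simp add: mod_mod_pow)
qed

lemma eval_guard:
  assumes "env s'"
  shows "eval_expr v s' (Bin Mul (Bin Less (Num 0) (Reg rClk)) (Bin Less (Num 0) (tr_expr e)))
    = of_bool (0 < fst s' rClk \<and> 0 < eval_expr v s' (tr_expr e))"
  using assms one_less by (simp add: env_def)

lemma step_Assign:
  fixes e :: expr and r :: nat
  assumes "env s'"
  defines "s2 \<equiv> ((fst s')(r + offset := eval_expr v s' (tr_expr e)), snd s')"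
  shows "step v (tr (Assign r e) # K, s') = return_pmf (K, s2)" "env s2" "frame s' s2"
    "fst s2 rClk = fst s' rClk"
  using assms unfolding s2_def by (auto simp: env_def frame_def)

lemma step_Store:
  fixes e1 e2 :: expr
  assumes "env s'"
  defines "s2 \<equiv> (fst s', (snd s')(base + eval_expr v s' (tr_expr e1) := eval_expr v s' (tr_expr e2)))"
  shows "step v (tr (Store e1 e2) # K, s') = return_pmf (K, s2)" "env s2" "frame s' s2"
    "fst s2 rClk = fst s' rClk"
proof -
  have "eval_expr v s' (tr_expr e1) < R"
    using eval_tr_less[OF assms(1), of e1] pow_le_R by linarith
  then show "frame s' s2" by (auto simp: s2_def frame_def)
  show "step v (tr (Store e1 e2) # K, s') = return_pmf (K, s2)"
    by (simp only: tr.simps step.simps eval_address[OF assms(1)] s2_def)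
qed (use assms in \<open>auto simp: env_def s2_def\<close>)

lemma run_While_enter:
  assumes "env s'" "0 < fst s' rClk" "0 < eval_expr v s' (tr_expr e)"
  defines "s2 \<equiv> ((fst s')(rClk := fst s' rClk - 1), snd s')"
  shows "run v 3 (tr (While e p) # K, s') = return_pmf (tr p # tr (While e p) # K, s2)"
    "env s2" "frame s' s2"
proof -
  have "eval_expr v s' (Bin Sub (Reg rClk) (Num 1)) = fst s' rClk - 1"
    using assms(1) one_less by (auto simp: env_def)
  then show "run v 3 (tr (While e p) # K, s') = return_pmf (tr p # tr (While e p) # K, s2)"
    using eval_guard[OF assms(1), of e] assms(2,3)
    by (simp add: numeral_3_eq_3 bind_return_pmf s2_def del: eval_expr.simps)
qed (use assms in \<open>auto simp: env_def s2_def frame_def\<close>)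

lemma step_While_exit:
  assumes "env s'" "\<not> (0 < fst s' rClk \<and> 0 < eval_expr v s' (tr_expr e))"
  shows "step v (tr (While e p) # K, s') = return_pmf (K, s')"
  using eval_guard[OF assms(1), of e] assms(2) by (auto simp del: eval_expr.simps)

text \<open>
  Every loop iteration consumes a clock tick, which pays for the commands it pushes; hence a
  translated program halts whatever its input is.
\<close>

lemma safe_tr:
  assumes "env s'" "\<forall>p\<in>set ks. msize p \<le> S" "\<And>s''. frame s' s'' \<Longrightarrow> safe v ok t (k, s'') e"
  shows "safe v ok (sum_list (map msize ks) + fst s' rClk * S + t) (map tr ks @ k, s') e"
  using assms
proof (induction "sum_list (map msize ks) + fst s' rClk * S" arbitrary: ks s' rule: less_induct)
  case less
  note env = less.prems(1) and bnd = less.prems(2) and cont = less.prems(3)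
  have step: "safe v ok (sum_list (map msize ks) + fst s' rClk * S + t) (map tr ks @ k, s') e"
    if "run v j (map tr ks @ k, s') = return_pmf (map tr ks2 @ k, s2)" "env s2" "frame s' s2"
      "\<forall>p\<in>set ks2. msize p \<le> S" "0 < j"
      "sum_list (map msize ks2) + fst s2 rClk * S + j \<le> sum_list (map msize ks) + fst s' rClk * S"
    for j ks2 s2
  proof (rule safe_reach[OF that(1)])
    show "safe v ok (sum_list (map msize ks2) + fst s2 rClk * S + t) (map tr ks2 @ k, s2) e"
      using that frame_trans[OF that(3)] cont by (intro less.hyps) auto
    show "j + (sum_list (map msize ks2) + fst s2 rClk * S + t)
      \<le> sum_list (map msize ks) + fst s' rClk * S + t" using that by simp
  qed
  have step1: "safe v ok (sum_list (map msize ks) + fst s' rClk * S + t) (map tr ks @ k, s') e"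
    if "step v (map tr ks @ k, s') = return_pmf (map tr ks2 @ k, s2)" "env s2" "frame s' s2"
      "\<forall>p\<in>set ks2. msize p \<le> S" "fst s2 rClk = fst s' rClk"
      "sum_list (map msize ks2) < sum_list (map msize ks)"
    for ks2 s2
    using that by (intro step[of 1 ks2 s2]) (auto simp: bind_return_pmf' bind_return_pmf)
  show ?case
  proof (cases ks)
    case Nil
    have "safe v ok t (k, s') e" by (intro cont frame_refl)
    from safe_mono[OF this, of "fst s' rClk * S + t" e] show ?thesis by (simp add: Nil)
  next
    case (Cons c ks')
    show ?thesis
    proof (cases c)
      case Skip
      then show ?thesis using env bnd Cons by (intro step1[of ks' s']) (auto simp: frame_refl)
    next
      case (Assign r ex)
      then show ?thesis using step_Assign[OF env, where r = r and e = ex] bnd Cons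
        by (intro step1[of ks' "((fst s')(r + offset := eval_expr v s' (tr_expr ex)), snd s')"]) auto
    next
      case (Store e1 e2)
      then show ?thesis using step_Store[OF env, where ?e1.0 = e1 and ?e2.0 = e2] bnd Cons
        by (intro step1[of ks'
          "(fst s', (snd s')(base + eval_expr v s' (tr_expr e1) := eval_expr v s' (tr_expr e2)))"]) auto
    next
      case (Flip r)
      let ?p = "sum_list (map msize ks') + fst s' rClk * S + t"
      have "safe v ok ?p (map tr ks' @ k, ((fst s')(r + offset := x), snd s')) e" for x
      proof -
        let ?s2 = "((fst s')(r + offset := x), snd s')"
        have fr: "frame s' ?s2" by (simp add: frame_def)
        have "safe v ok (sum_list (map msize ks') + fst ?s2 rClk * S + t) (map tr ks' @ k, ?s2) e"
          using env bnd Flip Cons frame_trans[OF fr] cont by (intro less.hyps) (auto simp: env_def)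
        then show ?thesis by simp
      qed
      then have "safe v ok (Suc ?p) (map tr ks @ k, s')
          (\<integral>\<^sup>+ c'. e \<partial>measure_pmf (step v (map tr ks @ k, s')))"
        unfolding Cons Flip by (intro safe_bind) auto
      then show ?thesis unfolding Cons Flip by (simp add: measure_pmf.emeasure_space_1)
    next
      case (Seq p q)
      then show ?thesis using env bnd Cons
        by (intro step1[of "p # q # ks'" s']) (auto simp: frame_refl)
    next
      case (If ex p q)
      then show ?thesis using env bnd Cons
        by (intro step1[of "(if eval_expr v s' (tr_expr ex) \<noteq> 0 then p else q) # ks'" s'])
          (auto simp: frame_refl)
    next
      case (While ex p)
      show ?thesis
      proof (cases "0 < fst s' rClk \<and> 0 < eval_expr v s' (tr_expr ex)")
        case True
        then obtain x where x: "fst s' rClk = Suc x" by (cases "fst s' rClk") auto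
        have "4 + msize p \<le> S" using bnd Cons While by auto
        then show ?thesis
          using run_While_enter[OF env, where e = ex] True bnd Cons While x
          by (intro step[of 3 "p # While ex p # ks'" "((fst s')(rClk := fst s' rClk - 1), snd s')"])
            (auto simp del: tr.simps(7))
      next
        case False
        then show ?thesis using step_While_exit[OF env False] env bnd Cons While
          by (intro step1[of ks' s']) (auto simp: frame_refl simp del: tr.simps(7))
      qed
    qed
  qed
qed

text \<open>The tosses of the two machines are coupled, so the error is the average of
  \<open>q\<close> over the final states of the simulated run. Entering a loop takes 3 steps (guard,
  \<open>Seq\<close>, clock) and everything else one, whence \<open>3 * n\<close>. In
  \<open>n\<close> steps at most \<open>n\<close> iterations begin, so a clock of at least
  \<open>n\<close> never alters a guard.\<close>

lemma safe_tr_sim: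
  assumes "\<forall>(k, u)\<in>set_pmf (run w n (ks, s)). k = []" "\<forall>p\<in>set ks. regs_below m p"
    "sim s s'" "env s'" "n \<le> fst s' rClk"
    "\<And>u s''. ([], u) \<in> set_pmf (run w n (ks, s)) \<Longrightarrow> sim u s'' \<Longrightarrow> frame s' s'' \<Longrightarrow>
       safe v ok t (k, s'') (q u)"
  shows "safe v ok (3 * n + t) (map tr ks @ k, s') (\<integral>\<^sup>+ c. q (snd c) \<partial>measure_pmf (run w n (ks, s)))"
  using assms
proof (induction n arbitrary: ks s s')
  case 0
  then have "ks = []" by auto
  moreover have "safe v ok t (k, s') (q s)"
    using 0 \<open>ks = []\<close> by (intro 0(6)) (auto simp: frame_refl)
  ultimately show ?case by simp
next
  case (Suc n)
  note env = \<open>env s'\<close> and sim = \<open>sim s s'\<close> and regs = Suc.prems(2) and cont = Suc.prems(6)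
    and halt = Suc.prems(1) and clk = Suc.prems(5)
  have step: "safe v ok (3 * Suc n + t) (map tr ks @ k, s')
      (\<integral>\<^sup>+ c. q (snd c) \<partial>measure_pmf (run w (Suc n) (ks, s)))"
    if "step w (ks, s) = return_pmf (ks2, s2)" "\<forall>p\<in>set ks2. regs_below m p" "sim s2 s2'"
      "run v j (map tr ks @ k, s') = return_pmf (map tr ks2 @ k, s2')" "env s2'" "frame s' s2'"
      "n \<le> fst s2' rClk" "j \<le> 3"
    for ks2 s2 s2' j
  proof -
    have run: "run w (Suc n) (ks, s) = run w n (ks2, s2)"
      by (simp add: that(1) bind_return_pmf)
    have "safe v ok (3 * n + t) (map tr ks2 @ k, s2')
        (\<integral>\<^sup>+ c. q (snd c) \<partial>measure_pmf (run w n (ks2, s2)))"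
      using halt that cont frame_trans[OF that(6)] unfolding run by (intro Suc.IH) auto
    from safe_reach[OF that(4) this] show ?thesis using that(8) unfolding run by simp
  qed
  have step1: "safe v ok (3 * Suc n + t) (map tr ks @ k, s')
      (\<integral>\<^sup>+ c. q (snd c) \<partial>measure_pmf (run w (Suc n) (ks, s)))"
    if "step w (ks, s) = return_pmf (ks2, s2)" "\<forall>p\<in>set ks2. regs_below m p" "sim s2 s2'"
      "step v (map tr ks @ k, s') = return_pmf (map tr ks2 @ k, s2')" "env s2'" "frame s' s2'"
      "fst s2' rClk = fst s' rClk"
    for ks2 s2 s2'
    using that clk by (intro step[of ks2 s2 s2' 1]) (auto simp: bind_return_pmf' bind_return_pmf)
  show ?case
  proof (cases ks)
    case Nil
    have "run w (Suc n) (ks, s) = return_pmf ([], s)" unfolding Nil by (rule run_halted)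
    moreover have "safe v ok t (k, s') (q s)"
      using sim calculation by (intro cont) (auto simp: frame_refl)
    ultimately show ?thesis unfolding Nil by (auto intro: safe_mono)
  next
    case (Cons c ks')
    show ?thesis
    proof (cases c)
      case Skip
      then show ?thesis using env sim regs Cons
        by (intro step1[of ks' s s']) (auto simp: frame_refl)
    next
      case (Assign r e)
      then have "eval_expr v s' (tr_expr e) = eval_expr w s e"
        using regs Cons by (intro eval_tr env sim) auto
      then show ?thesis
        using step_Assign[OF env, where r = r and e = e] regs Cons Assign sim
        by (intro step1[of ks' "((fst s)(r := eval_expr w s e), snd s)"
            "((fst s')(r + offset := eval_expr v s' (tr_expr e)), snd s')"]) (auto simp: sim_def)
    next
      case (Store e1 e2)
      then have "eval_expr v s' (tr_expr e1) = eval_expr w s e1"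
        "eval_expr v s' (tr_expr e2) = eval_expr w s e2"
        using regs Cons by (auto intro!: eval_tr env sim)
      then show ?thesis
        using step_Store[OF env, where ?e1.0 = e1 and ?e2.0 = e2] regs Cons Store sim
        by (intro step1[of ks' "(fst s, (snd s)(eval_expr w s e1 := eval_expr w s e2))"
            "(fst s', (snd s')(base + eval_expr v s' (tr_expr e1) := eval_expr v s' (tr_expr e2)))"])
          (auto simp: sim_def)
    next
      case (Flip r)
      define f :: "bool \<Rightarrow> ennreal" where "f = (\<lambda>b. \<integral>\<^sup>+ c. q (snd c)
        \<partial>measure_pmf (run w n (ks', ((fst s)(r := of_bool b mod 2 ^ w), snd s))))"
      have "safe v ok (3 * n + t) (map tr ks' @ k,
          ((fst s')(r + offset := of_bool b mod 2 ^ v), snd s')) (f b)" for b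
      proof -
        let ?s2 = "((fst s)(r := of_bool b mod 2 ^ w), snd s)"
        let ?s2' = "((fst s')(r + offset := of_bool b mod 2 ^ v), snd s')"
        have sub: "set_pmf (run w n (ks', ?s2)) \<subseteq> set_pmf (run w (Suc n) (ks, s))"
          using Cons Flip by (auto intro!: exI[of _ b] bexI[of _ b])
        have fr: "frame s' ?s2'" by (auto simp: frame_def)
        show ?thesis unfolding f_def
        proof (rule Suc.IH)
          show "\<forall>(k, u)\<in>set_pmf (run w n (ks', ?s2)). k = []" using halt sub by blast
          show "\<forall>p\<in>set ks'. regs_below m p" using regs Cons by simp
          show "sim ?s2 ?s2'" using sim by (auto simp: sim_def mod_mod_pow)
          show "env ?s2'" using env by (simp add: env_def)
          show "n \<le> fst ?s2' rClk" using clk by simp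
          show "safe v ok t (k, s'') (q u)"
            if "([], u) \<in> set_pmf (run w n (ks', ?s2))" "sim u s''" "frame ?s2' s''" for u s''
            using sub that by (intro cont frame_trans[OF fr]) auto
        qed
      qed
      note safe_f = this
      \<comment> \<open>\<open>safe_bind\<close> expects a bound that depends on the successor
        configuration, so the toss is read back from the register that received it.\<close>
      define g where "g c = (if fst (snd c) (r + offset) = 1 mod 2 ^ v then f True else f False)"
        for c :: config
      have v1: "1 mod 2 ^ v = (1::nat)" using one_less by (metis One_nat_def mod_less)
      have "safe v ok (Suc (3 * n + t)) (map tr ks @ k, s')
          (\<integral>\<^sup>+ c. g c \<partial>measure_pmf (step v (map tr ks @ k, s')))"
      proof (rule safe_bind)
        fix c' assume "c' \<in> set_pmf (step v (map tr ks @ k, s'))"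
        then obtain b where
          "c' = (map tr ks' @ k, ((fst s')(r + offset := of_bool b mod 2 ^ v), snd s'))"
          unfolding Cons Flip by auto
        then show "safe v ok (3 * n + t) c' (g c')"
          using safe_f[of b] v1 by (cases b) (auto simp: g_def)
      qed
      moreover have "(\<integral>\<^sup>+ c. g c \<partial>measure_pmf (step v (map tr ks @ k, s')))
          = (\<integral>\<^sup>+ b. f b \<partial>measure_pmf (bernoulli_pmf (1/2)))"
        unfolding Cons Flip using v1
        by (auto simp: g_def intro!: nn_integral_cong)
      moreover have "(\<integral>\<^sup>+ c. q (snd c) \<partial>measure_pmf (run w (Suc n) (ks, s)))
          = (\<integral>\<^sup>+ b. f b \<partial>measure_pmf (bernoulli_pmf (1/2)))"
        unfolding Cons Flip by (simp add: f_def bind_map_pmf nn_integral_bind_pmf)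
      ultimately show ?thesis by (auto intro: safe_mono)
    next
      case (Seq p q)
      then show ?thesis using env sim regs Cons
        by (intro step1[of "p # q # ks'" s s']) (auto simp: frame_refl)
    next
      case (If e p q)
      then have "eval_expr v s' (tr_expr e) = eval_expr w s e"
        using regs Cons by (intro eval_tr env sim) auto
      then show ?thesis using env sim regs Cons If
        by (intro step1[of "(if eval_expr w s e \<noteq> 0 then p else q) # ks'" s s'])
          (auto simp: frame_refl)
    next
      case (While e p)
      then have eq: "eval_expr v s' (tr_expr e) = eval_expr w s e"
        using regs Cons by (intro eval_tr env sim) auto
      show ?thesis
      proof (cases "eval_expr w s e = 0")
        case True
        then show ?thesis using step_While_exit[OF env, of e p "map tr ks' @ k"] eq env regs sim
            Cons While
          by (intro step1[of ks' s s']) (auto simp: frame_refl simp del: tr.simps(7))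
      next
        case False
        let ?s2 = "((fst s')(rClk := fst s' rClk - 1), snd s')"
        show ?thesis
        proof (rule step[of "p # While e p # ks'" s ?s2 3])
          show "sim s ?s2" using sim by (auto simp: sim_def)
        qed (use run_While_enter[OF env, where e = e] eq clk regs Cons While False
          in \<open>auto simp del: tr.simps(7)\<close>)
      qed
    qed
  qed
qed

end

section \<open>The embedding into Chamfer instances\<close>

definition emb_left :: "nat \<Rightarrow> nat list \<Rightarrow> nat list" where
  "emb_left D a = replicate (length a) 0 @ a @ replicate (D - 2 * length a) 0"

definition emb_right :: "nat \<Rightarrow> nat list \<Rightarrow> nat list" where
  "emb_right D b = b @ map (\<lambda>x. 1 - x) b @ replicate (D - 2 * length b) 0"

lemma emb_left_cube: "a \<in> cube d \<Longrightarrow> 2 * d \<le> D \<Longrightarrow> emb_left D a \<in> cube D"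
  unfolding cube_def emb_left_def by (auto simp: in_set_replicate)

lemma emb_right_cube: "b \<in> cube d \<Longrightarrow> 2 * d \<le> D \<Longrightarrow> emb_right D b \<in> cube D"
  unfolding cube_def emb_right_def by (auto simp: in_set_replicate)

text \<open>Instances are sets: injectivity keeps the listings of a query distinct and lets sums
  over embedded vectors be written as sums over the original ones.\<close>

lemma inj_emb_left: "inj_on (emb_left D) (cube d)"
  unfolding inj_on_def cube_def emb_left_def by auto

lemma inj_emb_right: "inj_on (emb_right D) (cube d)"
  unfolding inj_on_def cube_def emb_right_def by auto

lemma sum_lessThan_add:
  fixes f :: "nat \<Rightarrow> 'a :: comm_monoid_add"
  shows "(\<Sum>i<n + m. f i) = (\<Sum>i<n. f i) + (\<Sum>i<m. f (n + i))"
  by (induction m) (simp_all add: add.assoc)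

lemma l1_dist_append:
  assumes "length a = length b"
  shows "l1_dist (a @ a') (b @ b') = l1_dist a b + l1_dist a' b'"
  using assms unfolding l1_dist_def by (simp add: sum_lessThan_add nth_append)

lemma l1_dist_same: "l1_dist a a = 0"
  by (simp add: l1_dist_def)

lemma cube_nth: "a \<in> cube d \<Longrightarrow> i < d \<Longrightarrow> a ! i = 0 \<or> a ! i = 1"
  unfolding cube_def using nth_mem by fastforce

text \<open>For bits, \<open>b + \<bar>a - (1 - b)\<bar> = (1 - a) + 2 * a * b\<close>, where
  \<open>b\<close> comes from the first block and the absolute value from the second; the padding
  contributes nothing.\<close>

lemma l1_dist_emb:
  assumes "a \<in> cube d" "b \<in> cube d" "2 * d \<le> D"
  shows "l1_dist (emb_left D a) (emb_right D b) = (real d - (\<Sum>i<d. real (a ! i))) + 2 * real (dot a b)"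
proof -
  have len: "length a = d" "length b = d" using assms by (auto simp: cube_def)
  have "l1_dist (emb_left D a) (emb_right D b)
      = l1_dist (replicate d 0) b + l1_dist a (map (\<lambda>x. 1 - x) b)"
    unfolding emb_left_def emb_right_def len by (simp add: l1_dist_append len l1_dist_same)
  also have "\<dots> = (\<Sum>i<d. real (b ! i) + \<bar>real (a ! i) - real (1 - b ! i)\<bar>)"
    by (simp add: l1_dist_def len sum.distrib)
  also have "\<dots> = (\<Sum>i<d. (1 - real (a ! i)) + 2 * real (a ! i * b ! i))"
  proof (intro sum.cong refl)
    fix i assume "i \<in> {..<d}"
    then show "real (b ! i) + \<bar>real (a ! i) - real (1 - b ! i)\<bar> = (1 - real (a ! i)) + 2 * real (a ! i * b ! i)"
      using cube_nth[OF assms(1), of i] cube_nth[OF assms(2), of i] by auto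
  qed
  also have "\<dots> = (real d - (\<Sum>i<d. real (a ! i))) + 2 * real (dot a b)"
    unfolding sum.distrib sum_subtractf sum_distrib_left[symmetric] dot_def len by simp
  finally show ?thesis .
qed

text \<open>When every \<open>a\<close> has an orthogonal partner, the optimum is the total number
  of zeros in the vectors of \<open>A\<close>, at most \<open>d * card A\<close>. A nonorthogonal
  choice costs at least 2 more than the optimal one, while the total excess is at most
  \<open>\<epsilon> * d * card A \<le> card A / 2\<close>; this leaves at most
  \<open>card A / 4\<close> such choices.\<close>

lemma card_nonorthogonal:
  assumes A: "finite A" "A \<subseteq> cube d" and B: "finite B" "B \<subseteq> cube d" and D: "2 * d \<le> D"
    and orth: "\<forall>a\<in>A. \<exists>b\<in>B. dot a b = 0" and f: "\<forall>a\<in>A. f a \<in> B"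
    and eps: "\<epsilon> * real d \<le> 1/2" "0 < \<epsilon>"
    and cost: "(\<Sum>a\<in>A. l1_dist (emb_left D a) (emb_right D (f a)))
      \<le> (1 + \<epsilon>) * chamfer (emb_left D ` A) (emb_right D ` B)"
  shows "4 * card {a\<in>A. dot a (f a) \<noteq> 0} \<le> card A"
proof -
  define h where "h a = real d - (\<Sum>i<d. real (a ! i))" for a :: "nat list"
  define X where "X = (\<Sum>a\<in>A. h a)"
  have dist: "l1_dist (emb_left D a) (emb_right D b) = h a + 2 * real (dot a b)"
    if "a \<in> A" "b \<in> B" for a b
    using l1_dist_emb[of a d b D] that A B D by (auto simp: h_def)
  have "Min (l1_dist (emb_left D a) ` emb_right D ` B) = h a" if a: "a \<in> A" for a
  proof (rule Min_eqI)
    show "finite (l1_dist (emb_left D a) ` emb_right D ` B)" using B by auto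
    show "h a \<le> y" if "y \<in> l1_dist (emb_left D a) ` emb_right D ` B" for y
      using that dist[OF a] by auto
    obtain b where "b \<in> B" "dot a b = 0" using orth a by blast
    with dist[OF a, of b] show "h a \<in> l1_dist (emb_left D a) ` emb_right D ` B"
      by (auto simp: image_iff intro!: bexI[of _ b])
  qed
  then have ch: "chamfer (emb_left D ` A) (emb_right D ` B) = X"
    unfolding chamfer_def X_def using inj_on_subset[OF inj_emb_left A(2)]
    by (simp add: sum.reindex)
  have "X + 2 * (\<Sum>a\<in>A. real (dot a (f a))) \<le> (1 + \<epsilon>) * X"
    using cost dist f unfolding ch by (simp add: X_def sum.distrib sum_distrib_left)
  then have "2 * (\<Sum>a\<in>A. real (dot a (f a))) \<le> \<epsilon> * X" by (simp add: algebra_simps)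
  moreover have "X \<le> (\<Sum>a\<in>A. real d)"
    unfolding X_def h_def by (intro sum_mono) (simp add: sum_nonneg)
  then have "\<epsilon> * X \<le> \<epsilon> * (real d * card A)"
    using eps(2) by (intro mult_left_mono) (auto simp: mult.commute)
  moreover have "\<epsilon> * (real d * card A) \<le> 1/2 * card A"
    using mult_right_mono[OF eps(1), of "real (card A)"] by (simp add: mult.assoc)
  moreover have "real (card {a\<in>A. dot a (f a) \<noteq> 0}) \<le> (\<Sum>a\<in>A. real (dot a (f a)))"
  proof -
    have "real (card {a\<in>A. dot a (f a) \<noteq> 0}) = (\<Sum>a | a \<in> A \<and> dot a (f a) \<noteq> 0. 1)" by simp
    also have "\<dots> \<le> (\<Sum>a | a \<in> A \<and> dot a (f a) \<noteq> 0. real (dot a (f a)))"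
      by (intro sum_mono) auto
    also have "\<dots> \<le> (\<Sum>a\<in>A. real (dot a (f a)))" using A by (intro sum_mono2) auto
    finally show ?thesis .
  qed
  ultimately have "4 * real (card {a\<in>A. dot a (f a) \<noteq> 0}) \<le> real (card A)" by linarith
  then show ?thesis by linarith
qed

section \<open>Vector lists as zero-padded memory contents\<close>

definition rep :: "nat list \<Rightarrow> nat \<Rightarrow> nat" where
  "rep xs a = (if a < length xs then xs ! a else 0)"

lemma rep_append: "rep (xs @ ys) a = (if a < length xs then rep xs a else rep ys (a - length xs))"
  by (auto simp: rep_def nth_append)

lemma rep_Nil [simp]: "rep [] a = 0"
  by (simp add: rep_def)

lemma rep_replicate_0 [simp]: "rep (replicate k 0) a = 0"
  by (simp add: rep_def)

lemma length_concat_eq: "\<forall>x\<in>set xss. length x = d \<Longrightarrow> length (concat xss) = length xss * d"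
  by (induction xss) auto

lemma nth_concat_eq:
  assumes "\<forall>x\<in>set xss. length x = d" "i < length xss" "j < d"
  shows "concat xss ! (i * d + j) = xss ! i ! j"
  using assms
proof (induction xss arbitrary: i)
  case (Cons x xss)
  then show ?case by (cases i) (auto simp: nth_append add.assoc)
qed simp

lemma index_less:
  assumes "i < m" "j < (d :: nat)"
  shows "i * d + j < m * d"
proof -
  have "Suc i * d \<le> m * d" using assms(1) by (intro mult_le_mono1) simp
  then show ?thesis using assms(2) by simp
qed

lemma rep_encode_left:
  assumes "\<forall>x\<in>set xs. length x = d" "i < length xs" "j < d"
  shows "rep (encode n d xs ys) (4 + i * d + j) = xs ! i ! j"
proof -
  have "i * d + j < length xs * d"
    using assms(2,3) by (rule index_less)
  then show ?thesis using nth_concat_eq[OF assms] length_concat_eq[OF assms(1)]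
    by (simp add: encode_def rep_def nth_append eval_nat_numeral)
qed

lemma rep_encode_right:
  assumes "\<forall>x\<in>set xs. length x = d" "\<forall>y\<in>set ys. length y = d" "i < length ys" "j < d"
  shows "rep (encode n d xs ys) (4 + length xs * d + i * d + j) = ys ! i ! j"
proof -
  have "i * d + j < length ys * d" using assms(3,4) by (rule index_less)
  then show ?thesis
    using nth_concat_eq[OF assms(2-4)] length_concat_eq[OF assms(1)] length_concat_eq[OF assms(2)]
    by (simp add: encode_def rep_def nth_append eval_nat_numeral add.assoc)
qed

section \<open>Program fragments\<close>

text \<open>An equation instead of an implication, so that straight-line code can be executed by
  rewriting. From left to right, the number of steps cannot be 0, since the command \<open>c\<close>
  is still pending.\<close>

lemma wp_cong_step:
  assumes "\<And>k. step w (c # ks @ k, s) = return_pmf (ks' @ k, s')"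
  shows "wp w (c # ks) s t Q = wp w ks' s' (Suc t) Q"
proof
  assume "wp w (c # ks) s t Q"
  then obtain u s2 where u: "Q s2 (t + u)" "\<And>k. run w u (c # ks @ k, s) = return_pmf (k, s2)"
    unfolding wp_def by auto
  show "wp w ks' s' (Suc t) Q"
  proof (cases u)
    case 0
    with u(2)[of "[]"] show ?thesis by simp
  next
    case (Suc u')
    then show ?thesis using u unfolding wp_def
      by (intro exI[of _ u'] exI[of _ s2]) (auto simp: assms bind_return_pmf)
  qed
qed (use assms in \<open>auto intro: wp_step\<close>)

lemma wp_simps:
  "wp w (Skip # ks) s t Q = wp w ks s (Suc t) Q"
  "wp w (Assign r e # ks) s t Q = wp w ks ((fst s)(r := eval_expr w s e), snd s) (Suc t) Q"
  "wp w (Store e1 e2 # ks) s t Q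
     = wp w ks (fst s, (snd s)(eval_expr w s e1 := eval_expr w s e2)) (Suc t) Q"
  "wp w (Seq p q # ks) s t Q = wp w (p # q # ks) s (Suc t) Q"
  "wp w (If e p q # ks) s t Q = wp w ((if eval_expr w s e \<noteq> 0 then p else q) # ks) s (Suc t) Q"
  by (intro wp_cong_step; simp)+

text \<open>Below \<open>offset\<close>, hence out of reach of the simulated program.
  \<open>rN\<close>, \<open>rD\<close>, \<open>rNA\<close>, \<open>rNB\<close> hold the input
  header, \<open>rEll\<close> the bit length of the size, \<open>rR\<close> the length of a region,
  \<open>rL\<close> the initial clock, \<open>rCnt\<close> the number of remaining queries,
  \<open>rAlv\<close> the number of candidates and \<open>rDD\<close> the guessed dimension.
  \<open>rQ\<close> points into the query region, \<open>rSrc\<close> and \<open>rDst\<close> are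
  the ends of a copy and \<open>rY\<close> is its mask; \<open>rV\<close> is a reported index,
  \<open>rS\<close> the result of \<open>dot_test\<close>, \<open>rYB\<close> the start of the
  second input list and \<open>rYP\<close> one of its vectors.\<close>

abbreviation (input) "rN \<equiv> 3 :: nat"
abbreviation (input) "rD \<equiv> 4 :: nat"
abbreviation (input) "rNA \<equiv> 5 :: nat"
abbreviation (input) "rNB \<equiv> 6 :: nat"
abbreviation (input) "rEll \<equiv> 7 :: nat"
abbreviation (input) "rR \<equiv> 8 :: nat"
abbreviation (input) "rL \<equiv> 9 :: nat"
abbreviation (input) "rCnt \<equiv> 10 :: nat"
abbreviation (input) "rAlv \<equiv> 11 :: nat"
abbreviation (input) "rDD \<equiv> 12 :: nat"
abbreviation (input) "rQ \<equiv> 13 :: nat"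
abbreviation (input) "rSrc \<equiv> 14 :: nat"
abbreviation (input) "rI \<equiv> 15 :: nat"
abbreviation (input) "rJ \<equiv> 16 :: nat"
abbreviation (input) "rDst \<equiv> 17 :: nat"
abbreviation (input) "rY \<equiv> 18 :: nat"
abbreviation (input) "rV \<equiv> 19 :: nat"
abbreviation (input) "rS \<equiv> 20 :: nat"
abbreviation (input) "rYB \<equiv> 21 :: nat"
abbreviation (input) "rYP \<equiv> 22 :: nat"

abbreviation (input) add (infixl "\<oplus>" 65) where "add \<equiv> Bin Add"

primrec seqs :: "cmd list \<Rightarrow> cmd" where
  "seqs [] = Skip"
| "seqs (c # cs) = Seq c (seqs cs)"

text \<open>The mask \<open>rY\<close> lets the same code copy a bit vector (0) or complement it
  (1).\<close>

definition copy :: cmd where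
  "copy = Seq (Assign rJ (Num 0)) (While (Bin Less (Reg rJ) (Reg rD)) (Seq
     (Store (Reg rDst \<oplus> Reg rJ) (Bin Xor (Mem (Reg rSrc \<oplus> Reg rJ)) (Reg rY)))
     (Assign rJ (Reg rJ \<oplus> Num 1))))"

text \<open>Only whether the inner product vanishes matters, so a disjunction of bits replaces the
  sum and cannot overflow.\<close>

definition dot_test :: cmd where
  "dot_test = seqs [Assign rJ (Num 0), Assign rS (Num 0), While (Bin Less (Reg rJ) (Reg rD)) (Seq
     (Assign rS (Bin Or (Reg rS) (Bin And (Mem (Reg rSrc \<oplus> Reg rJ)) (Mem (Reg rYP \<oplus> Reg rJ)))))
     (Assign rJ (Reg rJ \<oplus> Num 1)))]"

lemma wp_copy:
  assumes v: "0 < v"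
    and regs: "fst s rD = d" "fst s rSrc = src" "fst s rDst = dst" "fst s rY = y"
    and y: "y < 2" and le: "src + d \<le> dst" "dst + d < 2 ^ v"
    and x: "\<And>j. j < d \<Longrightarrow> snd s (src + j) = x j \<and> x j < 2"
    and cont: "wp v ks ((fst s)(rJ := d),
      \<lambda>a. if dst \<le> a \<and> a < dst + d then Bit_Operations.xor (x (a - dst)) y else snd s a) (Suc (4 * d + Suc (Suc t))) Q"
  shows "wp v (copy # ks) s t Q"
proof -
  define S where "S i = ((fst s)(rJ := i),
      \<lambda>a. if dst \<le> a \<and> a < dst + i then Bit_Operations.xor (x (a - dst)) y else snd s a)" for i
  have v1: "Suc 0 < 2 ^ v" using one_less_power[of "2::nat" v] v by simp
  have xy: "Bit_Operations.xor (x j) y < 2" if "j < d" for j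
  proof -
    have "x j = 0 \<or> x j = 1" "y = 0 \<or> y = 1" using x[OF that] y by auto
    then show ?thesis by auto
  qed
  have "wp v (While (Bin Less (Reg rJ) (Reg rD)) (Seq
     (Store (Reg rDst \<oplus> Reg rJ) (Bin Xor (Mem (Reg rSrc \<oplus> Reg rJ)) (Reg rY)))
     (Assign rJ (Reg rJ \<oplus> Num 1))) # ks) (S 0) (Suc (Suc t)) Q"
  proof (rule wp_While[where n = d and Inv = "\<lambda>i s' t'. s' = S i \<and> t' = 4 * i + Suc (Suc t)"])
    fix i s' t'
    assume i: "i < d" and s': "s' = S i \<and> t' = 4 * i + Suc (Suc t)"
    have xv: "x i mod 2 ^ v = x i" "y mod 2 ^ v = y" "Bit_Operations.xor (x i) y mod 2 ^ v = Bit_Operations.xor (x i) y"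
      using x[OF i] y xy[OF i] v v1 by simp_all
    have regs': "fst (S i) rD = d" "fst (S i) rJ = i" "fst (S i) rSrc = src" "fst (S i) rDst = dst"
      "fst (S i) rY = y" "snd (S i) (src + i) = x i"
      using regs le x i by (auto simp: S_def)
    have S: "S (Suc i) = ((fst (S i))(rJ := Suc i), (snd (S i))(dst + i := Bit_Operations.xor (x i) y))"
      unfolding S_def using i by (auto simp: fun_eq_iff)
    show "eval_expr v s' (Bin Less (Reg rJ) (Reg rD)) \<noteq> 0 \<and>
      wp v [Seq (Store (Reg rDst \<oplus> Reg rJ) (Bin Xor (Mem (Reg rSrc \<oplus> Reg rJ)) (Reg rY)))
        (Assign rJ (Reg rJ \<oplus> Num 1))] s' (Suc t')
        (\<lambda>s' t'. s' = S (Suc i) \<and> t' = 4 * Suc i + Suc (Suc t))"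
      unfolding wp_simps using i s' le v v1
      by (intro conjI wp_Nil) (simp_all add: regs' xv S)
  qed (use regs cont le v v1 in \<open>simp_all add: S_def\<close>)
  moreover have "S 0 = ((fst s)(rJ := 0), snd s)" by (simp add: S_def fun_eq_iff)
  ultimately show ?thesis using v unfolding copy_def wp_simps by simp
qed

lemma dot_nonzero_iff: "dot a b \<noteq> 0 \<longleftrightarrow> (\<exists>j<length a. a ! j * b ! j \<noteq> 0)"
  unfolding dot_def by auto

lemma wp_dot_test:
  assumes v: "0 < v"
    and regs: "fst s rD = d" "fst s rSrc = src" "fst s rYP = yp"
    and le: "src + d < 2 ^ v" "yp + d < 2 ^ v"
    and a: "a \<in> cube d" "\<And>j. j < d \<Longrightarrow> snd s (src + j) = a ! j"
    and b: "b \<in> cube d" "\<And>j. j < d \<Longrightarrow> snd s (yp + j) = b ! j"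
    and cont: "wp v ks ((fst s)(rJ := d, rS := of_bool (dot a b \<noteq> 0)), snd s) (Suc (Suc (4 * d + (Suc (Suc (Suc (Suc (Suc t)))))))) Q"
  shows "wp v (dot_test # ks) s t Q"
proof -
  define e :: "nat \<Rightarrow> nat" where "e i = of_bool (\<exists>j<i. a ! j * b ! j \<noteq> 0)" for i
  define S where "S i = ((fst s)(rJ := i, rS := e i), snd s)" for i
  have v1: "Suc 0 < 2 ^ v" using one_less_power[of "2::nat" v] v by simp
  have S0: "S 0 = ((fst s)(rJ := 0, rS := 0), snd s)" by (simp add: S_def e_def)
  have Sd: "S d = ((fst s)(rJ := d, rS := of_bool (dot a b \<noteq> 0)), snd s)"
    using a(1) unfolding S_def e_def dot_nonzero_iff by (simp add: cube_def)
  have "wp v (While (Bin Less (Reg rJ) (Reg rD)) (Seq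
     (Assign rS (Bin Or (Reg rS) (Bin And (Mem (Reg rSrc \<oplus> Reg rJ)) (Mem (Reg rYP \<oplus> Reg rJ)))))
     (Assign rJ (Reg rJ \<oplus> Num 1))) # Skip # ks) (S 0) (Suc (Suc (Suc (Suc (Suc t))))) Q"
  proof (rule wp_While[where n = d and Inv = "\<lambda>i s' t'. s' = S i \<and> t' = 4 * i + (Suc (Suc (Suc (Suc (Suc t)))))"])
    fix i s' t'
    assume i: "i < d" and s': "s' = S i \<and> t' = 4 * i + (Suc (Suc (Suc (Suc (Suc t)))))"
    have ab: "a ! i = 0 \<or> a ! i = 1" "b ! i = 0 \<or> b ! i = 1"
      using cube_nth a(1) b(1) i by blast+
    have regs': "fst (S i) rD = d" "fst (S i) rJ = i" "fst (S i) rSrc = src" "fst (S i) rYP = yp"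
      "fst (S i) rS = e i"
      "snd (S i) (src + i) = a ! i" "snd (S i) (yp + i) = b ! i"
      using regs a b i by (auto simp: S_def)
    have dot_Suc: "Bit_Operations.or (e i) (Bit_Operations.and (a ! i) (b ! i)) = e (Suc i)"
      using ab unfolding e_def by (auto simp: less_Suc_eq)
    have S: "S (Suc i) = ((fst (S i))(rS := e (Suc i), rJ := Suc i), snd (S i))"
      unfolding S_def by (auto simp: fun_eq_iff)
    have m: "a ! i mod 2 ^ v = a ! i" "b ! i mod 2 ^ v = b ! i" "Bit_Operations.and (a ! i) (b ! i) mod 2 ^ v = Bit_Operations.and (a ! i) (b ! i)"
      "\<And>j. e j mod 2 ^ v = e j"
      using ab v v1 unfolding e_def by auto
    show "eval_expr v s' (Bin Less (Reg rJ) (Reg rD)) \<noteq> 0 \<and>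
      wp v [Seq (Assign rS (Bin Or (Reg rS) (Bin And (Mem (Reg rSrc \<oplus> Reg rJ)) (Mem (Reg rYP \<oplus> Reg rJ)))))
     (Assign rJ (Reg rJ \<oplus> Num 1))] s' (Suc t')
        (\<lambda>s' t'. s' = S (Suc i) \<and> t' = 4 * Suc i + (Suc (Suc (Suc (Suc (Suc t))))))"
      unfolding wp_simps using i s' le v v1
      by (intro conjI wp_Nil) (simp_all add: regs' m dot_Suc S)
  qed (use regs cont le v v1 in \<open>simp_all add: S_def Sd[unfolded S_def] wp_simps\<close>)
  then show ?thesis using v unfolding dot_test_def seqs.simps wp_simps by (simp add: S0)
qed

section \<open>Writing the embedded vectors into a fresh region\<close>

definition build_left :: cmd where
  "build_left = While (Bin Less (Reg rI) (Reg rNA)) (seqs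
     [If (Bin Equal (Mem (Reg rR \<oplus> Reg rI)) (Num 0))
        (seqs [Assign rDst (Reg rQ \<oplus> Reg rD), copy, Assign rQ (Reg rQ \<oplus> Reg rDD)]) Skip,
      Assign rSrc (Reg rSrc \<oplus> Reg rD), Assign rI (Reg rI \<oplus> Num 1)])"

definition build_right :: cmd where
  "build_right = While (Bin Less (Reg rI) (Reg rNB)) (seqs
     [Assign rDst (Reg rQ), copy,
      Assign rDst (Reg rQ \<oplus> Reg rD), Assign rY (Num 1), copy, Assign rY (Num 0),
      Assign rQ (Reg rQ \<oplus> Reg rDD),
      Assign rSrc (Reg rSrc \<oplus> Reg rD), Assign rI (Reg rI \<oplus> Num 1)])"

text \<open>Since \<open>rep\<close> pads with zeros, \<open>k\<close> untouched cells before the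
  copied block and any number \<open>k'\<close> after it already count as written zeros. This is how
  zero blocks and padding of embedded vectors come for free.\<close>

lemma wp_copy_rep:
  assumes v: "0 < v"
    and regs: "fst s rD = d" "fst s rSrc = src" "fst s rDst = base + length zs + k" "fst s rY = y"
    and y: "y < 2" and le: "src + d \<le> base" "base + length zs + k + d < 2 ^ v"
    and x: "x \<in> cube d" "\<And>j. j < d \<Longrightarrow> snd s (src + j) = x ! j"
    and rep: "\<And>a. snd s (base + a) = rep zs a"
    and cont: "\<And>s'. fst s' = (fst s)(rJ := d) \<Longrightarrow> \<forall>a<base. snd s' a = snd s a \<Longrightarrow>
      (\<And>k' a. snd s' (base + a) = rep (zs @ replicate k 0 @ map (\<lambda>z. Bit_Operations.xor z y) x @ replicate k' 0) a)
      \<Longrightarrow> wp v ks s' (Suc (4 * d + Suc (Suc t))) Q"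
  shows "wp v (copy # ks) s t Q"
proof (rule wp_copy[OF v regs y _ le(2)])
  show "src + d \<le> base + length zs + k" using le by simp
  show "snd s (src + j) = x ! j \<and> x ! j < 2" if "j < d" for j
    using x(2)[OF that] cube_nth[OF x(1) that] by auto
  have len: "length x = d" using x(1) by (simp add: cube_def)
  show "wp v ks ((fst s)(rJ := d),
      \<lambda>a. if base + length zs + k \<le> a \<and> a < base + length zs + k + d
        then Bit_Operations.xor (x ! (a - (base + length zs + k))) y else snd s a)
      (Suc (4 * d + Suc (Suc t))) Q"
  proof (rule cont)
    show "snd ((fst s)(rJ := d),
      \<lambda>a. if base + length zs + k \<le> a \<and> a < base + length zs + k + d
        then Bit_Operations.xor (x ! (a - (base + length zs + k))) y else snd s a) (base + a)
      = rep (zs @ replicate k 0 @ map (\<lambda>z. Bit_Operations.xor z y) x @ replicate k' 0) a" for k' a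
    proof (cases "length zs + k \<le> a \<and> a < length zs + k + d")
      case True
      then obtain j where "a = length zs + k + j" "j < d"
        by (metis le_Suc_ex nat_add_left_cancel_less)
      then show ?thesis by (simp add: rep_append len) (simp add: rep_def len)
    next
      case False
      then show ?thesis by (auto simp: rep_append len rep) (simp_all add: rep_def len)
    qed
  qed auto
qed

text \<open>The candidates in input order. A candidate \<open>j\<close> stands at position
  \<open>length (chosen Al j)\<close> of the query, so queries and answers are matched by scanning
  both in step.\<close>

definition chosen :: "nat set \<Rightarrow> nat \<Rightarrow> nat list" where
  "chosen Al i = filter (\<lambda>j. j \<in> Al) [0..<i]"

lemma chosen_0 [simp]: "chosen Al 0 = []"
  by (simp add: chosen_def)

lemma chosen_Suc: "chosen Al (Suc i) = chosen Al i @ (if i \<in> Al then [i] else [])"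
  by (simp add: chosen_def)

lemma length_chosen_le: "length (chosen Al i) \<le> i"
  unfolding chosen_def using length_filter_le[of _ "[0..<i]"] by simp

text \<open>The region is zero beyond \<open>zs\<close>, so for each candidate only the middle block
  is written, at distance \<open>d\<close> behind \<open>rQ\<close>; advancing \<open>rQ\<close> by
  \<open>D\<close> then accounts for the zero blocks on both sides.\<close>

lemma wp_build_left:
  fixes xs :: "nat list list"
  assumes v: "0 < v"
    and regs: "fst s rI = 0" "fst s rNA = length xs" "fst s rR = R" "fst s rD = d" "fst s rDD = D"
      "fst s rQ = base + length zs" "fst s rSrc = 4" "fst s rY = 0"
    and R: "4 + length xs * d \<le> R" "length zs + length xs * D \<le> R" "R + length xs \<le> base" "base + R < 2 ^ v"
    and D: "2 * d \<le> D" and xs: "set xs \<subseteq> cube d"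
    and input: "\<And>i j. i < length xs \<Longrightarrow> j < d \<Longrightarrow> snd s (4 + i * d + j) = xs ! i ! j"
    and flags: "\<And>i. i < length xs \<Longrightarrow> snd s (R + i) = of_bool (i \<notin> Al)"
    and rep: "\<And>a. snd s (base + a) = rep zs a"
    and cont: "\<And>s' t' zs'. zs' = zs @ concat (map (\<lambda>i. emb_left D (xs ! i)) (chosen Al (length xs))) \<Longrightarrow>
      fst s' rQ = base + length zs' \<Longrightarrow> fst s' rSrc = 4 + length xs * d \<Longrightarrow>
      \<forall>r. r \<notin> {rI, rJ, rSrc, rQ, rDst} \<longrightarrow> fst s' r = fst s r \<Longrightarrow>
      \<forall>a<base. snd s' a = snd s a \<Longrightarrow> (\<And>a. snd s' (base + a) = rep zs' a) \<Longrightarrow>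
      t' \<le> Suc (t + length xs * (4 * d + 20)) \<Longrightarrow> wp v ks s' t' Q"
  shows "wp v (build_left # ks) s t Q"
proof -
  define Z where "Z i = zs @ concat (map (\<lambda>i. emb_left D (xs ! i)) (chosen Al i))" for i
  define G where "G i s' t' \<longleftrightarrow> fst s' rI = i \<and> fst s' rQ = base + length (Z i) \<and>
      fst s' rSrc = 4 + i * d \<and>
      (\<forall>r. r \<notin> {rI, rJ, rSrc, rQ, rDst} \<longrightarrow> fst s' r = fst s r) \<and>
      (\<forall>a<base. snd s' a = snd s a) \<and> (\<forall>a. snd s' (base + a) = rep (Z i) a) \<and>
      t' \<le> t + i * (4 * d + 20)" for i s' t'
  have len_x: "length (xs ! i) = d" if "i < length xs" for i
    using subsetD[OF xs nth_mem[OF that]] by (simp add: cube_def)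
  have len_emb: "length (emb_left D (xs ! i)) = D" if "i < length xs" for i
    using len_x[OF that] D by (simp add: emb_left_def)
  have len_Z: "length (Z i) \<le> length zs + i * D" if "i \<le> length xs" for i
    using that
  proof (induction i)
    case (Suc i)
    then show ?case using len_emb[of i] by (auto simp: Z_def chosen_Suc)
  qed (simp add: Z_def)
  show ?thesis unfolding build_left_def
  proof (rule wp_While[where n = "length xs" and Inv = G])
    show "G 0 s t" using regs rep by (simp add: G_def Z_def)
  next
    fix i s' t'
    assume i: "i < length xs" and G: "G i s' t'"
    have idx: "i * d + d \<le> length xs * d" "i * D + D \<le> length xs * D"
      using mult_le_mono1[of "Suc i" "length xs" d] mult_le_mono1[of "Suc i" "length xs" D] i by simp_all
    have Zi: "length (Z i) + D \<le> R" using len_Z[of i] i idx R by linarith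
    have b: "R < 2 ^ v" "base < 2 ^ v" "D < 2 ^ v" "d < 2 ^ v" "length xs < 2 ^ v" "i < 2 ^ v" "R + i < 2 ^ v"
      "base + length (Z i) < 2 ^ v" "base + length (Z i) + D < 2 ^ v" "base + length (Z i) + d < 2 ^ v"
      "4 + i * d + d < 2 ^ v" "4 + i * d < 2 ^ v" "Suc i < 2 ^ v" "Suc 0 < 2 ^ v"
      using R Zi i D idx by linarith+
    have regs': "fst s' rI = i" "fst s' rQ = base + length (Z i)" "fst s' rSrc = 4 + i * d"
      "fst s' rNA = length xs" "fst s' rR = R" "fst s' rD = d" "fst s' rDD = D" "fst s' rY = 0"
      using G regs by (auto simp: G_def)
    have mem': "snd s' (R + i) = of_bool (i \<notin> Al)" "\<And>j. j < d \<Longrightarrow> snd s' (4 + i * d + j) = xs ! i ! j"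
      "\<And>a. snd s' (base + a) = rep (Z i) a"
      using G flags[OF i] input[OF i] R i idx by (auto simp: G_def)
    have "wp v [seqs [If (Bin Equal (Mem (Reg rR \<oplus> Reg rI)) (Num 0))
        (seqs [Assign rDst (Reg rQ \<oplus> Reg rD), copy, Assign rQ (Reg rQ \<oplus> Reg rDD)]) Skip,
      Assign rSrc (Reg rSrc \<oplus> Reg rD), Assign rI (Reg rI \<oplus> Num 1)]] s' (Suc t') (G (Suc i))"
    proof (cases "i \<in> Al")
      case False
      then have "Z (Suc i) = Z i" by (simp add: Z_def chosen_Suc)
      with False show ?thesis using b v G
        by (simp add: wp_simps regs' mem', intro wp_Nil) (simp add: G_def)
    next
      case True
      then have ZS: "Z (Suc i) = Z i @ replicate d 0 @ xs ! i @ replicate (D - 2 * d) 0"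
        using len_x[OF i] by (simp add: Z_def chosen_Suc emb_left_def)
      have lenS: "length (Z (Suc i)) = length (Z i) + D" using len_x[OF i] D by (simp add: ZS)
      from True have step: ?thesis if "wp v [copy, seqs [Assign rQ (Reg rQ \<oplus> Reg rDD)],
            seqs [Assign rSrc (Reg rSrc \<oplus> Reg rD), Assign rI (Reg rI \<oplus> Num 1)]]
          ((fst s')(rDst := base + length (Z i) + d), snd s') (Suc (Suc (Suc (Suc (Suc (Suc t')))))) (G (Suc i))"
        using that b v by (simp add: wp_simps regs' mem' add.assoc)
      show ?thesis
      proof (rule step, rule wp_copy_rep[where d = d and base = base and zs = "Z i" and k = d and x = "xs ! i" and y = 0 and src = "4 + i * d"])
        fix s2
        assume s2: "fst s2 = (fst ((fst s')(rDst := base + length (Z i) + d), snd s'))(rJ := d)"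
          "\<forall>a<base. snd s2 a = snd ((fst s')(rDst := base + length (Z i) + d), snd s') a"
          "\<And>k' a. snd s2 (base + a) = rep (Z i @ replicate d 0 @ map (\<lambda>z. Bit_Operations.xor z 0) (xs ! i) @ replicate k' 0) a"
        \<comment> \<open>The \<open>D - 2 * d\<close> untouched cells behind the copy serve as the
          padding of the embedded vector.\<close>
        have rep2: "snd s2 (base + a) = rep (Z (Suc i)) a" for a
          using s2(3)[of a "D - 2 * d"] by (simp add: ZS)
        show "wp v [seqs [Assign rQ (Reg rQ \<oplus> Reg rDD)],
            seqs [Assign rSrc (Reg rSrc \<oplus> Reg rD), Assign rI (Reg rI \<oplus> Num 1)]]
          s2 (Suc (4 * d + Suc (Suc (Suc (Suc (Suc (Suc (Suc (Suc t'))))))))) (G (Suc i))"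
          using b v G s2(1,2) rep2
          by (simp add: wp_simps regs', intro wp_Nil) (simp add: G_def lenS)
      qed (use b v regs' mem' R idx xs i nth_mem[OF i] D Zi in auto)
    qed
    then show "eval_expr v s' (Bin Less (Reg rI) (Reg rNA)) \<noteq> 0 \<and>
       wp v [seqs [If (Bin Equal (Mem (Reg rR \<oplus> Reg rI)) (Num 0))
        (seqs [Assign rDst (Reg rQ \<oplus> Reg rD), copy, Assign rQ (Reg rQ \<oplus> Reg rDD)]) Skip,
      Assign rSrc (Reg rSrc \<oplus> Reg rD), Assign rI (Reg rI \<oplus> Num 1)]] s' (Suc t') (G (Suc i))"
      using b i v by (simp add: regs')
  next
    fix s' t'
    assume G: "G (length xs) s' t'"
    then have "fst s' rI = length xs" "fst s' rNA = length xs" using regs by (auto simp: G_def)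
    moreover have "wp v ks s' (Suc t') Q"
      using G by (intro cont[of "Z (length xs)"]) (auto simp: G_def Z_def)
    ultimately show "eval_expr v s' (Bin Less (Reg rI) (Reg rNA)) = 0 \<and> wp v ks s' (Suc t') Q"
      by simp
  qed
qed

lemma xor_1_bit: "z = 0 \<or> z = 1 \<Longrightarrow> Bit_Operations.xor z (Suc 0) = 1 - (z :: nat)"
  by auto

lemma wp_build_right:
  fixes ys :: "nat list list"
  assumes v: "0 < v"
    and regs: "fst s rI = 0" "fst s rNB = length ys" "fst s rD = d" "fst s rDD = D"
      "fst s rQ = base + length zs" "fst s rSrc = src" "fst s rY = 0"
    and R: "src + length ys * d \<le> base" "length zs + length ys * D \<le> R" "length ys \<le> R" "base + R < 2 ^ v"
    and D: "2 * d \<le> D" and ys: "set ys \<subseteq> cube d"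
    and input: "\<And>i j. i < length ys \<Longrightarrow> j < d \<Longrightarrow> snd s (src + i * d + j) = ys ! i ! j"
    and rep: "\<And>a. snd s (base + a) = rep zs a"
    and cont: "\<And>s' t'.
      \<forall>r. r \<notin> {rI, rJ, rSrc, rQ, rDst, rY} \<longrightarrow> fst s' r = fst s r \<Longrightarrow>
      \<forall>a<base. snd s' a = snd s a \<Longrightarrow>
      (\<And>a. snd s' (base + a) = rep (zs @ concat (map (emb_right D) ys)) a) \<Longrightarrow>
      t' \<le> Suc (t + length ys * (8 * d + 40)) \<Longrightarrow> wp v ks s' t' Q"
  shows "wp v (build_right # ks) s t Q"
proof -
  define Z where "Z i = zs @ concat (map (emb_right D) (take i ys))" for i
  define G where "G i s' t' \<longleftrightarrow> fst s' rI = i \<and> fst s' rQ = base + length (Z i) \<and>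
      fst s' rSrc = src + i * d \<and> fst s' rY = 0 \<and>
      (\<forall>r. r \<notin> {rI, rJ, rSrc, rQ, rDst, rY} \<longrightarrow> fst s' r = fst s r) \<and>
      (\<forall>a<base. snd s' a = snd s a) \<and> (\<forall>a. snd s' (base + a) = rep (Z i) a) \<and>
      t' \<le> t + i * (8 * d + 40)" for i s' t'
  have len_y: "length y = d" if "y \<in> set ys" for y
    using subsetD[OF ys that] by (simp add: cube_def)
  have len_emb: "length (emb_right D y) = D" if "y \<in> set ys" for y
    using len_y[OF that] D by (simp add: emb_right_def)
  have len_Z: "length (Z i) = length zs + i * D" if "i \<le> length ys" for i
    using that length_concat_eq[of "map (emb_right D) (take i ys)" D] len_emb
    by (auto simp: Z_def dest: in_set_takeD)
  show ?thesis unfolding build_right_def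
  proof (rule wp_While[where n = "length ys" and Inv = G])
    show "G 0 s t" using regs rep by (simp add: G_def Z_def)
  next
    fix i s' t'
    assume i: "i < length ys" and G: "G i s' t'"
    have idx: "i * d + d \<le> length ys * d" "i * D + D \<le> length ys * D"
      using mult_le_mono1[of "Suc i" "length ys" d] mult_le_mono1[of "Suc i" "length ys" D] i by simp_all
    have Zi: "length (Z i) + D \<le> R" using len_Z[of i] i idx R by linarith
    have b: "base < 2 ^ v" "D < 2 ^ v" "d < 2 ^ v" "length ys < 2 ^ v" "i < 2 ^ v"
      "base + length (Z i) < 2 ^ v" "base + length (Z i) + D < 2 ^ v" "base + length (Z i) + d < 2 ^ v"
      "src + i * d + d < 2 ^ v" "src + i * d < 2 ^ v" "Suc i < 2 ^ v" "Suc 0 < 2 ^ v"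
      using R Zi i D idx one_less_power[of "2 :: nat" v] v by linarith+
    have y_cube: "ys ! i \<in> cube d" using ys i nth_mem by blast
    have regs': "fst s' rI = i" "fst s' rQ = base + length (Z i)" "fst s' rSrc = src + i * d"
      "fst s' rNB = length ys" "fst s' rD = d" "fst s' rDD = D" "fst s' rY = 0"
      using G regs by (auto simp: G_def)
    have mem': "\<And>j. j < d \<Longrightarrow> snd s' (src + i * d + j) = ys ! i ! j"
      "\<And>a. snd s' (base + a) = rep (Z i) a"
      using G input[OF i] R i idx by (auto simp: G_def)
    have neg: "map (\<lambda>z. Bit_Operations.xor z (Suc 0)) (ys ! i) = map (\<lambda>z. 1 - z) (ys ! i)"
      using y_cube by (intro map_cong xor_1_bit) (auto simp: cube_def)
    have ZS: "Z (Suc i) = Z i @ ys ! i @ map (\<lambda>z. 1 - z) (ys ! i) @ replicate (D - 2 * d) 0"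
      using len_y[OF nth_mem[OF i]] i by (simp add: Z_def take_Suc_conv_app_nth emb_right_def)
    have lenS: "length (Z (Suc i)) = length (Z i) + D"
      using len_y[OF nth_mem[OF i]] D by (simp add: ZS)
    have lenM: "length (Z i @ ys ! i) = length (Z i) + d"
      using len_y[OF nth_mem[OF i]] by simp
    let ?tail2 = "[Assign rY (Num 0), Assign rQ (Reg rQ \<oplus> Reg rDD),
      Assign rSrc (Reg rSrc \<oplus> Reg rD), Assign rI (Reg rI \<oplus> Num 1)]"
    let ?tail1 = "[Assign rDst (Reg rQ \<oplus> Reg rD), Assign rY (Num 1), copy] @ ?tail2"
    have "wp v [copy, seqs ?tail1] ((fst s')(rDst := base + length (Z i)), snd s')
        (Suc (Suc (Suc (Suc t')))) (G (Suc i))"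
    proof (rule wp_copy_rep[where d = d and base = base and zs = "Z i" and k = 0 and x = "ys ! i"
          and y = 0 and src = "src + i * d"])
      fix s2
      assume s2: "fst s2 = (fst ((fst s')(rDst := base + length (Z i)), snd s'))(rJ := d)"
        "\<forall>a<base. snd s2 a = snd ((fst s')(rDst := base + length (Z i)), snd s') a"
        "\<And>k' a. snd s2 (base + a) = rep (Z i @ replicate 0 0 @ map (\<lambda>z. Bit_Operations.xor z 0) (ys ! i) @ replicate k' 0) a"
      have rep2: "snd s2 (base + a) = rep (Z i @ ys ! i) a" for a
        using s2(3)[of a 0] by simp
      have inp2: "snd s2 (src + i * d + j) = ys ! i ! j" if "j < d" for j
        using s2(2) mem'(1)[OF that] R(1) that idx(1) by simp
      have "wp v [copy, seqs ?tail2] ((fst s2)(rDst := base + length (Z i) + d, rY := 1), snd s2)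
        (Suc (Suc (Suc (Suc (Suc (Suc (4 * d + Suc (Suc (Suc (Suc (Suc (Suc t')))))))))))) (G (Suc i))"
      proof (rule wp_copy_rep[where d = d and base = base and zs = "Z i @ ys ! i" and k = 0 and x = "ys ! i"
          and y = 1 and src = "src + i * d"])
        fix s3
        assume s3: "fst s3 = (fst ((fst s2)(rDst := base + length (Z i) + d, rY := 1), snd s2))(rJ := d)"
          "\<forall>a<base. snd s3 a = snd ((fst s2)(rDst := base + length (Z i) + d, rY := 1), snd s2) a"
          "\<And>k' a. snd s3 (base + a) = rep ((Z i @ ys ! i) @ replicate 0 0 @ map (\<lambda>z. Bit_Operations.xor z 1) (ys ! i) @ replicate k' 0) a"
        have rep3: "snd s3 (base + a) = rep (Z (Suc i)) a" for a
          using s3(3)[of a "D - 2 * d"] neg by (simp add: ZS)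
        show "wp v [seqs ?tail2] s3 (Suc (4 * d + Suc (Suc (Suc (Suc (Suc (Suc (Suc (Suc (4 * d + Suc (Suc (Suc (Suc (Suc (Suc t'))))))))))))))) (G (Suc i))"
          using b v G s2(1,2) s3(1,2) rep3
          by (simp add: wp_simps regs', intro wp_Nil) (simp add: G_def lenS)
      qed (use b v regs' inp2 s2(1) rep2 R idx y_cube D Zi lenM in auto)
      then show "wp v [seqs ?tail1]
          s2 (Suc (4 * d + Suc (Suc (Suc (Suc (Suc (Suc t')))))))  (G (Suc i))"
        using b v by (simp add: wp_simps s2(1) regs')
    qed (use b v regs' mem' R idx y_cube D Zi in auto)
    then have "wp v [seqs [Assign rDst (Reg rQ), copy,
      Assign rDst (Reg rQ \<oplus> Reg rD), Assign rY (Num 1), copy, Assign rY (Num 0),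
      Assign rQ (Reg rQ \<oplus> Reg rDD),
      Assign rSrc (Reg rSrc \<oplus> Reg rD), Assign rI (Reg rI \<oplus> Num 1)]] s' (Suc t') (G (Suc i))"
      using b v by (simp add: wp_simps regs')
    then show "eval_expr v s' (Bin Less (Reg rI) (Reg rNB)) \<noteq> 0 \<and>
       wp v [seqs [Assign rDst (Reg rQ), copy,
      Assign rDst (Reg rQ \<oplus> Reg rD), Assign rY (Num 1), copy, Assign rY (Num 0),
      Assign rQ (Reg rQ \<oplus> Reg rDD),
      Assign rSrc (Reg rSrc \<oplus> Reg rD), Assign rI (Reg rI \<oplus> Num 1)]] s' (Suc t') (G (Suc i))"
      using b i v by (simp add: regs')
  next
    fix s' t'
    assume G: "G (length ys) s' t'"
    then have "fst s' rI = length ys" "fst s' rNB = length ys" using regs by (auto simp: G_def)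
    moreover have "wp v ks s' (Suc t') Q"
      using G by (intro cont) (auto simp: G_def Z_def)
    ultimately show "eval_expr v s' (Bin Less (Reg rI) (Reg rNB)) = 0 \<and> wp v ks s' (Suc t') Q"
      by simp
  qed
qed

text \<open>Simulated registers are shared by all queries and must be reset to their initial value
  0, whereas simulated memory is fresh for each query.\<close>

primrec clear_regs :: "nat \<Rightarrow> cmd" where
  "clear_regs 0 = Skip"
| "clear_regs (Suc m) = Seq (Assign (m + offset) (Num 0)) (clear_regs m)"

lemma wp_clear_regs:
  assumes "wp v ks (\<lambda>r. if offset \<le> r \<and> r < m + offset then 0 else fst s r, snd s) (t + 2 * m + 1) Q"
  shows "wp v (clear_regs m # ks) s t Q"
  using assms
proof (induction m arbitrary: s t)
  case (Suc m)
  have eq: "(\<lambda>r. if offset \<le> r \<and> r < m + offset then 0 else fst ((fst s)(m + offset := 0), snd s) r)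
      = (\<lambda>r. if offset \<le> r \<and> r < Suc m + offset then 0 else fst s r)" by (auto simp: fun_eq_iff)
  have "wp v ks (\<lambda>r. if offset \<le> r \<and> r < m + offset then 0 else fst ((fst s)(m + offset := 0), snd s) r,
      snd ((fst s)(m + offset := 0), snd s)) (Suc (Suc t) + 2 * m + 1) Q"
    unfolding eq using Suc.prems by simp
  then have "wp v (clear_regs m # ks) ((fst s)(m + offset := 0), snd s) (Suc (Suc t)) Q"
    by (rule Suc.IH)
  then show ?case by (simp add: wp_simps)
next
  case 0
  have "(\<lambda>r. if offset \<le> r \<and> r < 0 + offset then 0 else fst s r) = fst s" by auto
  with 0 show ?case by (simp add: wp_simps)
qed

section \<open>One query to the Chamfer algorithm\<close>

text \<open>The counter doubles as the guess of the dimension: while it runs through all numbers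
  below \<open>K * d\<close>, its residue modulo \<open>K\<close> takes each value \<open>d\<close>
  times. The announced size stays \<open>n\<close> although the candidates become fewer, because the
  dimension and the word size for which the algorithm is correct depend on that size.\<close>

definition prepare :: "nat \<Rightarrow> nat \<Rightarrow> cmd" where
  "prepare K m = seqs
     [Assign rCnt (Bin Sub (Reg rCnt) (Num 1)),
      Assign rDD (Bin Mul (Num K) (Reg rD) \<oplus> Bin Mod (Reg rCnt) (Num K)),
      Store (Reg rBase) (Reg rN), Store (Reg rBase \<oplus> Num 1) (Reg rDD),
      Store (Reg rBase \<oplus> Num 2) (Reg rAlv), Store (Reg rBase \<oplus> Num 3) (Reg rNB),
      Assign rQ (Reg rBase \<oplus> Num 4), Assign rSrc (Num 4), Assign rI (Num 0), Assign rY (Num 0),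
      build_left, Assign rI (Num 0), build_right, clear_regs m, Assign rClk (Reg rL)]"

text \<open>Nothing in the answer is trusted: an index outside the second list is ignored, and a
  vector is discarded only after its inner product with the reported one has been recomputed and
  found to be 0.\<close>

definition collect_loop :: cmd where
  "collect_loop = While (Bin Less (Reg rI) (Reg rNA)) (seqs
     [If (Bin Equal (Mem (Reg rR \<oplus> Reg rI)) (Num 0))
        (seqs [Assign rV (Mem (Reg rQ)), Assign rQ (Reg rQ \<oplus> Num 1),
           If (Bin Less (Reg rV) (Reg rNB))
             (seqs [Assign rYP (Reg rYB \<oplus> Bin Mul (Reg rV) (Reg rD)), dot_test,
                If (Bin Equal (Reg rS) (Num 0))
                  (Seq (Store (Reg rR \<oplus> Reg rI) (Num 1)) (Assign rAlv (Bin Sub (Reg rAlv) (Num 1)))) Skip])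
             Skip]) Skip,
      Assign rSrc (Reg rSrc \<oplus> Reg rD), Assign rI (Reg rI \<oplus> Num 1)])"

definition collect :: cmd where
  "collect = seqs
     [Assign rI (Num 0), Assign rSrc (Num 4), Assign rQ (Reg rBase),
      Assign rYB (Num 4 \<oplus> Bin Mul (Reg rNA) (Reg rD)), collect_loop,
      Assign rBase (Reg rBase \<oplus> Reg rR)]"

section \<open>Memory layout and invariants of the query loop\<close>

locale reduction =
  fixes v w R K L n d m :: nat and xs ys :: "nat list list"
  assumes d_pos: "0 < d" and K: "2 \<le> K" and w_less_v: "w < v" and pow_le_R: "2 ^ w \<le> R"
    and L_less: "L < 2 ^ v"
    and xs: "set xs \<subseteq> cube d" "length xs \<le> n" and ys: "set ys \<subseteq> cube d" "length ys \<le> n"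
    and region: "4 + (2 * n + 1) * (K * d + K) \<le> R" and fits: "(K * d + 3) * R \<le> 2 ^ v"
begin

text \<open>
  Memory is divided into regions of length \<open>R\<close>: the input, then a flag for every discarded vector,
  then one fresh region for each query, which avoids clearing the memory of the simulated program.
  The argument \<open>i\<close> is the number of queries that remain.
\<close>

definition base :: "nat \<Rightarrow> nat" where
  "base i = (K * d - i + 2) * R"

text \<open>For \<open>d = D div K\<close> this is the true dimension \<open>D\<close> exactly when
  \<open>i\<close> and \<open>D\<close> are congruent modulo \<open>K\<close>.\<close>

definition dim :: "nat \<Rightarrow> nat" where
  "dim i = K * d + i mod K"

text \<open>\<open>Al\<close> contains the indices of the remaining candidates. That every hitting
  vector is among them is the soundness half of the argument, and it is preserved whatever the
  simulated program does.\<close>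

definition common :: "nat set \<Rightarrow> state \<Rightarrow> bool" where
  "common Al s \<longleftrightarrow> Al \<subseteq> {..<length xs} \<and> (\<forall>j<length xs. hits (xs ! j) (set ys) \<longrightarrow> j \<in> Al) \<and>
     fst s rW = 2 ^ w \<and> fst s rN = n \<and> fst s rD = d \<and> fst s rNA = length xs \<and>
     fst s rNB = length ys \<and> fst s rR = R \<and> fst s rL = L \<and> fst s rAlv = card Al \<and>
     (\<forall>a<R. snd s a = rep (encode n d xs ys) a) \<and>
     (\<forall>j<length xs. snd s (R + j) = of_bool (j \<notin> Al))"

definition inv :: "nat \<Rightarrow> nat set \<Rightarrow> state \<Rightarrow> bool" where
  "inv i Al s \<longleftrightarrow> common Al s \<and> fst s rBase = base i \<and> fst s rCnt = i \<and>
     (\<forall>a\<ge>base i. snd s a = 0)"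

definition query :: "nat \<Rightarrow> nat set \<Rightarrow> nat list" where
  "query i Al = encode n (dim i) (map (\<lambda>j. emb_left (dim i) (xs ! j)) (chosen Al (length xs)))
     (map (emb_right (dim i)) ys)"

text \<open>All cells from the start of the region on are described, not only the region: inside it
  they form the initial memory of the simulated run, and beyond it they give the zeros that later
  queries rely on.\<close>

definition ready :: "nat \<Rightarrow> nat set \<Rightarrow> state \<Rightarrow> bool" where
  "ready i Al s \<longleftrightarrow> common Al s \<and> fst s rBase = base (Suc i) \<and> fst s rCnt = i \<and>
     fst s rClk = L \<and> (\<forall>r<m. fst s (r + offset) = 0) \<and>
     (\<forall>a. snd s (base (Suc i) + a) = rep (query i Al) a)"

definition prepare_time :: nat where
  "prepare_time = n * (12 * d + 60) + 2 * m + 100"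

definition collect_time :: nat where
  "collect_time = n * (4 * d + 50) + 30"

lemma v_pos: "0 < v"
  using w_less_v by simp

lemma one_less: "Suc 0 < 2 ^ v"
  using one_less_power[of "2 :: nat" v] v_pos by simp

lemma dim_bounds: "2 * d \<le> dim i" "dim i < K * d + K"
  using K mult_le_mono1[OF K, of d] unfolding dim_def by (auto intro: trans_le_add1)

text \<open>A query consists of 4 header cells and at most \<open>2 * n\<close> vectors of length
  below \<open>K * d + K\<close>. The one additional vector length in \<open>region\<close> makes
  the remaining parameters smaller than \<open>R\<close>.\<close>

lemma R_bounds: "4 + n * d + n * d \<le> R" "4 + n * dim i + n * dim i \<le> R" "n < R" "K * d + K < R" "d < R" "dim i < R" "4 \<le> R"
proof -
  have D: "n * dim i \<le> n * (K * d + K)" using dim_bounds(2)[of i] by (intro mult_le_mono2) simp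
  have "1 * d \<le> K * d" using K by (intro mult_le_mono1) simp
  then have dd: "d \<le> K * d + K" by linarith
  have nd: "n * d \<le> n * (K * d + K)" using dd by (intro mult_le_mono2)
  have nn: "n * 1 \<le> n * (K * d + K)" using K by (intro mult_le_mono2) simp
  have r: "4 + n * (K * d + K) + n * (K * d + K) + (K * d + K) \<le> R"
    using region by (simp add: algebra_simps)
  show "4 + n * d + n * d \<le> R" using nd r by linarith
  show "4 + n * dim i + n * dim i \<le> R" using D r by linarith
  show "n < R" using nn r by linarith
  show "K * d + K < R" using r by linarith
  show "d < R" using dd r by linarith
  show "dim i < R" using dim_bounds(2)[of i] r by linarith
  show "4 \<le> R" using r by linarith
qed

lemma base_Suc: "i < K * d \<Longrightarrow> base (Suc i) + R = base i"
  unfolding base_def by (simp add: Suc_diff_Suc[symmetric] algebra_simps)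

lemma base_ge: "2 * R \<le> base i"
  unfolding base_def by simp

text \<open>Input, flags and \<open>K * d\<close> queries occupy \<open>K * d + 2\<close> regions;
  one more is reserved so that \<open>base 0\<close>, the pointer after the last query, is still a
  word.\<close>

lemma base_fits: "base i + R \<le> 2 ^ v"
proof -
  have "base i + R = (K * d - i + 3) * R" by (simp add: base_def algebra_simps)
  also have "\<dots> \<le> (K * d + 3) * R" by (intro mult_le_mono1) simp
  finally show ?thesis using fits by linarith
qed

lemma base_Suc_fits: "i < K * d \<Longrightarrow> base (Suc i) + R < 2 ^ v"
  using base_Suc[of i] base_fits[of i] R_bounds(7) by linarith

lemma input_left:
  "common Al s \<Longrightarrow> i < length xs \<Longrightarrow> j < d \<Longrightarrow> snd s (4 + i * d + j) = xs ! i ! j"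
proof -
  assume c: "common Al s" and i: "i < length xs" and j: "j < d"
  have "i * d + j < length xs * d" using i j by (rule index_less)
  moreover have "length xs * d \<le> n * d" using xs(2) by (rule mult_le_mono1)
  ultimately have "4 + i * d + j < R" using R_bounds(1) by linarith
  then show ?thesis using c rep_encode_left[of xs d i j n ys] xs(1) i j
    by (auto simp: common_def cube_def)
qed

lemma input_right:
  "common Al s \<Longrightarrow> i < length ys \<Longrightarrow> j < d \<Longrightarrow> snd s (4 + length xs * d + i * d + j) = ys ! i ! j"
proof -
  assume c: "common Al s" and i: "i < length ys" and j: "j < d"
  have "i * d + j < length ys * d" using i j by (rule index_less)
  moreover have "length xs * d \<le> n * d" "length ys * d \<le> n * d"
    using xs(2) ys(2) by (auto intro: mult_le_mono1)
  ultimately have "4 + length xs * d + i * d + j < R" using R_bounds(1) by linarith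
  then show ?thesis using c rep_encode_right[of xs d ys i j n] xs(1) ys(1) i j
    by (auto simp: common_def cube_def)
qed

lemma card_le: "common Al s \<Longrightarrow> card Al \<le> length xs"
  unfolding common_def using card_mono[of "{..<length xs}" Al] by simp

lemma length_chosen: "Al \<subseteq> {..<length xs} \<Longrightarrow> length (chosen Al (length xs)) = card Al"
proof -
  assume "Al \<subseteq> {..<length xs}"
  then have "set (chosen Al (length xs)) = Al" by (auto simp: chosen_def)
  moreover have "distinct (chosen Al (length xs))" by (simp add: chosen_def)
  ultimately show ?thesis using distinct_card by fastforce
qed

lemma wp_prepare:
  assumes inv: "inv (Suc i) Al s" and i: "i < K * d"
  shows "wp v [prepare K m] s 0 (\<lambda>s' t. t \<le> prepare_time \<and> ready i Al s')"
proof -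
  let ?D = "dim i" and ?b = "base (Suc i)"
  have com: "common Al s" and regs: "fst s rBase = ?b" "fst s rCnt = Suc i"
    and zero: "\<And>a. ?b \<le> a \<Longrightarrow> snd s a = 0"
    using inv by (auto simp: inv_def)
  note regs1 = regs(1)[unfolded One_nat_def]
  have regs': "fst s rW = 2 ^ w" "fst s rN = n" "fst s rD = d" "fst s rNA = length xs"
     "fst s rNB = length ys" "fst s rR = R" "fst s rL = L" "fst s rAlv = card Al"
    using com by (auto simp: common_def)
  have len: "length xs * d \<le> n * d" "length ys * d \<le> n * d" "length xs * ?D \<le> n * ?D" "length ys * ?D \<le> n * ?D"
    using xs(2) ys(2) by (auto intro: mult_le_mono1)
  note R = R_bounds(1,3-7) R_bounds(2,6)[of i]
  have bf: "?b + R < 2 ^ v" "2 * R \<le> ?b" using base_Suc_fits[OF i] base_ge by auto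
  have ca: "card Al \<le> length xs" using card_le[OF com] .
  have b: "?b < 2 ^ v" "?b + 1 < 2 ^ v" "?b + 2 < 2 ^ v" "?b + 3 < 2 ^ v" "?b + 4 < 2 ^ v"
    "n < 2 ^ v" "?D < 2 ^ v" "card Al < 2 ^ v" "length ys < 2 ^ v" "K < 2 ^ v" "K * d < 2 ^ v" "d < 2 ^ v"
    "i < 2 ^ v" "Suc i < 2 ^ v" "4 < (2::nat) ^ v" "3 < (2::nat) ^ v" "2 < (2::nat) ^ v"
    using bf R ca xs(2) ys(2) i by linarith+
  define hdr where "hdr = [n, ?D, card Al, length ys]"
  have lh: "length hdr = 4" by (simp add: hdr_def)
  define s1 :: state where "s1 = ((fst s)(rCnt := i, rDD := ?D, rQ := ?b + 4, rSrc := 4, rI := 0, rY := 0),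
     (snd s)(?b := n, ?b + 1 := ?D, ?b + 2 := card Al, ?b + 3 := length ys))"
  have rep1: "snd s1 (?b + a) = rep hdr a" for a
    using zero[of "?b + a"] by (auto simp: s1_def hdr_def rep_def nth_Cons' numeral_3_eq_3 numeral_2_eq_2 eval_nat_numeral)
  have low1: "snd s1 a = snd s a" if "a < ?b" for a using that by (simp add: s1_def)
  have D_eval: "K * d + i mod K = ?D" by (simp add: dim_def)
  have iK: "i mod K < 2 ^ v" using b by (meson mod_less_eq_dividend order_le_less_trans)
  have "wp v [build_left, seqs [Assign rI (Num 0), build_right, clear_regs m, Assign rClk (Reg rL)]]
    s1 t1 (\<lambda>s' t. t \<le> prepare_time \<and> ready i Al s')" if t1: "t1 \<le> 50" for t1
  proof (rule wp_build_left[where R = R and d = d and D = ?D and xs = xs and Al = Al and base = ?b and zs = hdr])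
    show "snd s1 (4 + i * d + j) = xs ! i ! j" if "i < length xs" "j < d" for i j
    proof -
      have "4 + i * d + j < ?b" using index_less[OF that] len R bf by linarith
      then show ?thesis using low1 input_left[OF com that] by simp
    qed
    show "snd s1 (R + i) = of_bool (i \<notin> Al)" if "i < length xs" for i
    proof -
      have "R + i < ?b" using that xs(2) R bf by linarith
      then show ?thesis using low1 com that by (simp add: common_def)
    qed
    show "length hdr + length xs * ?D \<le> R" using len R lh by linarith
    show "4 + length xs * d \<le> R" using len R by linarith
    show "R + length xs \<le> ?b" using xs(2) R bf by linarith
  next
    fix s2 t2 zs2
    assume zs2: "zs2 = hdr @ concat (map (\<lambda>i. emb_left ?D (xs ! i)) (chosen Al (length xs)))"
      and s2: "fst s2 rQ = ?b + length zs2" "fst s2 rSrc = 4 + length xs * d"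
        "\<forall>r. r \<notin> {rI, rJ, rSrc, rQ, rDst} \<longrightarrow> fst s2 r = fst s1 r"
        "\<forall>a<?b. snd s2 a = snd s1 a" "\<And>a. snd s2 (?b + a) = rep zs2 a"
        "t2 \<le> Suc (t1 + length xs * (4 * d + 20))"
    have lz: "length zs2 \<le> 4 + length xs * ?D"
    proof -
      have "\<forall>x\<in>set (map (\<lambda>i. emb_left ?D (xs ! i)) (chosen Al (length xs))). length x = ?D"
        using xs(1) nth_mem[of _ xs] dim_bounds(1)[of i]
        by (force simp: chosen_def emb_left_def cube_def subset_iff)
      from length_concat_eq[OF this] show ?thesis
        using length_chosen_le[of Al "length xs"] by (simp add: zs2 hdr_def)
    qed
    have "wp v [build_right, seqs [clear_regs m, Assign rClk (Reg rL)]] ((fst s2)(rI := 0), snd s2)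
      t2' (\<lambda>s' t. t \<le> prepare_time \<and> ready i Al s')" if t2': "t2' \<le> t2 + 4" for t2'
    proof (rule wp_build_right[where src = "4 + length xs * d" and R = R and d = d and D = ?D and ys = ys and base = ?b and zs = zs2])
      show "snd ((fst s2)(rI := 0), snd s2) (4 + length xs * d + j * d + k) = ys ! j ! k"
        if "j < length ys" "k < d" for j k
      proof -
        have "4 + length xs * d + j * d + k < ?b" using index_less[OF that] len R bf by linarith
        then show ?thesis using low1 s2(4) input_right[OF com that] by simp
      qed
      show "4 + length xs * d + length ys * d \<le> ?b" using len R bf by linarith
      show "length zs2 + length ys * ?D \<le> R" using lz len R by linarith
      show "length ys \<le> R" using ys(2) R by linarith
    next
      fix s3 t3
      assume s3: "\<forall>r. r \<notin> {rI, rJ, rSrc, rQ, rDst, rY} \<longrightarrow> fst s3 r = fst ((fst s2)(rI := 0), snd s2) r"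
        "\<forall>a<?b. snd s3 a = snd ((fst s2)(rI := 0), snd s2) a"
        "\<And>a. snd s3 (?b + a) = rep (zs2 @ concat (map (emb_right ?D) ys)) a"
        "t3 \<le> Suc (t2' + length ys * (8 * d + 40))"
      have r3: "fst s3 r = fst s r" if "r < 10 \<or> r = 11" for r
      proof -
        have "r \<notin> {rI, rJ, rSrc, rQ, rDst, rY}" "r \<notin> {rCnt, rDD}" using that by auto
        then show ?thesis using s3(1) s2(3) by (simp add: s1_def)
      qed
      have r3': "fst s3 rCnt = i" using s3(1) s2(3) by (simp add: s1_def)
      have low3: "snd s3 a = snd s a" if "a < ?b" for a using s3(2) s2(4) low1 that by simp
      have q: "zs2 @ concat (map (emb_right ?D) ys) = query i Al"
        using length_chosen[of Al] com by (simp add: zs2 hdr_def query_def encode_def common_def)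
      define s4 where "s4 = ((\<lambda>r. if offset \<le> r \<and> r < m + offset then 0 else fst s3 r)(rClk := L), snd s3)"
      have low4: "snd s3 a = rep (encode n d xs ys) a" if "a < R" for a
        using com low3[of a] that bf by (simp add: common_def)
      have low4': "snd s3 (R + j) = of_bool (j \<notin> Al)" if "j < length xs" for j
        using com low3[of "R + j"] that bf xs(2) R by (simp add: common_def)
      have "ready i Al s4"
        unfolding ready_def common_def using com s3(3) low4 low4'
        by (simp add: s4_def r3 r3' q regs1 regs' common_def)
      moreover have "Suc (Suc (Suc (t3 + 2 * m + 10))) \<le> prepare_time"
      proof -
        have "length xs * (4 * d + 20) \<le> n * (4 * d + 20)" "length ys * (8 * d + 40) \<le> n * (8 * d + 40)"
          using xs(2) ys(2) by (auto intro: mult_le_mono1)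
        then show ?thesis using s3(4) s2(6) t1 t2' unfolding prepare_time_def by (simp add: algebra_simps)
      qed
      ultimately show "wp v [seqs [clear_regs m, Assign rClk (Reg rL)]] s3 t3
          (\<lambda>s' t. t \<le> prepare_time \<and> ready i Al s')"
        using L_less
        by (simp add: wp_simps, intro wp_clear_regs) (simp add: wp_simps r3 regs' s4_def, intro wp_Nil, simp)
    qed (use v_pos s2 regs regs' bf b dim_bounds(1)[of i] ys in \<open>simp_all add: s1_def\<close>)
    then show "wp v [seqs [Assign rI (Num 0), build_right, clear_regs m, Assign rClk (Reg rL)]] s2 t2
        (\<lambda>s' t. t \<le> prepare_time \<and> ready i Al s')"
      using v_pos by (simp add: wp_simps)
  qed (use v_pos regs regs' bf b dim_bounds(1)[of i] xs rep1 in \<open>simp_all add: s1_def hdr_def\<close>)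
  then show ?thesis using b iK v_pos one_less
    by (simp add: prepare_def wp_simps s1_def regs regs1 regs' D_eval)
qed


text \<open>\<open>g\<close> is the content of the query region after the simulated run. The
  reduction modulo \<open>2 ^ v\<close> is the one that every read of a memory cell
  performs.\<close>

definition certified :: "nat set \<Rightarrow> (nat \<Rightarrow> nat) \<Rightarrow> nat \<Rightarrow> bool" where
  "certified Al g j \<longleftrightarrow> j \<in> Al \<and>
     (let y = g (length (chosen Al j)) mod 2 ^ v in y < length ys \<and> dot (xs ! j) (ys ! y) = 0)"

text \<open>The bound \<open>i\<close> restricts the discards to indices already scanned, which
  makes this the loop invariant; \<open>i = length xs\<close> gives the final set.\<close>

definition survivors :: "nat set \<Rightarrow> (nat \<Rightarrow> nat) \<Rightarrow> nat \<Rightarrow> nat set" where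
  "survivors Al g i = {j \<in> Al. j < i \<longrightarrow> \<not> certified Al g j}"

lemma survivors_Suc:
  "survivors Al g (Suc i) = (if certified Al g i then survivors Al g i - {i} else survivors Al g i)"
  by (auto simp: survivors_def less_Suc_eq)

text \<open>The flag of \<open>i\<close> is tested before it can change, so the scan still sees the
  set \<open>Al\<close> from which the query was built and stays aligned with the answer.\<close>

lemma mem_survivors: "i \<in> survivors Al g i \<longleftrightarrow> i \<in> Al"
  by (simp add: survivors_def)

lemma wp_collect_loop:
  assumes com: "common Al s" and i: "i0 < K * d" and base: "fst s rQ = base (Suc i0)"
    and regs: "fst s rI = 0" "fst s rSrc = 4" "fst s rYB = 4 + length xs * d"
    and g: "\<And>a. g a = snd s (base (Suc i0) + a)"
    and cont: "\<And>s' t'. common (survivors Al g (length xs)) s' \<Longrightarrow>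
       (\<forall>r. r \<notin> {rI, rSrc, rQ, rAlv, rJ, rV, rYP, rS} \<longrightarrow> fst s' r = fst s r) \<Longrightarrow>
       (\<forall>a\<ge>base (Suc i0). snd s' a = snd s a) \<Longrightarrow>
       t' \<le> Suc (t + length xs * (4 * d + 40)) \<Longrightarrow> wp v ks s' t' Q"
  shows "wp v (collect_loop # ks) s t Q"
proof -
  let ?b = "base (Suc i0)"
  let ?A = "survivors Al g"
  define G where "G i s' t' \<longleftrightarrow> common (?A i) s' \<and> fst s' rI = i \<and> fst s' rSrc = 4 + i * d \<and>
      fst s' rQ = ?b + length (chosen Al i) \<and>
      (\<forall>r. r \<notin> {rI, rSrc, rQ, rAlv, rJ, rV, rYP, rS} \<longrightarrow> fst s' r = fst s r) \<and>
      (\<forall>a\<ge>?b. snd s' a = snd s a) \<and> t' \<le> t + i * (4 * d + 40)" for i s' t'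
  have bf: "?b + R < 2 ^ v" "2 * R \<le> ?b" using base_Suc_fits[OF i] base_ge by auto
  have len: "length xs * d \<le> n * d" "length ys * d \<le> n * d"
    using xs(2) ys(2) by (auto intro: mult_le_mono1)
  have sub: "Al \<subseteq> {..<length xs}" using com by (simp add: common_def)
  then have fin: "finite (?A i)" for i
    using finite_subset[of "?A i" "{..<length xs}"] by (auto simp: survivors_def)
  show ?thesis unfolding collect_loop_def
  proof (rule wp_While[where n = "length xs" and Inv = G])
    have "?A 0 = Al" by (simp add: survivors_def)
    then show "G 0 s t" using com regs base by (simp add: G_def)
  next
    fix i s' t'
    assume i: "i < length xs" and G: "G i s' t'"
    have com': "common (?A i) s'" using G by (simp add: G_def)
    have x_cube: "xs ! i \<in> cube d" using xs(1) i nth_mem by blast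
    have regs': "fst s' rI = i" "fst s' rSrc = 4 + i * d" "fst s' rQ = ?b + length (chosen Al i)"
      "fst s' rNA = length xs" "fst s' rNB = length ys" "fst s' rR = R" "fst s' rD = d"
      "fst s' rYB = 4 + length xs * d" "fst s' rAlv = card (?A i)"
      using G com' regs by (simp_all add: G_def common_def)
    have idx: "i * d + d \<le> length xs * d" using mult_le_mono1[of "Suc i" "length xs" d] i by simp
    have lc: "length (chosen Al i) \<le> i" by (rule length_chosen_le)
    have b: "R < 2 ^ v" "d < 2 ^ v" "length xs < 2 ^ v" "length ys < 2 ^ v" "i < 2 ^ v" "R + i < 2 ^ v"
      "?b + length (chosen Al i) < 2 ^ v" "?b + Suc (length (chosen Al i)) < 2 ^ v"
      "4 + i * d + d < 2 ^ v" "4 + i * d < 2 ^ v" "Suc i < 2 ^ v" "4 + length xs * d < 2 ^ v"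
      using bf R_bounds(1,3,5) xs(2) ys(2) i idx lc len by linarith+
    have mem': "snd s' (R + i) = of_bool (i \<notin> Al)" "snd s' (?b + a) = g a" for a
      using G com' i g by (simp_all add: G_def common_def mem_survivors)
    let ?tail = "seqs [Assign rSrc (Reg rSrc \<oplus> Reg rD), Assign rI (Reg rI \<oplus> Num 1)]"
    let ?kill = "If (Bin Equal (Reg rS) (Num 0))
      (Seq (Store (Reg rR \<oplus> Reg rI) (Num 1)) (Assign rAlv (Bin Sub (Reg rAlv) (Num 1)))) Skip"
    let ?body = "[If (Bin Equal (Mem (Reg rR \<oplus> Reg rI)) (Num 0))
        (seqs [Assign rV (Mem (Reg rQ)), Assign rQ (Reg rQ \<oplus> Num 1),
           If (Bin Less (Reg rV) (Reg rNB))
             (seqs [Assign rYP (Reg rYB \<oplus> Bin Mul (Reg rV) (Reg rD)), dot_test, ?kill])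
             Skip]) Skip,
      Assign rSrc (Reg rSrc \<oplus> Reg rD), Assign rI (Reg rI \<oplus> Num 1)]"
    let ?y = "g (length (chosen Al i)) mod 2 ^ v"
    have "wp v [seqs ?body] s' (Suc t') (G (Suc i))"
    proof (cases "i \<in> Al")
      case False
      then have "?A (Suc i) = ?A i" "chosen Al (Suc i) = chosen Al i"
        by (simp_all add: survivors_Suc certified_def chosen_Suc)
      with False show ?thesis using b v_pos one_less G com'
        by (simp add: wp_simps regs' mem', intro wp_Nil) (simp add: G_def common_def)
    next
      case True
      then have ch: "length (chosen Al (Suc i)) = Suc (length (chosen Al i))" by (simp add: chosen_Suc)
      show ?thesis
      proof (cases "?y < length ys")
        case False
        then have "?A (Suc i) = ?A i" by (simp add: survivors_Suc certified_def Let_def)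
        with False True show ?thesis using b v_pos one_less G com'
          by (simp add: wp_simps regs' mem', intro wp_Nil) (simp add: G_def common_def ch)
      next
        case y: True
        have yd: "?y * d + d \<le> length ys * d" using mult_le_mono1[of "Suc ?y" "length ys" d] y by simp
        have yb: "4 + length xs * d + ?y * d + d < 2 ^ v" "?y * d < 2 ^ v" "4 + length xs * d + ?y * d < 2 ^ v"
          using yd len R_bounds(1) b by linarith+
        have y_cube: "ys ! ?y \<in> cube d" using ys(1) y nth_mem by blast
        define s1 where "s1 = ((fst s')(rV := ?y, rQ := ?b + Suc (length (chosen Al i)), rYP := 4 + length xs * d + ?y * d), snd s')"
        have "wp v [dot_test, seqs [?kill], Skip, ?tail] s1 t1 (G (Suc i))" if t1: "t1 \<le> t' + 15" for t1
        proof (rule wp_dot_test[where d = d and src = "4 + i * d" and yp = "4 + length xs * d + ?y * d"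
              and a = "xs ! i" and b = "ys ! ?y"])
          show "snd s1 (4 + i * d + j) = xs ! i ! j" if "j < d" for j
            using input_left[OF com' i that] by (simp add: s1_def)
          show "snd s1 (4 + length xs * d + ?y * d + j) = ys ! ?y ! j" if "j < d" for j
            using input_right[OF com' y that] by (simp add: s1_def)
          let ?s2 = "((fst s1)(rJ := d, rS := of_bool (dot (xs ! i) (ys ! ?y) \<noteq> 0)), snd s1)"
          let ?t2 = "Suc (Suc (4 * d + Suc (Suc (Suc (Suc (Suc t1))))))"
          show "wp v [seqs [?kill], Skip, ?tail] ?s2 ?t2 (G (Suc i))"
          proof (cases "dot (xs ! i) (ys ! ?y) = 0")
            case False
            then have "?A (Suc i) = ?A i" by (simp add: survivors_Suc certified_def Let_def)
            with False show ?thesis using b v_pos one_less G com' t1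
              by (simp add: wp_simps regs' mem' s1_def, intro wp_Nil) (simp add: G_def common_def ch)
          next
            case dot0: True
            then have A: "?A (Suc i) = ?A i - {i}" using True y
              by (simp add: survivors_Suc certified_def Let_def)
            have "i \<in> ?A i" using True by (simp add: mem_survivors)
            then have cA: "card (?A i - {i}) = card (?A i) - 1" by simp
            have "ys ! ?y \<in> set ys" using y by simp
            \<comment> \<open>The certificate is a vector of the second list with inner product 0,
              so the discarded vector is not a hitting one and \<open>common\<close> is
              preserved.\<close>
            then have nh: "\<not> hits (xs ! i) (set ys)" using dot0 by (auto simp: hits_def)
            have "R + i < ?b" using bf i xs(2) R_bounds(3) by linarith
            moreover have "card (?A i) < 2 ^ v" using card_le[OF com'] b by linarith
            ultimately show ?thesis using dot0 b v_pos one_less G com' t1 nh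
              by (simp add: wp_simps regs' mem' s1_def, intro wp_Nil)
                (auto simp: G_def common_def ch A cA)
          qed
        qed (use regs' b yb v_pos x_cube y_cube in \<open>simp_all add: s1_def\<close>)
        then show ?thesis using b v_pos one_less True y yb
          by (simp add: wp_simps regs' mem' s1_def add.assoc)
      qed
    qed
    then show "eval_expr v s' (Bin Less (Reg rI) (Reg rNA)) \<noteq> 0 \<and>
       wp v [seqs ?body] s' (Suc t') (G (Suc i))"
      using b i v_pos by (simp add: regs')
  next
    fix s' t'
    assume G: "G (length xs) s' t'"
    then have "fst s' rI = length xs" "fst s' rNA = length xs" by (simp_all add: G_def common_def)
    moreover have "wp v ks s' (Suc t') Q" using G by (intro cont) (simp_all add: G_def)
    ultimately show "eval_expr v s' (Bin Less (Reg rI) (Reg rNA)) = 0 \<and> wp v ks s' (Suc t') Q"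
      by simp
  qed
qed

text \<open>Moving \<open>rBase\<close> one region further restores the invariant, because the cells
  from \<open>base i\<close> on are still zero.\<close>

lemma wp_collect:
  assumes com: "common Al s" and i: "i < K * d" and regs: "fst s rBase = base (Suc i)" "fst s rCnt = i"
    and zero: "\<forall>a\<ge>base i. snd s a = 0"
  shows "wp v [collect] s 0 (\<lambda>s' t. t \<le> collect_time \<and>
    inv i (survivors Al (\<lambda>a. snd s (base (Suc i) + a)) (length xs)) s')"
proof -
  let ?b = "base (Suc i)"
  have len: "length xs * d \<le> n * d" using xs(2) by (rule mult_le_mono1)
  have bf: "?b + R < 2 ^ v" using base_Suc_fits[OF i] by simp
  have b: "?b < 2 ^ v" "4 < (2::nat) ^ v" "length xs < 2 ^ v" "d < 2 ^ v" "length xs * d < 2 ^ v"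
    "4 + length xs * d < 2 ^ v" "R < 2 ^ v"
    using bf len R_bounds(1,3,5,7) xs(2) by linarith+
  have regs': "fst s rNA = length xs" "fst s rD = d" "fst s rR = R"
    using com by (auto simp: common_def)
  define s1 where "s1 = ((fst s)(rI := 0, rSrc := 4, rQ := ?b, rYB := 4 + length xs * d), snd s)"
  note regs1 = regs(1)[unfolded One_nat_def]
  have "wp v [collect_loop, seqs [Assign rBase (Reg rBase \<oplus> Reg rR)]] s1 t1
    (\<lambda>s' t. t \<le> collect_time \<and> inv i (survivors Al (\<lambda>a. snd s (?b + a)) (length xs)) s')"
    if t1: "t1 \<le> 20" for t1
  proof (rule wp_collect_loop[where Al = Al and g = "\<lambda>a. snd s (?b + a)"])
    show "common Al s1" using com by (simp add: s1_def common_def)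
    fix s2 t2
    assume s2: "common (survivors Al (\<lambda>a. snd s (?b + a)) (length xs)) s2"
      "\<forall>r. r \<notin> {rI, rSrc, rQ, rAlv, rJ, rV, rYP, rS} \<longrightarrow> fst s2 r = fst s1 r"
      "\<forall>a\<ge>?b. snd s2 a = snd s1 a" "t2 \<le> Suc (t1 + length xs * (4 * d + 40))"
    have r2: "fst s2 (Suc 0) = ?b" "fst s2 rCnt = i" using s2(2) regs1 regs(2) by (simp_all add: s1_def)
    have r2': "fst s2 rR = R" using s2(1) by (simp add: common_def)
    have "length xs * (4 * d + 40) \<le> n * (4 * d + 40)" using xs(2) by (rule mult_le_mono1)
    then have t: "Suc (Suc (Suc (Suc t2))) \<le> collect_time" using t1 s2(4) by (simp add: collect_time_def algebra_simps)
    have z: "\<forall>a\<ge>base i. snd s2 a = 0" using zero s2(3) base_Suc[OF i] by (simp add: s1_def)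
    show "wp v [seqs [Assign rBase (Reg rBase \<oplus> Reg rR)]] s2 t2
      (\<lambda>s' t. t \<le> collect_time \<and> inv i (survivors Al (\<lambda>a. snd s (?b + a)) (length xs)) s')"
      using b bf s2(1) t z base_Suc[OF i]
      by (simp add: wp_simps r2 r2', intro wp_Nil) (simp add: inv_def common_def r2)
  qed (use i in \<open>simp_all add: s1_def\<close>)
  then show ?thesis using b v_pos
    by (simp add: collect_def wp_simps s1_def regs1 regs')
qed

end

text \<open>Identifies the entry at position \<open>length (chosen Al j)\<close> of the full list as
  \<open>j\<close>.\<close>

lemma chosen_split:
  assumes "j \<in> Al" "j < N"
  shows "\<exists>l. chosen Al N = chosen Al j @ j # l"
proof -
  have "[0..<N] = [0..<j] @ j # [Suc j..<N]"
    using assms(2) upt_add_eq_append[of 0 j "N - j"] by (simp add: upt_conv_Cons)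
  then show ?thesis using assms(1) by (simp add: chosen_def)
qed

lemma safe_Seq: "safe w ok t (p # q # k, s) e \<Longrightarrow> safe w ok (Suc t) (Seq p q # k, s) e"
  by (rule safe_reach[of w 1 _ "(p # q # k, s)" ok t e]) (simp_all add: bind_return_pmf)

definition loop_body :: "nat \<Rightarrow> nat \<Rightarrow> cmd \<Rightarrow> cmd" where
  "loop_body K m P = Seq (prepare K m) (Seq (tr P) collect)"

section \<open>Halting and expected progress of a single query\<close>

context reduction
begin

abbreviation (input) chosen_all :: "nat set \<Rightarrow> nat list" where
  "chosen_all Al \<equiv> chosen Al (length xs)"

lemma set_chosen_all: "Al \<subseteq> {..<length xs} \<Longrightarrow> set (chosen_all Al) = Al"
  by (auto simp: chosen_def)

lemma survivors_subset: "survivors Al g i \<subseteq> Al"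
  by (auto simp: survivors_def)

lemma length_query: "Al \<subseteq> {..<length xs} \<Longrightarrow> length (query i Al) \<le> R"
proof -
  assume Al: "Al \<subseteq> {..<length xs}"
  have x: "\<forall>x\<in>set (map (\<lambda>j. emb_left (dim i) (xs ! j)) (chosen_all Al)). length x = dim i"
    using xs(1) nth_mem[of _ xs] dim_bounds(1)[of i]
    by (force simp: chosen_def emb_left_def cube_def subset_iff)
  have y: "\<forall>y\<in>set (map (emb_right (dim i)) ys). length y = dim i"
    using ys(1) dim_bounds(1)[of i] by (force simp: emb_right_def cube_def subset_iff)
  have "length (query i Al) = 4 + length (chosen_all Al) * dim i + length ys * dim i"
    using length_concat_eq[OF x] length_concat_eq[OF y] by (simp add: query_def encode_def)
  moreover have "length (chosen_all Al) * dim i \<le> n * dim i" "length ys * dim i \<le> n * dim i"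
    using length_chosen_le[of Al "length xs"] xs(2) ys(2) by (auto intro!: mult_le_mono1)
  ultimately show ?thesis using R_bounds(2)[of i] by linarith
qed

lemma ready_simulation: "i < K * d \<Longrightarrow> simulation w v (base (Suc i)) R"
  using w_less_v pow_le_R base_fits by unfold_locales auto

text \<open>The frame is all that is known about the simulated run: input, flags and the solver's
  own registers other than the clock survive, and cells behind the region keep their zeros, since
  the query is no longer than \<open>R\<close>.\<close>

lemma safe_collect:
  assumes r: "ready i Al s" and i: "i < K * d"
    and fr: "simulation.frame (base (Suc i)) R s s2"
    and cont: "\<And>s'. inv i (survivors Al (\<lambda>a. snd s2 (base (Suc i) + a)) (length xs)) s' \<Longrightarrow>
      safe v ok t (k, s') e"
  shows "safe v ok (collect_time + t) (collect # k, s2) e"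
proof -
  interpret simulation w v "base (Suc i)" R m using ready_simulation[OF i] .
  have com: "common Al s" using r by (simp add: ready_def)
  have regs: "fst s2 r = fst s r" if "r < 30" "r \<noteq> 2" for r using fr that by (simp add: frame_def)
  have low: "snd s2 a = snd s a" if "a < base (Suc i)" for a using fr that by (simp add: frame_def)
  have "common Al s2"
    using com base_ge[of "Suc i"] xs(2) R_bounds(3) unfolding common_def
    by (simp add: regs low)
  moreover have "snd s2 a = 0" if a: "base i \<le> a" for a
  proof -
    obtain x where x: "a = base (Suc i) + (R + x)"
      using a base_Suc[OF i] by (metis add.assoc le_Suc_ex)
    then have "snd s2 a = snd s a" using fr by (simp add: frame_def)
    also have "\<dots> = rep (query i Al) (R + x)" using r x by (simp add: ready_def)
    also have "\<dots> = 0" using length_query[of Al i] com by (simp add: rep_def common_def)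
    finally show ?thesis .
  qed
  ultimately have "wp v [collect] s2 0 (\<lambda>s' t. t \<le> collect_time \<and>
    inv i (survivors Al (\<lambda>a. snd s2 (base (Suc i) + a)) (length xs)) s')"
    using i r by (intro wp_collect) (auto simp: ready_def regs)
  then have "wp v [collect] s2 0 (\<lambda>s' u. u \<le> collect_time \<and> safe v ok t (k, s') e)"
    by (rule wp_mono) (auto intro: cont)
  from safe_if_wp[OF this order_refl] show ?thesis by simp
qed

text \<open>\<open>(msize P + 3) * (L + 1)\<close> covers both estimates for the simulated run:
  \<open>msize P * (L + 1)\<close> for an arbitrary one, stopped by the clock, and
  \<open>3 * T\<close> with \<open>T \<le> L\<close> for a correct one.\<close>

definition iteration_time :: "cmd \<Rightarrow> nat" where
  "iteration_time P = prepare_time + collect_time + (msize P + 3) * (L + 1) + 10"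

lemma safe_loop_body:
  assumes inv: "inv (Suc i) Al s" and i: "i < K * d"
    and cont: "\<And>s1. ready i Al s1 \<Longrightarrow> safe v ok (t + collect_time + (msize P + 3) * (L + 1)) (tr P # collect # k, s1) e"
  shows "safe v ok (iteration_time P + t) (loop_body K m P # k, s) e"
proof -
  have "wp v [prepare K m] s 0 (\<lambda>s' u. u \<le> prepare_time \<and>
      safe v ok (Suc (t + collect_time + (msize P + 3) * (L + 1))) (Seq (tr P) collect # k, s') e)"
    using wp_prepare[OF inv i] by (rule wp_mono) (use safe_Seq cont in blast)
  from safe_Seq[OF safe_if_wp[OF this order_refl, simplified]] show ?thesis
    unfolding loop_body_def iteration_time_def by (rule safe_mono) auto
qed

text \<open>The case of a wrong guess: the clock alone guarantees halting, and all that is claimed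
  about the candidates is that none reappears.\<close>

lemma safe_iteration:
  assumes inv: "inv (Suc i) Al s" and i: "i < K * d"
    and cont: "\<And>Al' s'. Al' \<subseteq> Al \<Longrightarrow> inv i Al' s' \<Longrightarrow> safe v ok t (k, s') e"
  shows "safe v ok (iteration_time P + t) (loop_body K m P # k, s) e"
proof (rule safe_loop_body[OF inv i])
  fix s1 assume r: "ready i Al s1"
  interpret simulation w v "base (Suc i)" R m using ready_simulation[OF i] .
  have "env s1" using r L_less by (simp add: env_def ready_def common_def)
  moreover have "safe v ok (collect_time + t) (collect # k, s2) e" if "frame s1 s2" for s2
    using cont survivors_subset by (intro safe_collect[OF r i that]) blast
  ultimately have "safe v ok (sum_list (map msize [P]) + fst s1 rClk * msize P + (collect_time + t))
      (map tr [P] @ collect # k, s1) e"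
    by (intro safe_tr) auto
  moreover have "sum_list (map msize [P]) + fst s1 rClk * msize P + (collect_time + t)
      \<le> t + collect_time + (msize P + 3) * (L + 1)"
    using r by (simp add: ready_def algebra_simps)
  ultimately have "safe v ok (t + collect_time + (msize P + 3) * (L + 1)) (map tr [P] @ collect # k, s1) e"
    using order_refl by (rule safe_mono)
  then show "safe v ok (t + collect_time + (msize P + 3) * (L + 1)) (tr P # collect # k, s1) e"
    by simp
qed

text \<open>The reported mapping is pulled back along the embeddings to a choice \<open>f\<close> of
  partners. A candidate with an orthogonal partner is certified and discarded, so the survivors
  inject into the nonorthogonal candidates counted by \<open>card_nonorthogonal\<close>.\<close>

lemma card_survivors:
  assumes Al: "Al \<subseteq> {..<length xs}" and dist: "distinct xs" and no_hit: "\<forall>a\<in>set xs. \<not> hits a (set ys)"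
    and eps: "\<epsilon> * real d \<le> 1/2" "0 < \<epsilon>"
    and g: "\<forall>a\<in>set qa. g a \<in> set qb" "\<forall>p<length qa. mem p < length qb \<and> g (qa ! p) = qb ! mem p"
      "(\<Sum>a\<in>set qa. l1_dist a (g a)) \<le> (1 + \<epsilon>) * chamfer (set qa) (set qb)"
    and qa: "qa = map (\<lambda>j. emb_left (dim i) (xs ! j)) (chosen_all Al)"
    and qb: "qb = map (emb_right (dim i)) ys"
    and h: "\<And>a. a < R \<Longrightarrow> h a = mem a"
  shows "4 * card (survivors Al h (length xs)) \<le> card Al"
proof -
  let ?D = "dim i"
  define A where "A = (\<lambda>j. xs ! j) ` Al"
  define f where "f a = inv_into (set ys) (emb_right ?D) (g (emb_left ?D a))" for a
  have AX: "A \<subseteq> set xs" using Al by (auto simp: A_def)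
  have fin: "finite Al" using Al finite_subset by blast
  have inj: "inj_on (\<lambda>j. xs ! j) Al"
    using dist Al by (meson inj_on_nth inj_on_def lessThan_iff nth_eq_iff_index_eq subsetD)
  have sqa: "set qa = emb_left ?D ` A"
    unfolding qa A_def using set_chosen_all[OF Al] by (auto simp: image_image)
  have sqb: "set qb = emb_right ?D ` set ys" by (simp add: qb)
  have ginv: "emb_right ?D (f a) = g (emb_left ?D a)" "f a \<in> set ys" if "a \<in> A" for a
  proof -
    have "g (emb_left ?D a) \<in> emb_right ?D ` set ys" using g(1) that by (simp add: sqa sqb)
    then show "emb_right ?D (f a) = g (emb_left ?D a)" "f a \<in> set ys"
      unfolding f_def by (auto intro: f_inv_into_f inv_into_into)
  qed
  have "4 * card {a\<in>A. dot a (f a) \<noteq> 0} \<le> card A"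
  proof (rule card_nonorthogonal[where d = d and D = ?D and B = "set ys" and \<epsilon> = \<epsilon>])
    show "\<forall>a\<in>A. \<exists>b\<in>set ys. dot a b = 0" using no_hit AX by (auto simp: hits_def)
    have "(\<Sum>a\<in>A. l1_dist (emb_left ?D a) (emb_right ?D (f a))) = (\<Sum>a\<in>set qa. l1_dist a (g a))"
      unfolding sqa using inj_on_subset[OF inj_emb_left[of ?D d], of A] AX xs(1) ginv(1)
      by (subst sum.reindex) auto
    then show "(\<Sum>a\<in>A. l1_dist (emb_left ?D a) (emb_right ?D (f a)))
      \<le> (1 + \<epsilon>) * chamfer (emb_left ?D ` A) (emb_right ?D ` set ys)"
      using g(3) by (simp add: sqa sqb)
  qed (use fin AX xs(1) ys(1) dim_bounds eps ginv(2) in \<open>auto simp: A_def\<close>)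
  moreover have "(\<lambda>j. xs ! j) ` survivors Al h (length xs) \<subseteq> {a\<in>A. dot a (f a) \<noteq> 0}"
  proof (rule image_subsetI)
    fix j assume j: "j \<in> survivors Al h (length xs)"
    then have jA: "j \<in> Al" "j < length xs" using Al by (auto simp: survivors_def)
    then have "xs ! j \<in> A" by (auto simp: A_def)
    let ?p = "length (chosen Al j)"
    obtain l where l: "chosen_all Al = chosen Al j @ j # l" using chosen_split[OF jA] by blast
    have p: "?p < length qa" "qa ! ?p = emb_left ?D (xs ! j)" by (simp_all add: qa l nth_append)
    have m: "mem ?p < length ys" "g (emb_left ?D (xs ! j)) = emb_right ?D (ys ! mem ?p)"
      using g(2) p by (auto simp: qb)
    have fj: "f (xs ! j) = ys ! mem ?p"
      unfolding f_def m(2) using m(1) inj_on_subset[OF inj_emb_right[of ?D d] ys(1)] by (intro inv_into_f_f) auto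
    have pR: "?p < R" using length_chosen_le[of Al j] jA(2) xs(2) R_bounds(3) by linarith
    have "length ys < 2 ^ v" using ys(2) R_bounds(3) base_fits[of 0] by linarith
    then have "h ?p mod 2 ^ v = mem ?p" using h[OF pR] m(1) by simp
    then have "dot (xs ! j) (f (xs ! j)) \<noteq> 0"
      using j jA m(1) fj by (simp add: survivors_def certified_def Let_def)
    with \<open>xs ! j \<in> A\<close> show "xs ! j \<in> {a\<in>A. dot a (f a) \<noteq> 0}" by simp
  qed
  then have "card (survivors Al h (length xs)) \<le> card {a\<in>A. dot a (f a) \<noteq> 0}"
    using fin inj_on_subset[OF inj survivors_subset] A_def by (intro card_inj_on_le) auto
  ultimately show ?thesis using card_image[OF inj] by (simp add: A_def)
qed

text \<open>With probability at least 2/3 at most a quarter of the candidates survive, otherwise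
  possibly all of them, so the expected fraction is at most \<open>1/4 + 3/4 * 1/3 = 1/2\<close>. A
  bound linear in the number of candidates is therefore halved.\<close>

lemma safe_good_iteration:
  assumes inv: "inv (Suc i) Al s" and i: "i < K * d"
    and alg: "approximates_chamfer w P n (dim i) \<epsilon> T" and T: "T \<le> L" and P: "regs_below m P"
    and eps: "\<epsilon> * real d \<le> 1/2" "0 < \<epsilon>"
    and dist: "distinct xs" "distinct ys"
    and no_hit: "\<forall>a\<in>set xs. \<not> hits a (set ys)" and nonempty: "ys \<noteq> []" and c: "0 \<le> (c::real)"
    and cont: "\<And>Al' s'. Al' \<subseteq> Al \<Longrightarrow> inv i Al' s' \<Longrightarrow> safe v ok t (k, s') (ennreal (c * card Al'))"
  shows "safe v ok (iteration_time P + t) (loop_body K m P # k, s) (ennreal (c * card Al / 2))"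
proof (rule safe_loop_body[OF inv i])
  fix s1 assume r: "ready i Al s1"
  interpret simulation w v "base (Suc i)" R m using ready_simulation[OF i] .
  let ?D = "dim i"
  have Al: "Al \<subseteq> {..<length xs}" using r by (simp add: ready_def common_def)
  have fin: "finite Al" using Al finite_subset by blast
  define qa where "qa = map (\<lambda>j. emb_left ?D (xs ! j)) (chosen_all Al)"
  define qb where "qb = map (emb_right ?D) ys"
  define okay where "okay mem \<longleftrightarrow> (\<exists>g. (\<forall>a\<in>set qa. g a \<in> set qb) \<and>
     (\<forall>p<length qa. mem p < length qb \<and> g (qa ! p) = qb ! mem p) \<and>
     (\<Sum>a\<in>set qa. l1_dist a (g a)) \<le> (1 + \<epsilon>) * chamfer (set qa) (set qb))" for mem :: "nat \<Rightarrow> nat"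
  define M where "M = run w T (init_config P (encode n ?D qa qb))"
  have x_cube: "xs ! j \<in> cube d" if "j < length xs" for j using xs(1) that nth_mem by blast
  have "lists_set qa (set qa) n ?D"
  proof -
    have "distinct qa" unfolding qa_def distinct_map
    proof (intro conjI inj_onI)
      show "distinct (chosen_all Al)" by (simp add: chosen_def)
      fix j j' assume jj: "j \<in> set (chosen_all Al)" "j' \<in> set (chosen_all Al)"
        "emb_left ?D (xs ! j) = emb_left ?D (xs ! j')"
      then have lt: "j < length xs" "j' < length xs" by (auto simp: chosen_def)
      then have "xs ! j = xs ! j'" using inj_onD[OF inj_emb_left jj(3)] x_cube by blast
      then show "j = j'" using dist(1) lt nth_eq_iff_index_eq by blast
    qed
    moreover have "length qa \<le> n"
      using length_chosen_le[of Al "length xs"] xs(2) by (simp add: qa_def)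
    moreover have "set qa \<subseteq> cube ?D"
      using x_cube dim_bounds(1) by (auto simp: qa_def chosen_def intro!: emb_left_cube)
    ultimately show ?thesis unfolding lists_set_def using distinct_card[of qa] by auto
  qed
  moreover have "lists_set qb (set qb) n ?D"
  proof -
    have "distinct qb" unfolding qb_def distinct_map
      using dist(2) inj_on_subset[OF inj_emb_right ys(1)] by simp
    moreover have "set qb \<subseteq> cube ?D"
      using ys(1) dim_bounds(1) by (auto simp: qb_def intro!: emb_right_cube)
    moreover have "length qb \<le> n" using ys(2) by (simp add: qb_def)
    ultimately show ?thesis unfolding lists_set_def using distinct_card[of qb] by auto
  qed
  moreover have "set qb \<noteq> {}" using nonempty by (simp add: qb_def)
  ultimately have comp: "computes w P (encode n ?D qa qb) T okay"
    using alg unfolding approximates_chamfer_def okay_def[abs_def] by blast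
  have halt: "\<forall>(k, u)\<in>set_pmf M. k = []" using comp by (simp add: computes_def M_def)
  define bad where "bad = {c :: config. \<not> okay (snd (snd c))}"
  have bad: "emeasure (measure_pmf M) bad \<le> ennreal (1/3)"
  proof -
    have eq: "{(k, s). okay (snd s)} = UNIV - bad" by (auto simp: bad_def)
    have "measure_pmf.prob M (UNIV - bad) \<ge> 2/3" using comp eq by (simp add: computes_def M_def)
    then have "measure_pmf.prob M bad \<le> 1/3" using measure_pmf.prob_compl[of bad M] by simp
    then show ?thesis by (simp add: measure_pmf.emeasure_eq_measure ennreal_leI)
  qed
  define x where "x = c * card Al"
  define q where "q u = (if okay (snd u) then ennreal (x / 4) else ennreal x)" for u :: state
  have x0: "0 \<le> x" using c by (simp add: x_def)
  have int: "(\<integral>\<^sup>+ c. q (snd c) \<partial>measure_pmf M) \<le> ennreal (x / 2)"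
  proof -
    \<comment> \<open>The two values of \<open>q\<close> are written as a constant plus a multiple
      of the indicator of failure, so only the probability of failure enters.\<close>
    have "(\<integral>\<^sup>+ c. q (snd c) \<partial>measure_pmf M)
        = (\<integral>\<^sup>+ c. ennreal (x / 4) + ennreal (3/4 * x) * indicator bad c \<partial>measure_pmf M)"
      using x0 by (intro nn_integral_cong)
        (auto simp: q_def bad_def indicator_def ennreal_plus[symmetric] simp del: ennreal_plus)
    also have "\<dots> = ennreal (x / 4) + ennreal (3/4 * x) * emeasure (measure_pmf M) bad"
      by (subst nn_integral_add) (auto simp: nn_integral_cmult_indicator measure_pmf.emeasure_space_1)
    also have "\<dots> \<le> ennreal (x / 4) + ennreal (3/4 * x) * ennreal (1/3)"
      using bad by (intro add_left_mono mult_left_mono) auto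
    also have "\<dots> = ennreal (x / 2)"
      using x0 by (simp add: ennreal_mult[symmetric] ennreal_plus[symmetric] del: ennreal_plus)
    finally show ?thesis .
  qed
  have conf: "init_config P (encode n ?D qa qb) = ([P], (\<lambda>_. 0), rep (query i Al))"
    by (auto simp: init_config_def rep_def query_def qa_def qb_def)
  have "safe v ok (3 * T + (collect_time + t)) (map tr [P] @ collect # k, s1)
      (\<integral>\<^sup>+ c. q (snd c) \<partial>measure_pmf (run w T ([P], (\<lambda>_. 0), rep (query i Al))))"
  proof (rule safe_tr_sim)
    show "\<forall>(k, u)\<in>set_pmf (run w T ([P], \<lambda>_. 0, rep (query i Al))). k = []"
      using halt by (simp add: M_def conf)
    show "sim (\<lambda>_. 0, rep (query i Al)) s1" using r by (simp add: sim_def ready_def)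
    show "env s1" using r L_less by (simp add: env_def ready_def common_def)
    show "T \<le> fst s1 rClk" using r T by (simp add: ready_def)
    fix u s2
    assume "sim u s2" and fr: "frame s1 s2"
    then have mem: "snd s2 (base (Suc i) + a) = snd u a" if "a < R" for a
      using that by (simp add: sim_def)
    let ?S = "survivors Al (\<lambda>a. snd s2 (base (Suc i) + a)) (length xs)"
    show "safe v ok (collect_time + t) (collect # k, s2) (q u)"
    proof (rule safe_collect[OF r i fr])
      fix s' assume inv': "inv i ?S s'"
      have "c * card ?S \<le> (if okay (snd u) then x / 4 else x)"
      proof (cases "okay (snd u)")
        case True
        then obtain g where "\<forall>a\<in>set qa. g a \<in> set qb"
          "\<forall>p<length qa. snd u p < length qb \<and> g (qa ! p) = qb ! snd u p"
          "(\<Sum>a\<in>set qa. l1_dist a (g a)) \<le> (1 + \<epsilon>) * chamfer (set qa) (set qb)"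
          unfolding okay_def by blast
        from card_survivors[OF Al dist(1) no_hit eps this qa_def qb_def mem]
        have "real (card ?S) \<le> card Al / 4" by simp
        then have "c * card ?S \<le> c * (card Al / 4)" using c by (intro mult_left_mono) auto
        then show ?thesis using True by (simp add: x_def)
      next
        case False
        have "card ?S \<le> card Al" using fin survivors_subset by (rule card_mono)
        then show ?thesis using False c by (simp add: x_def mult_left_mono)
      qed
      then have "ennreal (c * card ?S) \<le> q u" unfolding q_def by (auto intro: ennreal_leI)
      with cont[OF survivors_subset inv'] show "safe v ok t (k, s') (q u)"
        by (rule safe_mono[OF _ order_refl])
    qed
  qed (use P in auto)
  then have "safe v ok (3 * T + (collect_time + t)) (tr P # collect # k, s1)
      (\<integral>\<^sup>+ c. q (snd c) \<partial>measure_pmf M)"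
    by (simp add: M_def conf)
  then show "safe v ok (t + collect_time + (msize P + 3) * (L + 1)) (tr P # collect # k, s1)
      (ennreal (c * card Al / 2))"
  proof (rule safe_mono)
    have "3 * T \<le> (msize P + 3) * (L + 1)" using T by (intro mult_le_mono) auto
    then show "3 * T + (collect_time + t) \<le> t + collect_time + (msize P + 3) * (L + 1)" by simp
    show "(\<integral>\<^sup>+ c. q (snd c) \<partial>measure_pmf M) \<le> ennreal (c * card Al / 2)"
      using int by (simp add: x_def)
  qed
qed

end

section \<open>The Hitting Set program\<close>

definition main_loop :: "nat \<Rightarrow> nat \<Rightarrow> cmd \<Rightarrow> cmd" where
  "main_loop K m P = While (Reg rCnt) (loop_body K m P)"

context reduction
begin

definition hit :: bool where
  "hit \<longleftrightarrow> (\<exists>a\<in>set xs. hits a (set ys))"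

text \<open>The remaining queries that guess the dimension correctly.\<close>

definition good :: "nat \<Rightarrow> nat \<Rightarrow> nat set" where
  "good \<rho> i = {j. j < i \<and> j mod K = \<rho>}"

text \<open>The expected number of survivors after the remaining \<open>i\<close> queries bounds the error probability.\<close>

definition potential :: "nat \<Rightarrow> nat \<Rightarrow> nat set \<Rightarrow> real" where
  "potential \<rho> i Al = (if hit then 0 else (1/2) ^ card (good \<rho> i) * card Al)"

lemma good_Suc: "good \<rho> (Suc i) = (if i mod K = \<rho> then insert i (good \<rho> i) else good \<rho> i)"
  by (auto simp: good_def less_Suc_eq)

lemma finite_good [simp]: "finite (good \<rho> i)"
  by (simp add: good_def)

lemma card_good: "\<rho> < K \<Longrightarrow> card (good \<rho> (K * e)) = e"
proof -
  assume \<rho>: "\<rho> < K"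
  have "good \<rho> (K * e) = (\<lambda>i. i * K + \<rho>) ` {..<e}"
  proof (intro set_eqI iffI)
    fix j assume "j \<in> good \<rho> (K * e)"
    then have j: "j < K * e" "j mod K = \<rho>" by (auto simp: good_def)
    have "j = (j div K) * K + \<rho>" using j(2) div_mult_mod_eq[of j K] by simp
    moreover have "j div K < e" using j(1) \<rho> by (simp add: less_mult_imp_div_less mult.commute)
    ultimately show "j \<in> (\<lambda>i. i * K + \<rho>) ` {..<e}" by blast
  next
    fix j assume "j \<in> (\<lambda>i. i * K + \<rho>) ` {..<e}"
    then show "j \<in> good \<rho> (K * e)"
      using \<rho> index_less[of _ e \<rho> K] by (auto simp: good_def mult.commute)
  qed
  moreover have "inj_on (\<lambda>i. i * K + \<rho>) {..<e}" using K by (auto simp: inj_on_def)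
  ultimately show ?thesis by (simp add: card_image)
qed

text \<open>A good query halves the expected number of candidates and any other one does not
  increase it, which is exactly the change of the exponent in \<open>potential\<close>. If a hitting
  vector exists, it survives all queries and the error is 0.\<close>

lemma safe_main_loop:
  assumes alg: "approximates_chamfer w P n (K * d + \<rho>) \<epsilon> T" and T: "T \<le> L" and P: "regs_below m P"
    and eps: "\<epsilon> * real d \<le> 1/2" "0 < \<epsilon>"
    and dist: "distinct xs" "distinct ys"
    and "inv i Al s" "i \<le> K * d"
  shows "safe v (\<lambda>mem. mem 0 \<noteq> 0 \<longleftrightarrow> hit) (i * (iteration_time P + 1) + 2)
    ([main_loop K m P, Store (Num 0) (Reg rAlv)], s) (ennreal (potential \<rho> i Al))"
  using assms(8,9)
proof (induction i arbitrary: Al s)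
  case 0
  have c: "fst s rCnt = 0" "fst s rAlv = card Al" "common Al s"
    using 0 by (auto simp: inv_def common_def)
  then have Al: "Al \<subseteq> {..<length xs}" and hitters: "\<forall>j<length xs. hits (xs ! j) (set ys) \<longrightarrow> j \<in> Al"
    by (auto simp: common_def)
  have fin: "finite Al" using Al finite_subset by blast
  have ca: "card Al < 2 ^ v"
    using card_le[OF c(3)] xs(2) R_bounds(3) base_fits[of 0] by linarith
  let ?s = "(fst s, (snd s)(0 := card Al))"
  have "run v 2 ([main_loop K m P, Store (Num 0) (Reg rAlv)], s) = return_pmf ([], ?s)"
    using c ca by (simp add: main_loop_def numeral_2_eq_2 bind_return_pmf)
  moreover have "safe v (\<lambda>mem. mem 0 \<noteq> 0 \<longleftrightarrow> hit) 0 ([], ?s) (ennreal (potential \<rho> 0 Al))"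
  proof (rule safe_halted)
    have "card Al \<noteq> 0" if hit
    proof -
      obtain j where "j < length xs" "hits (xs ! j) (set ys)"
        using \<open>hit\<close> by (auto simp: hit_def in_set_conv_nth)
      then show ?thesis using hitters fin by auto
    qed
    \<comment> \<open>Markov's inequality in its simplest form: a wrong answer requires a survivor,
      and then the potential is at least 1.\<close>
    moreover have "1 \<le> ennreal (potential \<rho> 0 Al)" if "\<not> hit" "card Al \<noteq> 0"
      using that by (simp add: potential_def good_def ennreal_leI[of 1, simplified])
    ultimately show "(snd ?s 0 \<noteq> 0 \<longleftrightarrow> hit) \<or> 1 \<le> ennreal (potential \<rho> 0 Al)" by auto
  qed
  ultimately show ?case by (rule safe_reach) simp
next
  case (Suc i)
  let ?k = "[main_loop K m P, Store (Num 0) (Reg rAlv)]" and ?t = "i * (iteration_time P + 1) + 2"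
  let ?safe = "\<lambda>t c e. safe v (\<lambda>mem. mem 0 \<noteq> 0 \<longleftrightarrow> hit) t c (ennreal e)"
  have i: "i < K * d" using Suc.prems by simp
  have Al: "Al \<subseteq> {..<length xs}" using Suc.prems by (simp add: inv_def common_def)
  have fin: "finite Al" using Al finite_subset by blast
  have IH: "?safe ?t (?k, s') (potential \<rho> i Al')" if "inv i Al' s'" for Al' s'
    using Suc.IH[OF that] i by simp
  have body: "?safe (iteration_time P + ?t) (loop_body K m P # ?k, s) (potential \<rho> (Suc i) Al)"
  proof (cases "\<not> hit \<and> i mod K = \<rho> \<and> ys \<noteq> []")
    case True
    let ?c = "(1/2) ^ card (good \<rho> i) :: real"
    have "?safe (iteration_time P + ?t) (loop_body K m P # ?k, s) (?c * card Al / 2)"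
    proof (rule safe_good_iteration[OF Suc.prems(1) i])
      show "approximates_chamfer w P n (dim i) \<epsilon> T" using alg True by (simp add: dim_def)
      show "?safe ?t (?k, s') (?c * card Al')" if "Al' \<subseteq> Al" "inv i Al' s'" for Al' s'
        using IH[OF that(2)] True by (simp add: potential_def)
    qed (use T P eps dist True in \<open>auto simp: hit_def\<close>)
    moreover have "i \<notin> good \<rho> i" by (simp add: good_def)
    ultimately show ?thesis using True by (simp add: potential_def good_Suc)
  next
    case False
    have mono: "potential \<rho> i Al' \<le> potential \<rho> (Suc i) Al" if "Al' \<subseteq> Al" for Al'
    proof (cases hit)
      case nohit: False
      show ?thesis
      proof (cases "ys = []")
        case True
        \<comment> \<open>Every vector hits the empty set, so here the absence of a hit leaves no
          candidates at all; queries need a nonempty second set.\<close>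
        then have "xs = []" using nohit unfolding hit_def hits_def by (metis empty_iff ex_in_conv list.set(1) set_empty)
        then have e: "Al = {}" "Al' = {}" using Al that by auto
        show ?thesis unfolding potential_def e by simp
      next
        case nonempty: False
        then have "good \<rho> (Suc i) = good \<rho> i" using False nohit by (simp add: good_Suc)
        then show ?thesis using card_mono[OF fin that] by (simp add: potential_def)
      qed
    qed (simp add: potential_def)
    show ?thesis
    proof (rule safe_iteration[OF Suc.prems(1) i])
      fix Al' s' assume "Al' \<subseteq> Al" "inv i Al' s'"
      then show "?safe ?t (?k, s') (potential \<rho> (Suc i) Al)"
        by (intro safe_mono[OF IH order_refl ennreal_leI] mono)
    qed
  qed
  have "step v (?k, s) = return_pmf (loop_body K m P # ?k, s)"
  proof -
    have "Suc i < 2 ^ v" using i R_bounds(4) base_fits[of 0] by linarith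
    then show ?thesis using Suc.prems by (simp add: main_loop_def inv_def)
  qed
  then have "run v 1 (?k, s) = return_pmf (loop_body K m P # ?k, s)"
    by (simp add: bind_return_pmf)
  moreover have "1 + (iteration_time P + ?t) \<le> Suc i * (iteration_time P + 1) + 2" by simp
  ultimately show ?case by (rule safe_reach[OF _ body])
qed

text \<open>Each residue occurs \<open>d\<close> times below \<open>K * d\<close>, so without a hit
  the potential starts at \<open>length xs / 2 ^ d\<close>.\<close>

lemma initial_potential:
  assumes "\<rho> < K" "3 * n \<le> 2 ^ d"
  shows "potential \<rho> (K * d) {..<length xs} \<le> 1/3"
proof -
  have "3 * real (length xs) \<le> 2 ^ d"
  proof -
    have "3 * length xs \<le> 2 ^ d" using assms(2) xs(2) by linarith
    then have "real (3 * length xs) \<le> real (2 ^ d)" by (rule of_nat_mono)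
    then show ?thesis by simp
  qed
  then show ?thesis using assms(1) by (simp add: potential_def card_good power_one_over field_simps)
qed

end

section \<open>Parameters of the solver and its initialization\<close>

definition ell :: "nat \<Rightarrow> nat" where
  "ell n = nat \<lceil>log 2 (real n + 2)\<rceil>"

text \<open>A description without logarithms: \<open>ell n\<close> is the least exponent whose power
  of 2 reaches \<open>n + 2\<close>, which is what the loop in \<open>initialize\<close> searches
  for.\<close>

lemma ell_le_iff: "ell n \<le> k \<longleftrightarrow> n + 2 \<le> 2 ^ k"
proof -
  have "ell n \<le> k \<longleftrightarrow> log 2 (real n + 2) \<le> real k"
    unfolding ell_def by (simp add: nat_le_iff ceiling_le_iff)
  also have "\<dots> \<longleftrightarrow> real n + 2 \<le> 2 powr real k" by (rule log_le_iff) simp_all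
  also have "\<dots> \<longleftrightarrow> real n + 2 \<le> 2 ^ k" by (subst powr_realpow) simp_all
  also have "\<dots> \<longleftrightarrow> real (n + 2) \<le> real (2 ^ k)"
    by (simp only: of_nat_add of_nat_numeral of_nat_power)
  also have "\<dots> \<longleftrightarrow> n + 2 \<le> 2 ^ k" by (rule of_nat_le_iff)
  finally show ?thesis .
qed

lemma le_pow_ell: "n + 2 \<le> 2 ^ ell n"
  using ell_le_iff[of n "ell n"] by simp

lemma pow_less_ell: "i < ell n \<Longrightarrow> 2 ^ i < n + 2"
  using ell_le_iff[of n i] by simp

lemma ell_pos: "0 < ell n"
  using ell_le_iff[of n 0] by simp

lemma word_size_ell: "word_size c n = c * ell n"
  by (simp add: word_size_def ell_def)

text \<open>A region of \<open>2 ^ ((c + 3) * ell n)\<close> cells exceeds the \<open>2 ^ w\<close>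
  simulated addresses and has room for a query, whose length is at most cubic in
  \<open>2 ^ ell n\<close>. The clock is a power of 2 of order \<open>n powr (2 - 1/q)\<close>,
  obtained by shifting instead of taking roots.\<close>

definition initialize :: "nat \<Rightarrow> nat \<Rightarrow> nat \<Rightarrow> cmd list" where
  "initialize c K q =
     [Assign rEll (Num 0),
      While (Bin Less (Bin Shl (Num 1) (Reg rEll)) (Reg rN \<oplus> Num 2)) (Assign rEll (Reg rEll \<oplus> Num 1)),
      Assign rW (Bin Shl (Num 1) (Bin Mul (Num c) (Reg rEll))),
      Assign rR (Bin Shl (Num 1) (Bin Mul (Num (c + 3)) (Reg rEll))),
      Assign rL (Bin Shl (Num 1) (Bin Sub (Bin Mul (Num 2) (Reg rEll)) (Bin Div (Reg rEll) (Num q)))),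
      Assign rCnt (Bin Mul (Num K) (Reg rD)), Assign rAlv (Reg rNA),
      Assign rBase (Reg rR \<oplus> Reg rR)]"

definition read_input :: "cmd list" where
  "read_input = [Assign rN (Mem (Num 0)), Assign rD (Mem (Num 1)),
     Assign rNA (Mem (Num 2)), Assign rNB (Mem (Num 3))]"

text \<open>In dimension 0 the only vector is empty and all inner products are 0, so a hit exists
  iff the first set is nonempty and the second one empty. This case makes the program correct at
  sizes too small for the main loop.\<close>

definition solver :: "nat \<Rightarrow> nat \<Rightarrow> nat \<Rightarrow> nat \<Rightarrow> cmd \<Rightarrow> cmd" where
  "solver c K q m P = Seq (seqs read_input) (If (Bin Equal (Reg rD) (Num 0))
     (Store (Num 0) (Bin And (Bin Equal (Reg rNB) (Num 0)) (Bin Less (Num 0) (Reg rNA))))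
     (Seq (seqs (initialize c K q)) (Seq (main_loop K m P) (Store (Num 0) (Reg rAlv)))))"

lemma wp_initialize:
  assumes v: "v = (c + 6) * ell n"
    and regs: "fst s rN = n" "fst s rD = d" "fst s rNA = a" and bounds: "K * d \<le> n" "K \<le> n + 2" "d \<le> n" "a \<le> n" "q \<le> n + 2"
    and q: "0 < q"
  defines "l \<equiv> ell n"
  shows "wp v [seqs (initialize c K q)] s 0 (\<lambda>s' t. t \<le> 2 * l + 40 \<and> s' =
    ((fst s)(rEll := l, rW := 2 ^ (c * l), rR := 2 ^ ((c + 3) * l), rL := 2 ^ (2 * l - l div q),
       rCnt := K * d, rAlv := a, rBase := 2 * 2 ^ ((c + 3) * l)), snd s))"
proof -
  have l: "0 < l" "n + 2 \<le> 2 ^ l" unfolding l_def using ell_pos le_pow_ell by auto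
  have pow: "2 ^ (k * l) < (2::nat) ^ v" if "k < c + 6" for k
    using that l(1) by (intro power_strict_increasing) (auto simp: v l_def)
  have v_pos: "0 < v" using l by (simp add: v l_def)
  have pl: "(2::nat) ^ l < 2 ^ v" using pow[of 1] by simp
  then have nv: "n + 2 < 2 ^ v" using l(2) by linarith
  have cl: "(c + 3) * l < 2 ^ v"
    using less_exp[of "(c + 3) * l"] pow[of "c + 3"] by linarith
  have c1: "c + 3 \<le> (c + 3) * l" using l(1) by simp
  have cl': "c * l \<le> (c + 3) * l" by simp
  have two: "2 * l \<le> (c + 3) * l" by simp
  have b: "c < 2 ^ v" "c + 3 < 2 ^ v" "c * l < 2 ^ v" "l < 2 ^ v" "2 * l < 2 ^ v" "q < 2 ^ v"
    "K < 2 ^ v" "d < 2 ^ v" "a < 2 ^ v" "K * d < 2 ^ v" "n < 2 ^ v" "(2::nat) < 2 ^ v" "Suc 0 < 2 ^ v"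
    using cl c1 cl' two nv bounds l by linarith+
  have Lp: "2 ^ (2 * l - l div q) < (2::nat) ^ v"
  proof -
    have "2 ^ (2 * l - l div q) \<le> (2::nat) ^ (2 * l)" by (intro power_increasing) auto
    then show ?thesis using pow[of 2] by simp
  qed
  have dl: "2 * l - l div q < 2 ^ v" "l div q < 2 ^ v"
    using b(4,5) div_le_dividend[of l q] by linarith+
  have RR: "2 * 2 ^ ((c + 3) * l) < (2::nat) ^ v"
  proof -
    have "2 ^ Suc ((c + 3) * l) < (2::nat) ^ v"
      using l(1) by (intro power_strict_increasing) (auto simp: v l_def algebra_simps)
    then show ?thesis by simp
  qed
  define B :: nat where "B = 2 ^ v"
  define W :: nat where "W = 2 ^ (c * l)"
  define R :: nat where "R = 2 ^ ((c + 3) * l)"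
  define L :: nat where "L = 2 ^ (2 * l - l div q)"
  note bB = b[folded B_def] dl[folded B_def] cl[folded B_def] nv[folded B_def]
    pow[of c, folded B_def W_def] pow[of "c + 3", folded B_def R_def] Lp[folded B_def L_def]
    RR[folded B_def R_def] pl[folded B_def]
  have WB: "W < B" "R < B" using bB(18,19) by auto
  define S where "S i = ((fst s)(rEll := i), snd s)" for i
  let ?rest = "[Assign rW (Bin Shl (Num 1) (Bin Mul (Num c) (Reg rEll))),
      Assign rR (Bin Shl (Num 1) (Bin Mul (Num (c + 3)) (Reg rEll))),
      Assign rL (Bin Shl (Num 1) (Bin Sub (Bin Mul (Num 2) (Reg rEll)) (Bin Div (Reg rEll) (Num q)))),
      Assign rCnt (Bin Mul (Num K) (Reg rD)), Assign rAlv (Reg rNA),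
      Assign rBase (Reg rR \<oplus> Reg rR)]"
  let ?Q = "\<lambda>s' t. t \<le> 2 * l + 40 \<and> s' =
    ((fst s)(rEll := l, rW := W, rR := R, rL := L, rCnt := K * d, rAlv := a, rBase := 2 * R), snd s)"
  have eW: "fst u rEll = l \<Longrightarrow> eval_expr v u (Bin Shl (Num (Suc 0)) (Bin Mul (Num c) (Reg rEll))) = W" for u
    using bB(1,3,4,13) WB by (simp add: push_bit_eq_mult B_def[symmetric] W_def[symmetric])
  have eR: "fst u rEll = l \<Longrightarrow> eval_expr v u (Bin Shl (Num (Suc 0)) (Bin Mul (Num (c + 3)) (Reg rEll))) = R" for u
    using bB(2,4,13,16) WB by (simp add: push_bit_eq_mult B_def[symmetric] R_def[symmetric])
  have eL: "fst u rEll = l \<Longrightarrow> eval_expr v u (Bin Shl (Num (Suc 0)) (Bin Sub (Bin Mul (Num 2) (Reg rEll)) (Bin Div (Reg rEll) (Num q)))) = L" for u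
    using bB(4,5,6,12,13,14,15,20) by (simp add: push_bit_eq_mult B_def[symmetric] L_def[symmetric])
  have eC: "fst u rD = d \<Longrightarrow> eval_expr v u (Bin Mul (Num K) (Reg rD)) = K * d"
    "fst u rNA = a \<Longrightarrow> eval_expr v u (Reg rNA) = a" for u
    using bB(7,8,9,10) by (simp_all add: B_def[symmetric])
  have eG: "fst u rN = n \<Longrightarrow> fst u rEll < B \<Longrightarrow> 2 ^ fst u rEll < B \<Longrightarrow>
      eval_expr v u (Bin Less (Bin Shl (Num (Suc 0)) (Reg rEll)) (Reg rN \<oplus> Num 2)) = of_bool (2 ^ fst u rEll < n + 2)" for u
    using bB(11,12,13,17) by (simp add: push_bit_eq_mult B_def[symmetric])
  have eI: "Suc (fst u rEll) < B \<Longrightarrow> eval_expr v u (Reg rEll \<oplus> Num (Suc 0)) = Suc (fst u rEll)" for u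
    using bB(13) by (simp add: B_def[symmetric])
  note evals = eW eR eL eC eG eI
  have eval_RR: "fst u rR = R \<Longrightarrow> eval_expr v u (Reg rR \<oplus> Reg rR) = 2 * R" for u
    using bB WB by (simp add: mult_2 B_def[symmetric])
  have "wp v [While (Bin Less (Bin Shl (Num 1) (Reg rEll)) (Reg rN \<oplus> Num 2)) (Assign rEll (Reg rEll \<oplus> Num 1)),
     seqs ?rest] (S 0) t0 ?Q" if t0: "t0 \<le> 10" for t0
  proof (rule wp_While[where n = l and Inv = "\<lambda>i s' t'. s' = S i \<and> t' = 2 * i + t0"])
    fix i s' t'
    assume i: "i < l" and s': "s' = S i \<and> t' = 2 * i + t0"
    have "2 ^ i < n + 2" using pow_less_ell i by (simp add: l_def)
    moreover have "2 ^ i < B" using calculation bB(17) by linarith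
    moreover have "i < B" "Suc i < B" using i bB by linarith+
    ultimately show "eval_expr v s' (Bin Less (Bin Shl (Num 1) (Reg rEll)) (Reg rN \<oplus> Num 2)) \<noteq> 0 \<and>
      wp v [Assign rEll (Reg rEll \<oplus> Num 1)] s' (Suc t') (\<lambda>s' t'. s' = S (Suc i) \<and> t' = 2 * Suc i + t0)"
      using s' regs
      by (intro conjI; simp add: wp_simps S_def evals del: eval_expr.simps; intro wp_Nil; simp)
  next
    fix s' t'
    assume s': "s' = S l \<and> t' = 2 * l + t0"
    have "\<not> 2 ^ l < n + 2" using l by simp
    moreover have "wp v [seqs ?rest] s' (Suc t') ?Q"
      using s' t0 regs
      by (simp add: wp_simps S_def evals eval_RR del: eval_expr.simps, intro wp_Nil, simp)
    ultimately show "eval_expr v s' (Bin Less (Bin Shl (Num 1) (Reg rEll)) (Reg rN \<oplus> Num 2)) = 0 \<and>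
      wp v [seqs ?rest] s' (Suc t') ?Q"
      using s' regs bB by (simp add: S_def evals del: eval_expr.simps)
  qed simp
  then show ?thesis unfolding W_def[symmetric] R_def[symmetric] L_def[symmetric] using v_pos
    by (simp add: initialize_def wp_simps S_def)
qed

lemma rep_encode_header:
  "rep (encode n d xs ys) 0 = n" "rep (encode n d xs ys) (Suc 0) = d"
  "rep (encode n d xs ys) 2 = length xs" "rep (encode n d xs ys) 3 = length ys"
  by (simp_all add: rep_def encode_def numeral_3_eq_3 numeral_2_eq_2)

lemma wp_read_input:
  assumes v: "4 \<le> (2::nat) ^ v" and bounds: "n < 2 ^ v" "d < 2 ^ v" "length xs < 2 ^ v" "length ys < 2 ^ v"
    and mem: "snd s = rep (encode n d xs ys)"
  shows "wp v [seqs read_input] s 0 (\<lambda>s' t. t \<le> 15 \<and>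
    s' = ((fst s)(rN := n, rD := d, rNA := length xs, rNB := length ys), snd s))"
proof -
  have v_pos: "0 < v" using v by (cases v) auto
  have e: "snd u = rep (encode n d xs ys) \<Longrightarrow> eval_expr v u (Mem (Num 0)) = n"
    "snd u = rep (encode n d xs ys) \<Longrightarrow> eval_expr v u (Mem (Num (Suc 0))) = d"
    "snd u = rep (encode n d xs ys) \<Longrightarrow> eval_expr v u (Mem (Num 2)) = length xs"
    "snd u = rep (encode n d xs ys) \<Longrightarrow> eval_expr v u (Mem (Num 3)) = length ys" for u
    using v v_pos bounds by (simp_all add: rep_encode_header)
  show ?thesis
    by (simp add: read_input_def wp_simps e mem del: eval_expr.simps, intro wp_Nil) simp
qed

lemma safe_step_eq:
  assumes "step w c = return_pmf c'" "safe w ok t c' e"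
  shows "safe w ok (Suc t) c e"
proof (rule safe_reach[OF _ assms(2)])
  show "run w 1 c = return_pmf c'" using assms(1) by (simp add: bind_return_pmf)
qed simp

definition solver_time :: "nat \<Rightarrow> nat \<Rightarrow> nat \<Rightarrow> cmd \<Rightarrow> nat \<Rightarrow> nat \<Rightarrow> nat" where
  "solver_time K q m P n d = 2 * ell n + 100 + K * d *
     (n * (16 * d + 110) + 2 * m + 150 + (msize P + 3) * (2 ^ (2 * ell n - ell n div q) + 1))"

lemma length_le_card: "lists_set xs A n d \<Longrightarrow> length xs \<le> n"
  unfolding lists_set_def using distinct_card by fastforce

text \<open>Everything is compared with \<open>X = 2 ^ ell n\<close>, which bounds
  \<open>n + 2\<close> and \<open>K * d + K\<close>: a query fits into \<open>X ^ 3 \<le> R\<close>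
  cells, and at most \<open>X ^ 2\<close> regions are needed. The values \<open>\<rho>\<close>,
  \<open>\<epsilon>\<close> and \<open>T\<close> do not occur in the program, only in its analysis,
  so none of them has to be computable.\<close>

lemma solver_correct:
  assumes alg: "approximates_chamfer (word_size c n) P n (K * d + \<rho>) \<epsilon> T"
    and T: "T \<le> 2 ^ (2 * ell n - ell n div q)" and P: "regs_below m P"
    and \<rho>: "\<rho> < K" and K_bounds: "2 \<le> K" "K * d + K \<le> n + 2" and d: "0 < d" "3 * n \<le> 2 ^ d"
    and q: "0 < q" "q \<le> n + 2" and eps: "\<epsilon> * real d \<le> 1/2" "0 < \<epsilon>"
  shows "solves_hitting_set (word_size (c + 6) n) (solver c K q m P) n d (solver_time K q m P n d)"
  unfolding solves_hitting_set_def
proof (intro allI impI, elim conjE)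
  fix A B xs ys
  assume A: "lists_set xs A n d" and B: "lists_set ys B n d"
  define l where "l = ell n"
  define v where "v = (c + 6) * l"
  define w where "w = c * l"
  define R :: nat where "R = 2 ^ ((c + 3) * l)"
  define L :: nat where "L = 2 ^ (2 * l - l div q)"
  have l: "0 < l" "n + 2 \<le> 2 ^ l" unfolding l_def using ell_pos le_pow_ell by auto
  have Kd: "1 * d \<le> K * d" using K_bounds(1) by (intro mult_le_mono1) simp
  define X :: nat where "X = 2 ^ l"
  have X2: "2 \<le> X" using l(2) by (simp add: X_def)
  have X3: "X ^ 3 \<le> R" unfolding X_def R_def power_mult[symmetric] using l(1)
    by (intro power_increasing) (auto simp: algebra_simps)
  have XR: "R * X ^ 2 \<le> 2 ^ v" unfolding X_def R_def v_def power_mult[symmetric] power_add[symmetric]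
    using l(1) by (intro power_increasing) (auto simp: algebra_simps)
  interpret reduction v w R K L n d m xs ys
  proof
    show "w < v" "2 ^ w \<le> R" "L < 2 ^ v" using l(1)
      by (auto simp: w_def v_def R_def L_def algebra_simps intro!: power_increasing power_strict_increasing)
    show "set xs \<subseteq> cube d" "set ys \<subseteq> cube d" using A B by (auto simp: lists_set_def)
    show "length xs \<le> n" "length ys \<le> n" using A B by (auto intro: length_le_card)
    have "(2 * n + 1) * (K * d + K) \<le> (2 * n + 1) * X"
      using K_bounds(2) l(2) by (intro mult_le_mono2) (simp add: X_def)
    \<comment> \<open>From \<open>n + 2 \<le> X\<close>; the subtracted 3 later absorbs the 4 header
      cells, even for \<open>X = 2\<close>.\<close>
    also have "\<dots> \<le> (2 * X - 3) * X"
      using l(2) by (intro mult_le_mono1) (simp add: X_def)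
    finally have "4 + (2 * n + 1) * (K * d + K) \<le> 4 + (2 * X - 3) * X" by simp
    also have "\<dots> \<le> X ^ 3"
    proof -
      obtain y where y: "X = y + 2" using X2 le_Suc_ex by (metis add.commute)
      show ?thesis unfolding y by (simp add: power3_eq_cube algebra_simps)
    qed
    finally show "4 + (2 * n + 1) * (K * d + K) \<le> R" using X3 by linarith
    have "K * d + 3 \<le> 2 * X" using K_bounds l(2) by (simp add: X_def)
    also have "\<dots> \<le> X ^ 2" using X2 by (simp add: power2_eq_square)
    finally have "(K * d + 3) * R \<le> X ^ 2 * R" by (rule mult_le_mono1)
    then show "(K * d + 3) * R \<le> 2 ^ v" 
      using XR unfolding mult.commute[of R "X ^ 2"] by (rule order_trans)
  qed (use d K_bounds in auto)
  have R2: "2 * R < 2 ^ v" using base_fits[of "K * d"] R_bounds(7) by (simp add: base_def)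
  have vb: "4 \<le> (2::nat) ^ v" "n < 2 ^ v" "d < 2 ^ v" "length xs < 2 ^ v" "length ys < 2 ^ v"
    using R2 R_bounds(3,5,7) xs(2) ys(2) by linarith+
  let ?ok = "\<lambda>mem :: nat \<Rightarrow> nat. mem 0 \<noteq> 0 \<longleftrightarrow> hit"
  let ?e = "ennreal (potential \<rho> (K * d) {..<length xs})"
  let ?t = "K * d * (iteration_time P + 1) + 2"
  let ?fin = "[Seq (main_loop K m P) (Store (Num 0) (Reg rAlv))]"
  let ?rest = "Seq (seqs (initialize c K q)) (Seq (main_loop K m P) (Store (Num 0) (Reg rAlv)))"
  let ?if = "If (Bin Equal (Reg rD) (Num 0))
     (Store (Num 0) (Bin And (Bin Equal (Reg rNB) (Num 0)) (Bin Less (Num 0) (Reg rNA)))) ?rest"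
  let ?enc = "encode n d xs ys"
  define s1 :: state where "s1 = ((\<lambda>_. 0)(rN := n, rD := d, rNA := length xs, rNB := length ys), rep ?enc)"
  define s2 :: state where "s2 = ((fst s1)(rEll := l, rW := 2 ^ w, rR := R, rL := L,
       rCnt := K * d, rAlv := length xs, rBase := 2 * R), snd s1)"
  have len_enc: "length ?enc \<le> R"
  proof -
    have "length ?enc = 4 + length xs * d + length ys * d"
      using length_concat_eq[of xs d] length_concat_eq[of ys d] xs(1) ys(1)
      by (auto simp: encode_def cube_def subset_iff)
    moreover have "length xs * d \<le> n * d" "length ys * d \<le> n * d"
      using xs(2) ys(2) by (auto intro: mult_le_mono1)
    ultimately show ?thesis using R_bounds(1) by linarith
  qed
  have "inv (K * d) {..<length xs} s2"
    using len_enc R_bounds(7) by (simp add: inv_def common_def s2_def s1_def base_def) (simp add: rep_def)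
  then have "safe v ?ok ?t ([main_loop K m P, Store (Num 0) (Reg rAlv)], s2) ?e"
    using alg T P eps A B unfolding w_def[symmetric] word_size_ell l_def[symmetric] L_def[symmetric]
    by (intro safe_main_loop) (auto simp: w_def[symmetric] lists_set_def)
  from safe_Seq[OF this] have 2: "safe v ?ok (Suc ?t) (?fin, s2) ?e" .
  have Kb: "K * d \<le> n" "K \<le> n + 2" "d \<le> n" using K_bounds Kd by linarith+
  have "wp v [seqs (initialize c K q)] s1 0 (\<lambda>s' t. t \<le> 2 * l + 40 \<and> s' = s2)"
    unfolding s2_def w_def R_def L_def l_def
    by (rule wp_initialize) (use v_def l_def Kb xs(2) q in \<open>simp_all add: s1_def\<close>)
  then have "wp v [seqs (initialize c K q)] s1 0
      (\<lambda>s' t. t \<le> 2 * l + 40 \<and> safe v ?ok (Suc ?t) (?fin, s') ?e)"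
    by (rule wp_mono) (use 2 in blast)
  from safe_Seq[OF safe_if_wp[OF this order_refl, unfolded append_Cons append_Nil]]
  have "safe v ?ok (Suc (2 * l + 40 + Suc ?t)) ([?rest], s1) ?e" by simp
  moreover have "step v ([?if], s1) = return_pmf ([?rest], s1)"
    using vb d v_pos by (simp add: s1_def)
  ultimately have 3: "safe v ?ok (Suc (Suc (2 * l + 40 + Suc ?t))) ([?if], s1) ?e"
    by (rule safe_step_eq[rotated])
  have "wp v [seqs read_input] (\<lambda>_. 0, rep ?enc) 0 (\<lambda>s' t. t \<le> 15 \<and> s' = s1)"
    using wp_read_input[of v n d xs ys "(\<lambda>_. 0, rep ?enc)"] vb by (simp add: s1_def)
  then have "wp v [seqs read_input] (\<lambda>_. 0, rep ?enc) 0 (\<lambda>s' t. t \<le> 15 \<and>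
      safe v ?ok (Suc (Suc (2 * l + 40 + Suc ?t))) ([?if], s') ?e)"
    by (rule wp_mono) (use 3 in blast)
  from safe_Seq[OF safe_if_wp[OF this order_refl, unfolded append_Cons append_Nil]]
  have "safe v ?ok (Suc (15 + Suc (Suc (2 * l + 40 + Suc ?t)))) ([solver c K q m P], (\<lambda>_. 0, rep ?enc)) ?e"
    by (simp add: solver_def)
  moreover have "init_config (solver c K q m P) ?enc = ([solver c K q m P], (\<lambda>_. 0, rep ?enc))"
    by (auto simp: init_config_def rep_def)
  ultimately have "safe v ?ok (Suc (15 + Suc (Suc (2 * l + 40 + Suc ?t)))) (init_config (solver c K q m P) ?enc) ?e"
    by simp
  moreover have "Suc (15 + Suc (Suc (2 * l + 40 + Suc ?t))) \<le> solver_time K q m P n d"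
  proof -
    have "iteration_time P + 1 \<le> n * (16 * d + 110) + 2 * m + 150 + (msize P + 3) * (L + 1)"
      by (simp add: iteration_time_def prepare_time_def collect_time_def algebra_simps)
    then have "K * d * (iteration_time P + 1) \<le> K * d * (n * (16 * d + 110) + 2 * m + 150 + (msize P + 3) * (L + 1))"
      by (rule mult_le_mono2)
    then show ?thesis unfolding solver_time_def l_def[symmetric] L_def[symmetric] by linarith
  qed
  ultimately have "safe v ?ok (solver_time K q m P n d) (init_config (solver c K q m P) ?enc) ?e"
    using order_refl by (rule safe_mono)
  moreover have "?e \<le> ennreal (1/3)"
    using initial_potential[OF \<rho> d(2)] by (rule ennreal_leI)
  ultimately have "computes v (solver c K q m P) ?enc (solver_time K q m P n d) ?ok"
    by (rule computes_if_safe)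
  then show "computes (word_size (c + 6) n) (solver c K q m P) (encode n d xs ys)
      (solver_time K q m P n d) (\<lambda>mem. (mem 0 \<noteq> 0) = (\<exists>a\<in>A. hits a B))"
    using A B by (simp add: word_size_ell v_def l_def hit_def lists_set_def)
qed

lemma solver_dimension_0: "solves_hitting_set (word_size (c + 6) n) (solver c K q m P) n 0 30"
  unfolding solves_hitting_set_def
proof (intro allI impI, elim conjE)
  fix A B xs ys
  assume A: "lists_set xs A n 0" and B: "lists_set ys B n 0"
  define v where "v = word_size (c + 6) n"
  have p: "(2::nat) ^ (6 * 1) \<le> 2 ^ ((c + 6) * ell n)" "(2::nat) ^ ell n \<le> 2 ^ ((c + 6) * ell n)"
    using ell_pos[of n] by (intro power_increasing mult_le_mono; simp)+
  then have v: "64 \<le> (2::nat) ^ v" "n + 2 \<le> 2 ^ v"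
    using order_trans[OF le_pow_ell p(2)] by (simp_all add: v_def word_size_ell)
  have v_pos: "0 < v" using v by (cases v) auto
  have sub: "A \<subseteq> {[]}" "B \<subseteq> {[]}" using A B by (auto simp: lists_set_def cube_def)
  have xs: "xs = [] \<and> A = {} \<or> xs = [[]] \<and> A = {[]}" 
    using A sub(1) by (cases xs; cases "tl xs") (auto simp: lists_set_def)
  have ys: "ys = [] \<and> B = {} \<or> ys = [[]] \<and> B = {[]}"
    using B sub(2) by (cases ys; cases "tl ys") (auto simp: lists_set_def)
  have len: "length xs \<le> 1" "length ys \<le> 1" using xs ys by auto
  let ?enc = "encode n 0 xs ys" and ?ok = "\<lambda>mem :: nat \<Rightarrow> nat. (mem 0 \<noteq> 0) = (\<exists>a\<in>A. hits a B)"
  let ?st = "Store (Num 0) (Bin And (Bin Equal (Reg rNB) (Num 0)) (Bin Less (Num 0) (Reg rNA)))"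
  let ?rest = "Seq (seqs (initialize c K q)) (Seq (main_loop K m P) (Store (Num 0) (Reg rAlv)))"
  let ?if = "If (Bin Equal (Reg rD) (Num 0)) ?st ?rest"
  define s1 :: state where "s1 = ((\<lambda>_. 0)(rN := n, rD := 0, rNA := length xs, rNB := length ys), rep ?enc)"
  define s2 :: state where "s2 = (fst s1, (snd s1)(0 := of_bool (xs \<noteq> [] \<and> ys = [])))"
  have "step v ([?st], s1) = return_pmf ([], s2)"
    using v xs ys by (auto simp: s1_def s2_def)
  moreover have "safe v ?ok 0 ([], s2) 0"
    by (rule safe_halted) (use xs ys in \<open>auto simp: s2_def hits_def dot_def\<close>)
  ultimately have "safe v ?ok 1 ([?st], s1) 0" unfolding One_nat_def by (rule safe_step_eq)
  moreover have "step v ([?if], s1) = return_pmf ([?st], s1)"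
    using v v_pos by (simp add: s1_def)
  ultimately have 3: "safe v ?ok 2 ([?if], s1) 0"
    using safe_step_eq[of v "([?if], s1)" "([?st], s1)" ?ok 1 0] by (simp add: numeral_2_eq_2)
  have "wp v [seqs read_input] (\<lambda>_. 0, rep ?enc) 0 (\<lambda>s' t. t \<le> 15 \<and> s' = s1)"
    using wp_read_input[of v n 0 xs ys "(\<lambda>_. 0, rep ?enc)"] v len by (simp add: s1_def)
  then have "wp v [seqs read_input] (\<lambda>_. 0, rep ?enc) 0 (\<lambda>s' t. t \<le> 15 \<and> safe v ?ok 2 ([?if], s') 0)"
    by (rule wp_mono) (use 3 in blast)
  from safe_Seq[OF safe_if_wp[OF this order_refl, unfolded append_Cons append_Nil]]
  have "safe v ?ok 18 ([solver c K q m P], (\<lambda>_. 0, rep ?enc)) 0"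
    by (simp add: solver_def)
  moreover have "init_config (solver c K q m P) ?enc = ([solver c K q m P], (\<lambda>_. 0, rep ?enc))"
    by (auto simp: init_config_def rep_def)
  ultimately have "safe v ?ok 30 (init_config (solver c K q m P) ?enc) 0"
    by (auto elim!: safe_mono)
  then show "computes (word_size (c + 6) n) (solver c K q m P) ?enc 30 ?ok"
    unfolding v_def by (rule computes_if_safe) simp
qed

section \<open>Asymptotics\<close>

text \<open>The exponent differs from \<open>(2 - 1/q) * ell n\<close> only by the rounding in
  \<open>ell n div q\<close>, which is at most 1, and \<open>2 ^ ell n\<close> lies between
  \<open>n + 2\<close> and \<open>2 * n + 4\<close>. So the clock is long enough for an algorithm of
  time \<open>n powr (2 - 1/q)\<close>, up to a constant factor not longer, and computed without
  real arithmetic.\<close>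

lemma clock_bounds:
  fixes n q :: nat
  assumes q: "0 < q"
  defines "a \<equiv> 1 / real q" and "L \<equiv> (2::nat) ^ (2 * ell n - ell n div q)"
  shows "real n powr (2 - a) \<le> real L" "real L \<le> 2 * (2 * real n + 4) powr (2 - a)"
proof -
  let ?l = "ell n"
  have a: "a \<le> 1" using q by (simp add: a_def)
  have dl: "?l div q \<le> 2 * ?l" using div_le_dividend[of ?l q] by linarith
  have L: "real L = 2 powr (2 * real ?l - real (?l div q))"
    using dl by (simp add: L_def powr_realpow[symmetric] of_nat_diff)
  have fl: "real (?l div q) \<le> a * real ?l" "a * real ?l \<le> real (?l div q) + 1"
  proof -
    have "real ?l = real (q * (?l div q) + ?l mod q)" by simp
    then have "a * real ?l = real (?l div q) + real (?l mod q) / real q"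
      unfolding of_nat_add of_nat_mult using q by (simp add: a_def field_simps)
    moreover have "real (?l mod q) / real q \<le> 1" using q by simp
    ultimately show "real (?l div q) \<le> a * real ?l" "a * real ?l \<le> real (?l div q) + 1" by simp_all
  qed
  have X: "2 powr ((2 - a) * real ?l) = (2 ^ ?l) powr (2 - a)"
    by (simp add: powr_powr powr_realpow[symmetric] mult.commute)
  have "real n + 2 \<le> 2 ^ ?l"
  proof -
    have "real (n + 2) \<le> real (2 ^ ?l)" using le_pow_ell by (rule of_nat_mono)
    then show ?thesis by simp
  qed
  then have "real n powr (2 - a) \<le> (2 ^ ?l) powr (2 - a)" using a le_pow_ell[of n] by (intro powr_mono2) auto
  also have "\<dots> = 2 powr ((2 - a) * real ?l)" by (simp only: X)
  also have "\<dots> \<le> real L" unfolding L using fl by (intro powr_mono) (auto simp: algebra_simps)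
  finally show "real n powr (2 - a) \<le> real L" .
  have "real L \<le> 2 powr ((2 - a) * real ?l + 1)"
    unfolding L using fl by (intro powr_mono) (auto simp: algebra_simps)
  also have "\<dots> = 2 * (2 ^ ?l) powr (2 - a)" by (simp add: powr_add X[symmetric])
  also have "\<dots> \<le> 2 * (2 * real n + 4) powr (2 - a)"
  proof -
    have "2 ^ (?l - 1) < n + 2" using pow_less_ell[of "?l - 1" n] ell_pos[of n] by simp
    then have "2 ^ ?l \<le> 2 * n + 4" using ell_pos[of n] by (cases ?l) auto
    then have "real (2 ^ ?l) \<le> real (2 * n + 4)" by (rule of_nat_mono)
    then show ?thesis using a by (intro mult_left_mono powr_mono2) auto
  qed
  finally show "real L \<le> 2 * (2 * real n + 4) powr (2 - a)" .
qed

lemma ell_le: "ell n \<le> n + 2"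
proof -
  have "ell n - 1 < 2 ^ (ell n - 1)" by (rule less_exp)
  also have "\<dots> < n + 2" using pow_less_ell[of "ell n - 1" n] ell_pos[of n] by simp
  finally show ?thesis by linarith
qed

lemma polylog_le:
  fixes a C E :: real
  assumes "0 < a"
  shows "eventually (\<lambda>n. C * ln (real n) ^ 2 + E \<le> real n powr a) sequentially"
  using assms by real_asymp

text \<open>The part of the running time that does not involve the clock is nearly linear and gets
  half of the final bound.\<close>

lemma linear_polylog_le:
  fixes C E F G :: real
  shows "eventually (\<lambda>n. 2 * real n + E + C * ln (real n) ^ 2 * (real n * (16 * (C * ln (real n) ^ 2) + 110) + F)
    \<le> 1/2 * real n powr (3/2)) sequentially"
  by real_asymp

text \<open>There are only polylogarithmically many queries, each dominated by the clock of order
  \<open>n powr (2 - 1/q)\<close>. Giving up half of the saving \<open>1/q\<close> in the exponent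
  absorbs the polylogarithmic factor.\<close>

lemma solver_time_bound:
  fixes D :: "nat \<Rightarrow> nat" and C :: real
  assumes D: "eventually (\<lambda>n. real (D n) \<le> C * ln (real n) ^ 2) sequentially" and C: "0 < C"
    and q: "0 < q" and K: "0 < K"
  shows "eventually (\<lambda>n. real (solver_time K q m P n (D n div K)) \<le> real n powr (2 - 1 / real (2 * q))) sequentially"
proof -
  define a where "a = 1 / real q"
  have a: "0 < a" "a \<le> 1" using q by (simp_all add: a_def)
  define S where "S = real (msize P) + 3"
  define F where "F = 2 * real m + 150 + S"
  \<comment> \<open>The bound on \<open>L\<close> below has the constant
    \<open>2 * 4 ^ 2 = 32\<close>; it is doubled so that the clock takes at most half of the final
    bound.\<close>
  have 1: "eventually (\<lambda>n. 64 * C * S * ln (real n) ^ 2 + 0 \<le> real n powr (a / 2)) sequentially"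
    using a by (intro polylog_le) simp
  show ?thesis
    using D 1 linear_polylog_le[of 106 C F] eventually_ge_at_top[of 2]
  proof eventually_elim
    case (elim n)
    let ?y = "C * ln (real n) ^ 2" and ?d = "D n div K" and ?l = "ell n"
    define L where "L = (2::nat) ^ (2 * ?l - ?l div q)"
    have Kd: "real (K * ?d) \<le> ?y" "real ?d \<le> ?y"
    proof -
      have "K * ?d \<le> D n" "?d \<le> D n" by simp_all
      then have "real (K * ?d) \<le> real (D n)" "real ?d \<le> real (D n)" by (blast intro: of_nat_mono)+
      with elim(1) show "real (K * ?d) \<le> ?y" "real ?d \<le> ?y" by linarith+
    qed
    have y0: "0 \<le> ?y" using C by simp
    have n1: "1 \<le> real n" using elim(4) by simp
    have L: "real L \<le> 32 * real n powr (2 - a)"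
    proof -
      have "real L \<le> 2 * (2 * real n + 4) powr (2 - a)"
        using clock_bounds(2)[OF q, of n] by (simp add: L_def a_def)
      also have "\<dots> \<le> 2 * (4 * real n) powr (2 - a)"
        using elim(4) a by (intro mult_left_mono powr_mono2) auto
      also have "\<dots> = 2 * (4 powr (2 - a) * real n powr (2 - a))" by (simp add: powr_mult)
      also have "\<dots> \<le> 2 * (4 powr 2 * real n powr (2 - a))"
        using a by (intro mult_left_mono mult_right_mono powr_mono) auto
      finally show ?thesis by simp
    qed
    have "real (solver_time K q m P n ?d) = 2 * real ?l + 100 + real (K * ?d) *
        (real n * (16 * real ?d + 110) + 2 * real m + 150 + S * (real L + 1))"
      by (simp add: solver_time_def L_def S_def algebra_simps)
    also have "\<dots> \<le> 2 * (real n + 2) + 100 + ?y *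
        (real n * (16 * ?y + 110) + 2 * real m + 150 + S * (32 * real n powr (2 - a) + 1))"
    proof (intro add_mono mult_mono order_refl mult_left_mono)
      show "real ?l \<le> real n + 2" using of_nat_mono[OF ell_le[of n], where 'a = real] by simp
    qed (use Kd y0 L in \<open>auto simp: S_def intro!: add_nonneg_nonneg mult_nonneg_nonneg\<close>)
    also have "\<dots> = (2 * real n + 104 + ?y * (real n * (16 * ?y + 110) + F)) + 32 * S * ?y * real n powr (2 - a)"
      by (simp add: F_def algebra_simps)
    also have "\<dots> \<le> 1/2 * real n powr (3/2) + 1/2 * (real n powr (a/2) * real n powr (2 - a))"
    proof (intro add_mono)
      show "2 * real n + 104 + ?y * (real n * (16 * ?y + 110) + F) \<le> 1/2 * real n powr (3/2)"
        using elim(3) by linarith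
      have "32 * S * ?y \<le> 1/2 * real n powr (a/2)" using elim(2) by (simp add: algebra_simps)
      then have "32 * S * ?y * real n powr (2 - a) \<le> 1/2 * real n powr (a/2) * real n powr (2 - a)"
        by (rule mult_right_mono) simp
      then show "32 * S * ?y * real n powr (2 - a) \<le> 1/2 * (real n powr (a/2) * real n powr (2 - a))"
        by (simp only: mult.assoc)
    qed
    also have "\<dots> = 1/2 * real n powr (3/2) + 1/2 * real n powr (2 - a/2)"
      by (simp add: powr_add[symmetric])
    also have "real n powr (3/2) \<le> real n powr (2 - a/2)" using a n1 by (intro powr_mono) auto
    then have "1/2 * real n powr (3/2) + 1/2 * real n powr (2 - a/2) \<le> real n powr (2 - a/2)" by simp
    finally show ?case by (simp add: a_def mult.commute)
  qed
qed

text \<open>With \<open>d = D div K\<close>, the first estimate gives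
  \<open>3 * n \<le> 2 ^ d\<close>, its \<open>+ 1\<close> compensating the rounding, and the second
  makes \<open>d\<close> positive.\<close>

lemma eventually_dimension_large:
  fixes c :: real
  assumes "0 < c"
  shows "eventually (\<lambda>n. log 2 (3 * real n) + 1 \<le> c * ln (real n) ^ 2) sequentially"
    "eventually (\<lambda>n. 2 \<le> c * ln (real n) ^ 2) sequentially"
  using assms by real_asymp+


section \<open>Dimension functions and the transfer of running times\<close>

lemma bigthetaE_bounds:
  fixes f g :: "nat \<Rightarrow> real"
  assumes "f \<in> \<Theta>(g)"
  obtains c C where "0 < c" "0 < C" "eventually (\<lambda>n. c * \<bar>g n\<bar> \<le> \<bar>f n\<bar> \<and> \<bar>f n\<bar> \<le> C * \<bar>g n\<bar>) sequentially"
proof -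
  from assms have "f \<in> O(g)" "f \<in> \<Omega>(g)" by (auto simp: bigtheta_def)
  then obtain c C where cC: "0 < C" "eventually (\<lambda>n. norm (f n) \<le> C * norm (g n)) sequentially"
    "0 < c" "eventually (\<lambda>n. norm (f n) \<ge> c * norm (g n)) sequentially"
    by (elim landau_o.bigE landau_omega.bigE)
  have "eventually (\<lambda>n. c * \<bar>g n\<bar> \<le> \<bar>f n\<bar> \<and> \<bar>f n\<bar> \<le> C * \<bar>g n\<bar>) sequentially"
    using cC(2,4) by eventually_elim auto
  with cC that show thesis by blast
qed

text \<open>Rounding loses less than 1, which is at most half of the lower bound once that bound
  reaches 2; hence the constant \<open>c / (2 * real K)\<close>.\<close>

lemma dimension_div_bigtheta:
  fixes D :: "nat \<Rightarrow> nat"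
  assumes D: "(\<lambda>N. real (D N)) \<in> \<Theta>(\<lambda>N. ln (real N) ^ 2)" and K: "0 < K"
  shows "(\<lambda>N. real (D N div K)) \<in> \<Theta>(\<lambda>N. ln (real N) ^ 2)"
proof -
  obtain c C where c: "0 < c" "0 < C"
    "eventually (\<lambda>n. c * \<bar>ln (real n) ^ 2\<bar> \<le> \<bar>real (D n)\<bar> \<and> \<bar>real (D n)\<bar> \<le> C * \<bar>ln (real n) ^ 2\<bar>) sequentially"
    using bigthetaE_bounds[OF D] by blast
  show ?thesis
  proof (rule bigthetaI)
    show "(\<lambda>N. real (D N div K)) \<in> O(\<lambda>N. ln (real N) ^ 2)"
    proof (rule landau_o.bigI[OF c(2)], use c(3) in eventually_elim)
      case (elim n)
      have "real (D n div K) \<le> real (D n)" by (intro of_nat_mono) simp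
      also have "\<dots> \<le> C * ln (real n) ^ 2" using elim by simp
      finally have "real (D n div K) \<le> C * ln (real n) ^ 2" .
      then show ?case by simp
    qed
    have cK: "0 < c / real K" using c K by simp
    have K0: "0 < c / (2 * real K)" using c K by simp
    show "(\<lambda>N. real (D N div K)) \<in> \<Omega>(\<lambda>N. ln (real N) ^ 2)"
    proof (rule landau_omega.bigI[OF K0], use c(3) eventually_dimension_large(2)[OF cK] in eventually_elim)
      case (elim n)
      have "D n < K * (D n div K + 1)" using K by (simp add: dividend_less_times_div)
      then have "real (D n) < real (K * (D n div K + 1))" by (rule of_nat_less_iff[THEN iffD2])
      then have "real (D n) / real K < real (D n div K) + 1" using K by (simp add: field_simps)
      moreover have "c / real K * ln (real n) ^ 2 \<le> real (D n) / real K"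
        using elim(1) K by (simp add: field_simps)
      moreover have "y / 2 \<le> x" if "2 \<le> y" "y \<le> z" "z < x + 1" for x y z :: real
        using that by linarith
      ultimately have "c / real K * ln (real n) ^ 2 / 2 \<le> real (D n div K)" using elim(2) by blast
      then show ?case by simp
    qed
  qed
qed

text \<open>The transfer is stated separately for each size beyond \<open>N0\<close>, with one
  program for all sizes. It thus applies when the algorithm is fast at all large sizes as well as
  when it is fast only at infinitely many.\<close>

lemma fast_chamfer_gives_fast_hitting_set:
  fixes ALG :: cmd and D :: "nat \<Rightarrow> nat" and \<epsilon> :: "nat \<Rightarrow> real" and T :: "nat \<Rightarrow> nat"
  assumes D: "(\<lambda>N. real (D N)) \<in> \<Theta>(\<lambda>N. ln (real N) ^ 2)"
    and \<epsilon>_pos: "\<And>N. \<epsilon> N > 0" and \<epsilon>: "\<epsilon> \<in> \<Theta>(\<lambda>N. 1 / real (D N))"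
    and ALG: "\<And>N. approximates_chamfer (word_size c N) ALG N (D N) (\<epsilon> N) (T N)"
    and \<delta>: "0 < \<delta>"
  shows "\<exists>P K \<delta>' N0. 0 < K \<and> 0 < \<delta>' \<and>
    (\<forall>n. solves_hitting_set (word_size (c + 6) n) P n 0 30) \<and>
    (\<forall>n\<ge>N0. real (T n) \<le> real n powr (2 - \<delta>) \<longrightarrow>
      (\<exists>t. solves_hitting_set (word_size (c + 6) n) P n (D n div K) t \<and> real t \<le> real n powr (2 - \<delta>')))"
proof -
  obtain c1 C1 where c1: "0 < c1" "0 < C1"
    "eventually (\<lambda>n. c1 * \<bar>ln (real n) ^ 2\<bar> \<le> \<bar>real (D n)\<bar> \<and> \<bar>real (D n)\<bar> \<le> C1 * \<bar>ln (real n) ^ 2\<bar>) sequentially"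
    using bigthetaE_bounds[OF D] by blast
  obtain c2 C2 where c2: "0 < c2" "0 < C2"
    "eventually (\<lambda>n. c2 * \<bar>1 / real (D n)\<bar> \<le> \<bar>\<epsilon> n\<bar> \<and> \<bar>\<epsilon> n\<bar> \<le> C2 * \<bar>1 / real (D n)\<bar>) sequentially"
    using bigthetaE_bounds[OF \<epsilon>] by blast
  \<comment> \<open>\<open>K \<ge> 2 * C2\<close> turns \<open>\<epsilon> \<le> C2 / D\<close> into
    \<open>\<epsilon> * d \<le> C2 / K \<le> 1/2\<close>, and \<open>K \<ge> 2\<close> gives the
    embedding room for two blocks of length \<open>d\<close>.\<close>
  define K where "K = nat \<lceil>2 * C2\<rceil> + 2"
  have K: "2 \<le> K" "2 * C2 \<le> real K" by (auto simp: K_def) linarith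
  then have Kpos: "0 < K" by simp
  \<comment> \<open>With \<open>1/q < \<delta>\<close> the clock covers every running time up to
    \<open>n powr (2 - \<delta>)\<close>.\<close>
  obtain q :: nat where q: "0 < q" "1 / real q < \<delta>"
    using \<delta> real_arch_inverse[of \<delta>] by (auto simp: inverse_eq_divide)
  obtain m where m: "regs_below m ALG" using ex_regs_below by blast
  define \<delta>' where "\<delta>' = 1 / real (2 * q)"
  have up: "eventually (\<lambda>n. real (D n) \<le> C1 * ln (real n) ^ 2) sequentially"
    using c1(3) by eventually_elim simp
  have c1K: "0 < c1 / real K" using c1 Kpos by simp
  have "eventually (\<lambda>n. real (T n) \<le> real n powr (2 - \<delta>) \<longrightarrow>
      solves_hitting_set (word_size (c + 6) n) (solver c K q m ALG) n (D n div K) (solver_time K q m ALG n (D n div K)) \<and>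
      real (solver_time K q m ALG n (D n div K)) \<le> real n powr (2 - \<delta>')) sequentially"
    using c1(3) c2(3) solver_time_bound[OF up c1(2) q(1) Kpos, of m ALG]
      eventually_dimension_large[OF c1K] polylog_le[OF zero_less_one, of C1 "real K"] eventually_ge_at_top[of "q + 1"]
  proof eventually_elim
    case (elim n)
    let ?d = "D n div K"
    have n1: "1 \<le> real n" using elim(7) by simp
    have Dn: "c1 * ln (real n) ^ 2 \<le> real (D n)" "real (D n) \<le> C1 * ln (real n) ^ 2" using elim(1) by simp_all
    have split: "K * ?d + D n mod K = D n" by simp
    have lower: "c1 / real K * ln (real n) ^ 2 < real ?d + 1"
    proof -
      have "D n < K * (?d + 1)" using Kpos by (simp add: dividend_less_times_div)
      then have "real (D n) < real (K * (?d + 1))" by (rule of_nat_less_iff[THEN iffD2])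
      then have "real (D n) / real K < real ?d + 1" using Kpos by (simp add: field_simps)
      moreover have "c1 / real K * ln (real n) ^ 2 \<le> real (D n) / real K"
        using Dn(1) Kpos by (simp add: field_simps)
      ultimately show ?thesis by (rule order_le_less_trans[rotated])
    qed
    have arith: "x < z" if "x + 1 \<le> y" "y < z + 1" for x y z :: real using that by linarith
    have "(1::real) < real ?d" using elim(5) by (intro arith[OF _ lower]) simp
    then have d: "0 < ?d" by simp
    have "log 2 (3 * real n) \<le> real ?d" using arith[OF elim(4) lower] by (rule less_imp_le)
    then have "3 * real n \<le> 2 powr real ?d" using n1 by (simp add: log_le_iff)
    then have "real (3 * n) \<le> real (2 ^ ?d)" by (simp add: powr_realpow)
    then have pow: "3 * n \<le> 2 ^ ?d" by (rule of_nat_le_iff[THEN iffD1])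
    have "real (D n + K) \<le> real n" using Dn(2) elim(6) n1 by simp
    then have "D n + K \<le> n" by (rule of_nat_le_iff[THEN iffD1])
    moreover have "K * ?d \<le> D n" by simp
    ultimately have KD: "K * ?d + K \<le> n + 2" by linarith
    have eps: "\<epsilon> n * real ?d \<le> 1/2"
    proof -
      have Dpos: "0 < real (D n)" using d by (cases "D n") auto
      have "\<epsilon> n \<le> C2 / real (D n)" using elim(2) \<epsilon>_pos[of n] by simp
      then have "\<epsilon> n * real ?d \<le> C2 / real (D n) * real ?d" by (rule mult_right_mono) simp
      also have "real (K * ?d) \<le> real (D n)" by (rule of_nat_mono) simp
      then have "real ?d \<le> real (D n) / real K" using Kpos by (simp add: field_simps)
      then have "C2 / real (D n) * real ?d \<le> C2 / real (D n) * (real (D n) / real K)"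
        using c2(2) by (intro mult_left_mono) auto
      also have "\<dots> = C2 / real K" using Dpos by simp
      also have "\<dots> \<le> 1/2" using K Kpos by (simp add: field_simps)
      finally show ?thesis .
    qed
    show ?case
    proof (intro impI conjI)
      assume T: "real (T n) \<le> real n powr (2 - \<delta>)"
      have "real n powr (2 - \<delta>) \<le> real n powr (2 - 1 / real q)" using q n1 by (intro powr_mono) auto
      also have "\<dots> \<le> real (2 ^ (2 * ell n - ell n div q))" by (rule clock_bounds(1)[OF q(1)])
      finally have "T n \<le> 2 ^ (2 * ell n - ell n div q)"
        using T by (intro of_nat_le_iff[THEN iffD1]) (rule order_trans)
      then show "solves_hitting_set (word_size (c + 6) n) (solver c K q m ALG) n ?d (solver_time K q m ALG n ?d)"
        using ALG[of n] m K(1) Kpos KD d pow q(1) elim(7) eps \<epsilon>_pos[of n] split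
        by (intro solver_correct[where \<rho> = "D n mod K" and \<epsilon> = "\<epsilon> n" and T = "T n"]) simp_all
      show "real (solver_time K q m ALG n ?d) \<le> real n powr (2 - \<delta>')"
        using elim(3) by (simp add: \<delta>'_def)
    qed
  qed
  then obtain N0 where N0: "\<And>n. N0 \<le> n \<Longrightarrow> real (T n) \<le> real n powr (2 - \<delta>) \<Longrightarrow>
      solves_hitting_set (word_size (c + 6) n) (solver c K q m ALG) n (D n div K) (solver_time K q m ALG n (D n div K)) \<and>
      real (solver_time K q m ALG n (D n div K)) \<le> real n powr (2 - \<delta>')"
    unfolding eventually_sequentially by blast
  have "0 < \<delta>'" using q by (simp add: \<delta>'_def)
  with Kpos solver_dimension_0 N0 show ?thesis by blast
qed

theorem theorem2:
  fixes ALG :: cmd and c :: nat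
    and D :: "nat \<Rightarrow> nat" and \<epsilon> :: "nat \<Rightarrow> real"
    and T :: "nat \<Rightarrow> nat \<Rightarrow> real \<Rightarrow> nat"
  assumes HSC: "hitting_set_conjecture"
    and D: "(\<lambda>N. real (D N)) \<in> \<Theta>(\<lambda>N. ln (real N) ^ 2)"
    and \<epsilon>_pos: "\<And>N. \<epsilon> N > 0"
    and \<epsilon>: "\<epsilon> \<in> \<Theta>(\<lambda>N. 1 / real (D N))"
    and ALG: "\<And>N. approximates_chamfer (word_size c N) ALG N (D N) (\<epsilon> N) (T N (D N) (\<epsilon> N))"
  shows "(\<forall>\<delta>>0. (\<lambda>N. real (T N (D N) (\<epsilon> N))) \<notin> o(\<lambda>N. real N powr (2 - \<delta>))) \<and>
         (hitting_set_conjecture_io \<longrightarrow>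
           (\<forall>\<delta>>0. (\<lambda>N. real (T N (D N) (\<epsilon> N))) \<in> \<Omega>(\<lambda>N. real N powr (2 - \<delta>))))"
proof (intro conjI allI impI)
  let ?T = "\<lambda>N. T N (D N) (\<epsilon> N)"
  fix \<delta> :: real assume \<delta>: "\<delta> > 0"
  obtain P K \<delta>' N0 where P: "0 < K" "0 < \<delta>'"
    "\<forall>n. solves_hitting_set (word_size (c + 6) n) P n 0 30"
    "\<forall>n\<ge>N0. real (?T n) \<le> real n powr (2 - \<delta>) \<longrightarrow>
      (\<exists>t. solves_hitting_set (word_size (c + 6) n) P n (D n div K) t \<and> real t \<le> real n powr (2 - \<delta>'))"
    using fast_chamfer_gives_fast_hitting_set[OF D \<epsilon>_pos \<epsilon> ALG \<delta>] by metis
  have DK: "(\<lambda>N. real (D N div K)) \<in> \<Theta>(\<lambda>N. ln (real N) ^ 2)"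
    by (rule dimension_div_bigtheta[OF D P(1)])
  show "(\<lambda>N. real (?T N)) \<notin> o(\<lambda>N. real N powr (2 - \<delta>))"
  proof
    assume "(\<lambda>N. real (?T N)) \<in> o(\<lambda>N. real N powr (2 - \<delta>))"
    from landau_o.smallD[OF this zero_less_one]
    obtain N1 where N1: "\<And>n. N1 \<le> n \<Longrightarrow> real (?T n) \<le> real n powr (2 - \<delta>)"
      unfolding eventually_sequentially by auto
    define M where "M = max N0 N1"
    \<comment> \<open>The conjecture speaks of programs correct at every size. Below
      \<open>M\<close>, where nothing is known about the main loop, the dimension is replaced by 0,
      which the solver handles within 30 steps; the asymptotic order of the dimension does not
      notice.\<close>
    define d where "d n = (if n < M then 0 else D n div K)" for n
    have "\<exists>t. solves_hitting_set (word_size (c + 6) n) P n (d n) t \<and> (M \<le> n \<longrightarrow> real t \<le> real n powr (2 - \<delta>'))" for n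
    proof (cases "n < M")
      case True
      then show ?thesis using P(3) by (auto simp: d_def)
    next
      case False
      then have "N0 \<le> n" "N1 \<le> n" by (auto simp: M_def)
      then show ?thesis using P(4) N1 False by (auto simp: d_def)
    qed
    then obtain t where t: "\<And>n. solves_hitting_set (word_size (c + 6) n) P n (d n) (t n)"
      "\<And>n. M \<le> n \<Longrightarrow> real (t n) \<le> real n powr (2 - \<delta>')"
      by metis
    have "eventually (\<lambda>n. real (D n div K) = real (d n)) sequentially"
      using eventually_ge_at_top[of M] by eventually_elim (simp add: d_def)
    then have "(\<lambda>n. real (d n)) \<in> \<Theta>(\<lambda>N. ln (real N) ^ 2)"
      using DK landau_theta.in_cong[of "\<lambda>n. real (D n div K)" "\<lambda>n. real (d n)"] by blast
    moreover have "(\<lambda>n. real (t n)) \<in> O(\<lambda>n. real n powr (2 - \<delta>'))"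
    proof (rule landau_o.bigI[of 1])
      show "eventually (\<lambda>n. norm (real (t n)) \<le> 1 * norm (real n powr (2 - \<delta>'))) sequentially"
        using eventually_ge_at_top[of M] by eventually_elim (use t(2) in simp)
    qed simp
    ultimately show False using HSC t(1) P(2) unfolding hitting_set_conjecture_def by blast
  qed
next
  let ?T = "\<lambda>N. T N (D N) (\<epsilon> N)"
  fix \<delta> :: real assume io: "hitting_set_conjecture_io" and \<delta>: "\<delta> > 0"
  obtain P K \<delta>' N0 where P: "0 < K" "0 < \<delta>'"
    "\<forall>n. solves_hitting_set (word_size (c + 6) n) P n 0 30"
    "\<forall>n\<ge>N0. real (?T n) \<le> real n powr (2 - \<delta>) \<longrightarrow>
      (\<exists>t. solves_hitting_set (word_size (c + 6) n) P n (D n div K) t \<and> real t \<le> real n powr (2 - \<delta>'))"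
    using fast_chamfer_gives_fast_hitting_set[OF D \<epsilon>_pos \<epsilon> ALG \<delta>] by metis
  have DK: "(\<lambda>N. real (D N div K)) \<in> \<Theta>(\<lambda>N. ln (real N) ^ 2)"
    by (rule dimension_div_bigtheta[OF D P(1)])
  show "(\<lambda>N. real (?T N)) \<in> \<Omega>(\<lambda>N. real N powr (2 - \<delta>))"
  proof (rule ccontr)
    assume not: "(\<lambda>N. real (?T N)) \<notin> \<Omega>(\<lambda>N. real N powr (2 - \<delta>))"
    \<comment> \<open>Otherwise the lower bound would hold with constant 1.\<close>
    have "\<not> eventually (\<lambda>n. real n powr (2 - \<delta>) < real (?T n)) sequentially"
    proof
      assume "eventually (\<lambda>n. real n powr (2 - \<delta>) < real (?T n)) sequentially"
      then have "(\<lambda>N. real (?T N)) \<in> \<Omega>(\<lambda>N. real N powr (2 - \<delta>))"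
        by (intro landau_omega.bigI[of 1]) (auto elim!: eventually_mono)
      with not show False by blast
    qed
    then have "\<exists>\<^sub>F n in sequentially. real (?T n) \<le> real n powr (2 - \<delta>)"
      by (simp add: frequently_def not_le)
    then have freq: "\<exists>\<^sub>F n in sequentially. real (?T n) \<le> real n powr (2 - \<delta>) \<and> N0 \<le> n"
      using eventually_ge_at_top[of N0] by (rule frequently_eventually_frequently)
    \<comment> \<open>The refuted statement asks for correctness and speed only at infinitely many
      sizes, so \<open>t\<close> may be arbitrary where the algorithm is slow.\<close>
    have "\<exists>t. real (?T n) \<le> real n powr (2 - \<delta>) \<and> N0 \<le> n \<longrightarrow>
        solves_hitting_set (word_size (c + 6) n) P n (D n div K) t \<and> real t \<le> real n powr (2 - \<delta>')" for n
      using P(4) by blast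
    then obtain t where t: "\<And>n. real (?T n) \<le> real n powr (2 - \<delta>) \<and> N0 \<le> n \<Longrightarrow>
        solves_hitting_set (word_size (c + 6) n) P n (D n div K) (t n) \<and> real (t n) \<le> real n powr (2 - \<delta>')"
      by metis
    from freq have fast: "\<exists>\<^sub>F n in sequentially. solves_hitting_set (word_size (c + 6) n) P n (D n div K) (t n) \<and>
        real (t n) \<le> real n powr (2 - \<delta>')"
      by (rule frequently_mono[rotated]) (use t in blast)
    have "\<exists>P c' t. \<exists>\<^sub>F n in sequentially. solves_hitting_set (word_size c' n) P n (D n div K) (t n) \<and>
        real (t n) \<le> real n powr (2 - \<delta>')"
      by (intro exI) (rule fast)
    then show False
      using io[unfolded hitting_set_conjecture_io_def, rule_format, OF DK P(2)] by simp
  qed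
qed

end
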